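(* Let $c\neq 0$ and let $\Sigma^2$ be a biharmonic surface with constant mean curvature (CMC surface) in $M^3(c)\times\mathbb{R}$, with mean curvature vector field $H\neq 0$ orthogonal to $\xi$ and with $|T|\in(0,1)$, where $T$ is the tangent component of $\xi$. Then $c>0$ and $\Sigma^2$ is a non-pseudo-umbilical CMC biconservative surface which is flat, satisfies $|H|^2>-c(1-|T|^2)$, and is locally given by an isometric immersion $X=X(u,v):D\subset\mathbb{R}^2\to M^3(c)\times\mathbb{R}$, $D$ open, such that the integral curves of $X_u$ and $X_v$ are helices in $M^3(c)\times\mathbb{R}$ satisfying $\langle X_u,\xi\rangle=a$ and $\langle X_v,\xi\rangle=b$, where $a,b$ are two real constants with $0<a^2+b^2=|T|^2<1$ and $|H|^2+c(1-a^2-b^2)>0$, and with curvatures $$\kappa_1^1=|H|+\sqrt{|H|^2+c(1-a^2-b^2)},\qquad \kappa_2^1=\frac{|a|}{\sqrt{1-a^2-b^2}}\,\kappa_1^1$$ and $$\kappa_1^2=\Big||H|-\sqrt{|H|^2+c(1-a^2-b^2)}\Big|,\qquad \kappa_2^2=\frac{|b|}{\sqrt{1-a^2-b^2}}\,\kappa_1^2,$$ respectively; moreover $b^2>a^2$ and $$|H|^2=\frac{c(1-a^2-b^2)(b^2-a^2)^2}{4(1-a^2)(1-b^2)}.$$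
   Context: $M^3(c)$ is the simply-connected $3$-dimensional space form of constant sectional curvature $c$, and $\xi$ is the unit vector field on $M^3(c)\times\mathbb{R}$ tangent to $\mathbb{R}$. Surfaces are isometrically immersed. $\sigma$ is the second fundamental form, $A$ the shape operator, $H=\frac12\mathrm{trace}\,\sigma$ the mean curvature vector field; CMC means $|H|$ is constant. $\Sigma^2$ is pseudo-umbilical if $A_H=|H|^2\,\mathrm{I}$. The surface, with immersion $\psi$, is biharmonic if its bitension field $\tau_2(\psi)=\Delta\tau(\psi)-\mathrm{trace}\,\bar R(d\psi,\tau(\psi))d\psi$ vanishes, and biconservative if the tangent part of $\tau_2(\psi)$ vanishes, where $\tau(\psi)=\mathrm{trace}\,\nabla d\psi=2H$, $\Delta=\mathrm{trace}(\nabla^\psi)^2$ is the rough Laplacian, and $\bar R(X,Y)Z=[\bar\nabla_X,\bar\nabla_Y]Z-\bar\nabla_{[X,Y]}Z$ is the curvature tensor of the ambient space. Biharmonicity is equivalent to the two equations $$-\Delta^\perp H+\mathrm{trace}\,\sigma(\cdot,A_H\cdot)+\mathrm{trace}(\bar R(\cdot,H)\cdot)^\perp=0$$ and $$\mathrm{grad}|H|^2+2\,\mathrm{trace}A_{\nabla^\perp_{\cdot}H}(\cdot)+2\,\mathrm{trace}(\bar R(\cdot,H)\cdot)^\top=0,$$ where $\nabla^\perp$ and $\Delta^\perp$ are the connection and the Laplacian in the normal bundle; biconservativity is equivalent to the second equation alone. A helix is a unit-speed curve $\gamma$ with orthonormal vector fields $X_1=\gamma',X_2,X_3$ along it such that $\bar\nabla_{X_1}X_1=\kappa_1X_2$,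 $\bar\nabla_{X_1}X_2=-\kappa_1X_1+\kappa_2X_3$, $\bar\nabla_{X_1}X_3=-\kappa_2X_2$ with positive constants $\kappa_1,\kappa_2$, called its curvatures. In the claim, $\kappa_1^1,\kappa_2^1$ are the curvatures of the integral curves of $X_u$, and $\kappa_1^2,\kappa_2^2$ those of the integral curves of $X_v$.
   Formalization: When a = 0, which does occur, the integral curves of X_u cannot be helices with positive second curvature; in that case they are stated to satisfy the same Frenet equations with first curvature κ_1^1 > 0 and second curvature κ_2^1 = 0. *)

theory Defs
  imports "HOL-Analysis.Analysis"
begin

section \<open>Smooth maps\<close>

fun continuously_differentiable_on ::
  "nat \<Rightarrow> 'a::real_normed_vector set \<Rightarrow> ('a \<Rightarrow> 'b::real_normed_vector) \<Rightarrow> bool" where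
  "continuously_differentiable_on 0 S f \<longleftrightarrow> continuous_on S f"
| "continuously_differentiable_on (Suc k) S f \<longleftrightarrow>
     (\<forall>x\<in>S. f differentiable (at x)) \<and>
     (\<forall>v. continuously_differentiable_on k S (\<lambda>x. frechet_derivative f (at x) v))"

text \<open>To be used on open sets only.\<close>

definition smooth_on :: "'a::real_normed_vector set \<Rightarrow> ('a \<Rightarrow> 'b::real_normed_vector) \<Rightarrow> bool" where
  "smooth_on S f \<longleftrightarrow> (\<forall>k. continuously_differentiable_on k S f)"

abbreviation dd :: "('a::real_normed_vector \<Rightarrow> 'b::real_normed_vector) \<Rightarrow> 'a \<Rightarrow> 'a \<Rightarrow> 'b" where
  "dd f p v \<equiv> frechet_derivative f (at p) v"


section \<open>The ambient space\<close>

text \<open>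
  For \<open>c \<noteq> 0\<close> the simply connected space form of curvature \<open>c\<close> is realised as a hypersurface of
  \<open>\<real> \<times> \<real>\<^sup>3\<close>: the round sphere of radius \<open>1 / sqrt c\<close> in Euclidean space if \<open>c > 0\<close>, and the
  upper sheet of the hyperboloid in Minkowski space if \<open>c < 0\<close>. (For \<open>c = 0\<close> nothing below
  is meaningful.) The product with the real line lies in the following type; its metric is the
  restriction of the possibly indefinite form \<open>inn c\<close>, which is positive definite on
  tangent spaces.
\<close>

type_synonym ambient = "(real \<times> (real^3)) \<times> real"

definition space_form :: "real \<Rightarrow> (real \<times> (real^3)) set" where
  "space_form c = {x. sgn c * (fst x)\<^sup>2 + snd x \<bullet> snd x = 1 / c \<and> (c < 0 \<longrightarrow> fst x > 0)}"

definition inn :: "real \<Rightarrow> ambient \<Rightarrow> ambient \<Rightarrow> real" where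
  "inn c v w = sgn c * fst (fst v) * fst (fst w) + snd (fst v) \<bullet> snd (fst w) + snd v * snd w"

definition len :: "real \<Rightarrow> ambient \<Rightarrow> real" where
  "len c v = sqrt (inn c v v)"

definition xi :: ambient where
  "xi = (0, 1)"

text \<open>
  At a point \<open>q\<close> of the ambient space, \<open>(fst q, 0)\<close> spans the normal line and has square \<open>1 / c\<close>,
  so that \<open>tproj c q\<close> is the orthogonal projection onto the tangent space.
\<close>

definition tproj :: "real \<Rightarrow> ambient \<Rightarrow> ambient \<Rightarrow> ambient" where
  "tproj c q w = w - (c * inn c w (fst q, 0)) *\<^sub>R (fst q, 0)"

definition tangent_at :: "real \<Rightarrow> ambient \<Rightarrow> ambient \<Rightarrow> bool" where
  "tangent_at c q w \<longleftrightarrow> inn c w (fst q, 0) = 0"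

text \<open>
  The Levi-Civita connection is the tangential part of the flat derivative. Vector fields are
  given by extensions to the surrounding vector space, on which the result does not depend.
\<close>

definition amb_cov :: "real \<Rightarrow> (ambient \<Rightarrow> ambient) \<Rightarrow> (ambient \<Rightarrow> ambient) \<Rightarrow> ambient \<Rightarrow> ambient" where
  "amb_cov c V W q = tproj c q (dd W q (V q))"

definition bracket :: "('a::real_normed_vector \<Rightarrow> 'a) \<Rightarrow> ('a \<Rightarrow> 'a) \<Rightarrow> 'a \<Rightarrow> 'a" where
  "bracket V W q = dd W q (V q) - dd V q (W q)"

definition amb_curv_field ::
  "real \<Rightarrow> (ambient \<Rightarrow> ambient) \<Rightarrow> (ambient \<Rightarrow> ambient) \<Rightarrow> (ambient \<Rightarrow> ambient) \<Rightarrow> ambient \<Rightarrow> ambient" where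
  "amb_curv_field c V W Z q =
     amb_cov c V (amb_cov c W Z) q - amb_cov c W (amb_cov c V Z) q - amb_cov c (bracket V W) Z q"

text \<open>
  The curvature tensor on tangent vectors at \<open>q\<close>: by tensoriality any tangent fields extending
  them may be used; here a vector \<open>x\<close> is extended by the field \<open>r \<mapsto> tproj c r x\<close>.
\<close>

definition amb_curv :: "real \<Rightarrow> ambient \<Rightarrow> ambient \<Rightarrow> ambient \<Rightarrow> ambient \<Rightarrow> ambient" where
  "amb_curv c q x y z =
     amb_curv_field c (\<lambda>r. tproj c r x) (\<lambda>r. tproj c r y) (\<lambda>r. tproj c r z) q"


section \<open>Immersed coordinate patches\<close>

text \<open>
  In this section \<open>f\<close> is a patch, defined near a point \<open>p\<close> of the coordinate plane. Tangent vectors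
  of the surface are represented by their coordinate vectors \<open>x\<close>, so that \<open>dd f p x\<close> is the
  corresponding ambient vector.
\<close>

type_synonym plane = "real \<times> real"

definition immersion :: "real \<Rightarrow> plane set \<Rightarrow> (plane \<Rightarrow> ambient) \<Rightarrow> bool" where
  "immersion c D f \<longleftrightarrow> smooth_on D f \<and> f ` D \<subseteq> space_form c \<times> UNIV \<and> (\<forall>p\<in>D. inj (dd f p))"

definition fff :: "real \<Rightarrow> (plane \<Rightarrow> ambient) \<Rightarrow> plane \<Rightarrow> plane \<Rightarrow> plane \<Rightarrow> real" where
  "fff c f p x y = inn c (dd f p x) (dd f p y)"

definition isometric_immersion :: "real \<Rightarrow> plane set \<Rightarrow> (plane \<Rightarrow> ambient) \<Rightarrow> bool" where
  "isometric_immersion c D f \<longleftrightarrow> immersion c D f \<and> (\<forall>p\<in>D. \<forall>x y. fff c f p x y = x \<bullet> y)"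

text \<open>
  Trace of a bilinear map with respect to the induced metric, i.e. contraction with the inverse
  of the matrix of the first fundamental form.
\<close>

definition metric_trace ::
  "real \<Rightarrow> (plane \<Rightarrow> ambient) \<Rightarrow> plane \<Rightarrow> (plane \<Rightarrow> plane \<Rightarrow> 'v::real_vector) \<Rightarrow> 'v" where
  "metric_trace c f p b =
     (let e1 = (1, 0); e2 = (0, 1);
          E = fff c f p e1 e1; F = fff c f p e1 e2; G = fff c f p e2 e2
      in (1 / (E * G - F\<^sup>2)) *\<^sub>R (G *\<^sub>R b e1 e1 - F *\<^sub>R (b e1 e2 + b e2 e1) + E *\<^sub>R b e2 e2))"

text \<open>Levi-Civita connection of the induced metric; \<open>christoffel c f p x y\<close> is the covariant
  derivative of the constant field \<open>y\<close> in direction \<open>x\<close> (Koszul formula).\<close>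

definition christoffel :: "real \<Rightarrow> (plane \<Rightarrow> ambient) \<Rightarrow> plane \<Rightarrow> plane \<Rightarrow> plane \<Rightarrow> plane" where
  "christoffel c f p x y = metric_trace c f p (\<lambda>z w.
     ((dd (\<lambda>q. fff c f q y z) p x + dd (\<lambda>q. fff c f q x z) p y - dd (\<lambda>q. fff c f q x y) p z) / 2)
       *\<^sub>R w)"

definition surf_cov :: "real \<Rightarrow> (plane \<Rightarrow> ambient) \<Rightarrow> (plane \<Rightarrow> plane) \<Rightarrow> (plane \<Rightarrow> plane) \<Rightarrow> plane \<Rightarrow> plane" where
  "surf_cov c f V W p = dd W p (V p) + christoffel c f p (V p) (W p)"

definition surf_curv_field ::
  "real \<Rightarrow> (plane \<Rightarrow> ambient) \<Rightarrow> (plane \<Rightarrow> plane) \<Rightarrow> (plane \<Rightarrow> plane) \<Rightarrow> (plane \<Rightarrow> plane) \<Rightarrow> plane \<Rightarrow> plane" where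
  "surf_curv_field c f V W Z p =
     surf_cov c f V (surf_cov c f W Z) p - surf_cov c f W (surf_cov c f V Z) p
       - surf_cov c f (bracket V W) Z p"

definition flat_at :: "real \<Rightarrow> (plane \<Rightarrow> ambient) \<Rightarrow> plane \<Rightarrow> bool" where
  "flat_at c f p \<longleftrightarrow> (\<forall>x y z. surf_curv_field c f (\<lambda>_. x) (\<lambda>_. y) (\<lambda>_. z) p = 0)"

definition tang :: "real \<Rightarrow> (plane \<Rightarrow> ambient) \<Rightarrow> plane \<Rightarrow> ambient \<Rightarrow> ambient" where
  "tang c f p w = metric_trace c f p (\<lambda>x y. inn c w (dd f p x) *\<^sub>R dd f p y)"

text \<open>Pull-back connection: derivative of a section \<open>W\<close> along \<open>f\<close> in direction \<open>x\<close>.\<close>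

definition pcov :: "real \<Rightarrow> (plane \<Rightarrow> ambient) \<Rightarrow> (plane \<Rightarrow> ambient) \<Rightarrow> plane \<Rightarrow> plane \<Rightarrow> ambient" where
  "pcov c f W p x = tproj c (f p) (dd W p x)"

definition second_ff :: "real \<Rightarrow> (plane \<Rightarrow> ambient) \<Rightarrow> plane \<Rightarrow> plane \<Rightarrow> plane \<Rightarrow> ambient" where
  "second_ff c f p x y =
     (let w = pcov c f (\<lambda>q. dd f q y) p x in w - tang c f p w)"

definition mean_curv :: "real \<Rightarrow> (plane \<Rightarrow> ambient) \<Rightarrow> plane \<Rightarrow> ambient" where
  "mean_curv c f p = (1 / 2) *\<^sub>R metric_trace c f p (second_ff c f p)"

definition shape_op :: "real \<Rightarrow> (plane \<Rightarrow> ambient) \<Rightarrow> plane \<Rightarrow> ambient \<Rightarrow> plane \<Rightarrow> plane" where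
  "shape_op c f p \<eta> x = metric_trace c f p (\<lambda>y z. inn c (second_ff c f p x y) \<eta> *\<^sub>R z)"

definition tension :: "real \<Rightarrow> (plane \<Rightarrow> ambient) \<Rightarrow> plane \<Rightarrow> ambient" where
  "tension c f p = metric_trace c f p (\<lambda>x y.
     pcov c f (\<lambda>q. dd f q y) p x - dd f p (christoffel c f p x y))"

definition rough_laplacian :: "real \<Rightarrow> (plane \<Rightarrow> ambient) \<Rightarrow> (plane \<Rightarrow> ambient) \<Rightarrow> plane \<Rightarrow> ambient" where
  "rough_laplacian c f W p = metric_trace c f p (\<lambda>x y.
     pcov c f (\<lambda>q. pcov c f W q y) p x - pcov c f W p (christoffel c f p x y))"

definition bitension :: "real \<Rightarrow> (plane \<Rightarrow> ambient) \<Rightarrow> plane \<Rightarrow> ambient" where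
  "bitension c f p = rough_laplacian c f (tension c f) p -
     metric_trace c f p (\<lambda>x y. amb_curv c (f p) (dd f p x) (tension c f p) (dd f p y))"

definition T_part :: "real \<Rightarrow> (plane \<Rightarrow> ambient) \<Rightarrow> plane \<Rightarrow> ambient" where
  "T_part c f p = tang c f p xi"


section \<open>Surfaces\<close>

text \<open>
  A local parametrization is an inverse chart: a homeomorphism \<open>x\<close> from an open set \<open>D\<close> of the
  coordinate plane onto an open set of the surface. An atlas is a set of pairs \<open>(D, x)\<close>; it need
  not be maximal.
\<close>

definition local_param :: "'s topology \<Rightarrow> plane set \<Rightarrow> (plane \<Rightarrow> 's) \<Rightarrow> bool" where
  "local_param S D x \<longleftrightarrow> open D \<and> openin S (x ` D) \<and>
     homeomorphic_map (top_of_set D) (subtopology S (x ` D)) x"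

definition compatible :: "plane set \<Rightarrow> (plane \<Rightarrow> 's) \<Rightarrow> plane set \<Rightarrow> (plane \<Rightarrow> 's) \<Rightarrow> bool" where
  "compatible D x E y \<longleftrightarrow>
     smooth_on {p \<in> D. x p \<in> y ` E} (inv_into E y \<circ> x) \<and>
     smooth_on {p \<in> E. y p \<in> x ` D} (inv_into D x \<circ> y)"

definition smooth_surface :: "'s topology \<Rightarrow> (plane set \<times> (plane \<Rightarrow> 's)) set \<Rightarrow> bool" where
  "smooth_surface S A \<longleftrightarrow>
     Hausdorff_space S \<and> second_countable S \<and> connected_space S \<and> topspace S \<noteq> {} \<and>
     (\<forall>(D, x)\<in>A. local_param S D x) \<and>
     (\<Union>(D, x)\<in>A. x ` D) = topspace S \<and>
     (\<forall>(D, x)\<in>A. \<forall>(E, y)\<in>A. compatible D x E y)"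

text \<open>
  The surface always carries the metric induced by \<open>\<psi>\<close>, so that being isometrically immersed
  amounts to \<open>\<psi>\<close> being a smooth immersion.
\<close>

definition immersed_surface ::
  "real \<Rightarrow> 's topology \<Rightarrow> (plane set \<times> (plane \<Rightarrow> 's)) set \<Rightarrow> ('s \<Rightarrow> ambient) \<Rightarrow> bool" where
  "immersed_surface c S A \<psi> \<longleftrightarrow>
     smooth_surface S A \<and> (\<forall>(D, x)\<in>A. immersion c D (\<psi> \<circ> x))"

text \<open>A chart-independent pointwise property holds at every point of the surface.\<close>

definition everywhere ::
  "(plane set \<times> (plane \<Rightarrow> 's)) set \<Rightarrow> ('s \<Rightarrow> ambient) \<Rightarrow> ((plane \<Rightarrow> ambient) \<Rightarrow> plane \<Rightarrow> bool) \<Rightarrow> bool" where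
  "everywhere A \<psi> P \<longleftrightarrow> (\<forall>(D, x)\<in>A. \<forall>p\<in>D. P (\<psi> \<circ> x) p)"

definition biharmonic ::
  "real \<Rightarrow> (plane set \<times> (plane \<Rightarrow> 's)) set \<Rightarrow> ('s \<Rightarrow> ambient) \<Rightarrow> bool" where
  "biharmonic c A \<psi> \<longleftrightarrow> everywhere A \<psi> (\<lambda>f p. bitension c f p = 0)"

definition biconservative ::
  "real \<Rightarrow> (plane set \<times> (plane \<Rightarrow> 's)) set \<Rightarrow> ('s \<Rightarrow> ambient) \<Rightarrow> bool" where
  "biconservative c A \<psi> \<longleftrightarrow> everywhere A \<psi> (\<lambda>f p. tang c f p (bitension c f p) = 0)"

text \<open>The mean curvature \<open>|H|\<close> is constant with value \<open>h\<close>.\<close>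

definition cmc ::
  "real \<Rightarrow> (plane set \<times> (plane \<Rightarrow> 's)) set \<Rightarrow> ('s \<Rightarrow> ambient) \<Rightarrow> real \<Rightarrow> bool" where
  "cmc c A \<psi> h \<longleftrightarrow> everywhere A \<psi> (\<lambda>f p. len c (mean_curv c f p) = h)"

definition pseudo_umbilical ::
  "real \<Rightarrow> (plane set \<times> (plane \<Rightarrow> 's)) set \<Rightarrow> ('s \<Rightarrow> ambient) \<Rightarrow> bool" where
  "pseudo_umbilical c A \<psi> \<longleftrightarrow> everywhere A \<psi> (\<lambda>f p.
     \<forall>x. shape_op c f p (mean_curv c f p) x = (len c (mean_curv c f p))\<^sup>2 *\<^sub>R x)"

definition flat ::
  "real \<Rightarrow> (plane set \<times> (plane \<Rightarrow> 's)) set \<Rightarrow> ('s \<Rightarrow> ambient) \<Rightarrow> bool" where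
  "flat c A \<psi> \<longleftrightarrow> everywhere A \<psi> (flat_at c)"


section \<open>Curves\<close>

definition curve_cov :: "real \<Rightarrow> (real \<Rightarrow> ambient) \<Rightarrow> (real \<Rightarrow> ambient) \<Rightarrow> real \<Rightarrow> ambient" where
  "curve_cov c \<gamma> V t = tproj c (\<gamma> t) (vector_derivative V (at t))"

definition frenet_curve :: "real \<Rightarrow> real set \<Rightarrow> (real \<Rightarrow> ambient) \<Rightarrow> real \<Rightarrow> real \<Rightarrow> bool" where
  "frenet_curve c I \<gamma> \<kappa>1 \<kappa>2 \<longleftrightarrow>
     smooth_on I \<gamma> \<and> \<gamma> ` I \<subseteq> space_form c \<times> UNIV \<and>
     (\<exists>X1 X2 X3. smooth_on I X1 \<and> smooth_on I X2 \<and> smooth_on I X3 \<and>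
        (\<forall>t\<in>I.
          X1 t = vector_derivative \<gamma> (at t) \<and>
          tangent_at c (\<gamma> t) (X2 t) \<and> tangent_at c (\<gamma> t) (X3 t) \<and>
          inn c (X1 t) (X1 t) = 1 \<and> inn c (X2 t) (X2 t) = 1 \<and> inn c (X3 t) (X3 t) = 1 \<and>
          inn c (X1 t) (X2 t) = 0 \<and> inn c (X1 t) (X3 t) = 0 \<and> inn c (X2 t) (X3 t) = 0 \<and>
          curve_cov c \<gamma> X1 t = \<kappa>1 *\<^sub>R X2 t \<and>
          curve_cov c \<gamma> X2 t = - \<kappa>1 *\<^sub>R X1 t + \<kappa>2 *\<^sub>R X3 t \<and>
          curve_cov c \<gamma> X3 t = - \<kappa>2 *\<^sub>R X2 t))"

definition helix :: "real \<Rightarrow> real set \<Rightarrow> (real \<Rightarrow> ambient) \<Rightarrow> real \<Rightarrow> real \<Rightarrow> bool" where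
  "helix c I \<gamma> \<kappa>1 \<kappa>2 \<longleftrightarrow> 0 < \<kappa>1 \<and> 0 < \<kappa>2 \<and> frenet_curve c I \<gamma> \<kappa>1 \<kappa>2"

text \<open>
  The degenerate case of a helix with vanishing second curvature. It cannot be avoided for curves
  orthogonal to \<open>xi\<close>, which a biharmonic surface as considered here may contain.
\<close>

definition circle :: "real \<Rightarrow> real set \<Rightarrow> (real \<Rightarrow> ambient) \<Rightarrow> real \<Rightarrow> bool" where
  "circle c I \<gamma> \<kappa>1 \<longleftrightarrow> 0 < \<kappa>1 \<and> frenet_curve c I \<gamma> \<kappa>1 0"

text \<open>In coordinates, \<open>X\<^sub>u\<close> and \<open>X\<^sub>v\<close> are the constant fields \<open>(1, 0)\<close> and \<open>(0, 1)\<close>.\<close>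

definition integral_curve :: "plane set \<Rightarrow> plane \<Rightarrow> real set \<Rightarrow> (real \<Rightarrow> plane) \<Rightarrow> bool" where
  "integral_curve D e I \<alpha> \<longleftrightarrow> open I \<and> is_interval I \<and>
     (\<forall>t\<in>I. \<alpha> t \<in> D \<and> (\<alpha> has_vector_derivative e) (at t))"

end

theory Submission
  imports Defs
begin

text \<open>
  Since \<open>H\<close> is orthogonal to \<open>\<xi>\<close>, the height function is harmonic on the surface; together with a
  harmonic conjugate it gives isothermal coordinates with metric \<open>\<rho>(du\<^sup>2 + dv\<^sup>2)\<close>, \<open>\<rho> = 1 / |T|\<^sup>2\<close>.
  The normal bundle is spanned by \<open>H\<close> and the normal part \<open>N\<close> of \<open>\<xi>\<close>; in these coordinates the shape
  operator of \<open>N\<close> is given by the gradient of \<open>\<rho>\<close> and the normal connection by the first row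
  \<open>(b\<^sub>1\<^sub>1, b\<^sub>1\<^sub>2)\<close> of the matrix of \<open>\<langle>\<sigma>, \<tau>\<rangle>\<close>. The tangent part of the biharmonic equation becomes
  \<open>(b\<^sub>1\<^sub>1\<^sup>2 + b\<^sub>1\<^sub>2\<^sup>2) |grad \<rho>|\<^sup>2 = 0\<close>. Where \<open>grad \<rho> \<noteq> 0\<close> the normal part would therefore determine \<open>\<rho>\<close>
  as a constant, so \<open>\<rho>\<close> is locally constant. The Gauss equation, the normal part and the trace then
  determine \<open>b\<close>, hence the principal directions of \<open>A\<^sub>H\<close>, which are the parallel fields \<open>X\<^sub>u\<close>, \<open>X\<^sub>v\<close>.
\<close>

section \<open>Calculus of smooth maps\<close>

text \<open>Written with normal connection and normal Laplacian, the biharmonic equation is awkward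
  to handle. The ambient space is therefore kept inside a five-dimensional flat space, where
  covariant derivatives are ordinary ones followed by \<open>tproj\<close>. Because the tension
  field has no component along \<open>xi\<close>, its ordinary derivative is already tangent to the
  ambient space, and biharmonicity becomes one equation for the flat Laplacian of
  \<open>\<tau>\<close>: it equals \<open>- c (2 - |T|^2) \<tau>\<close> up to a multiple of the
  position vector. Pairing with \<open>\<tau>\<close> and with the coordinate fields gives the
  normal and the tangent part; third derivatives of the immersion enter only through the derivative
  of its Laplacian. The square of the mixed entry of \<open>b\<close> is a positive multiple of
  \<open>c - 4 h^2 \<rho>^2\<close>. Its nonnegativity makes the coefficient \<open>a\<close> real,
  and \<open>a = 0\<close> is the equality case, which accounts for the circles in the statement.
  The charts give only local constancy of \<open>|T|\<close>; connectedness turns \<open>a\<close>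
  and \<open>b\<close>, both taken nonnegative, into constants of the whole surface.\<close>

lemma dd_eqI: "(f has_derivative f') (at x) \<Longrightarrow> dd f x v = f' v"
  using frechet_derivative_at by metis

lemma has_derivative_cong_open:
  assumes "open S" "x \<in> S" "\<And>y. y \<in> S \<Longrightarrow> f y = g y"
  shows "(f has_derivative f') (at x) \<longleftrightarrow> (g has_derivative f') (at x)"
  using assms has_derivative_transform_within_open by (metis (no_types, lifting))

lemma dd_cong_open:
  assumes "open S" "x \<in> S" "\<And>y. y \<in> S \<Longrightarrow> f y = g y"
  shows "dd f x v = dd g x v"
  unfolding frechet_derivative_def using has_derivative_cong_open[of S x f g] assms by simp

lemma differentiable_cong_open:
  assumes "open S" "x \<in> S" "\<And>y. y \<in> S \<Longrightarrow> f y = g y" "f differentiable (at x)"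
  shows "g differentiable (at x)"
  using has_derivative_cong_open[of S x f g] assms unfolding differentiable_def by blast

lemma continuously_differentiable_on_Suc_has_derivative:
  "continuously_differentiable_on (Suc k) S f \<Longrightarrow> x \<in> S \<Longrightarrow> (f has_derivative dd f x) (at x)"
  using frechet_derivative_works by auto

lemma continuously_differentiable_on_Suc_dd:
  "continuously_differentiable_on (Suc k) S f \<Longrightarrow> continuously_differentiable_on k S (\<lambda>x. dd f x v)"
  by simp

lemma continuously_differentiable_on_cong:
  assumes "open S" "\<And>x. x \<in> S \<Longrightarrow> f x = g x" "continuously_differentiable_on k S f"
  shows "continuously_differentiable_on k S g"
  using assms(2,3)
proof (induction k arbitrary: f g)
  case 0
  then show ?case by (metis continuous_on_cong continuously_differentiable_on.simps(1))
next
  case (Suc k)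
  have "continuously_differentiable_on k S (\<lambda>x. dd g x v)" for v
    by (rule Suc.IH[of "\<lambda>x. dd f x v"]) (use Suc.prems dd_cong_open[of S _ f g] assms(1) in auto)
  moreover have "g differentiable (at x)" if "x \<in> S" for x
    using differentiable_cong_open[of S x f g] assms(1) Suc.prems that by auto
  ultimately show ?case by simp
qed

lemma smooth_on_cong:
  assumes "open S" "\<And>x. x \<in> S \<Longrightarrow> f x = g x"
  shows "smooth_on S f \<longleftrightarrow> smooth_on S g"
  unfolding smooth_on_def
  using continuously_differentiable_on_cong[OF assms(1)] assms(2) by metis

lemma continuously_differentiable_on_subset:
  "T \<subseteq> S \<Longrightarrow> continuously_differentiable_on k S f \<Longrightarrow> continuously_differentiable_on k T f"
  by (induction k arbitrary: f) (auto intro: continuous_on_subset)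

lemma smooth_on_subset: "smooth_on S f \<Longrightarrow> T \<subseteq> S \<Longrightarrow> smooth_on T f"
  unfolding smooth_on_def using continuously_differentiable_on_subset by blast

lemma smooth_on_locally:
  assumes "\<And>x. x \<in> S \<Longrightarrow> \<exists>T. open T \<and> x \<in> T \<and> smooth_on T f"
  shows "smooth_on S f"
  unfolding smooth_on_def
proof
  fix k
  from assms have "\<And>x. x \<in> S \<Longrightarrow> \<exists>T. open T \<and> x \<in> T \<and> continuously_differentiable_on k T f"
    unfolding smooth_on_def by blast
  then show "continuously_differentiable_on k S f"
  proof (induction k arbitrary: f)
    case 0
    then have "continuous (at x) f" if "x \<in> S" for x
      by (metis continuous_on_eq_continuous_at continuously_differentiable_on.simps(1) that)
    then show ?case by (simp add: continuous_at_imp_continuous_on)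
  next
    case (Suc k)
    have "continuously_differentiable_on k S (\<lambda>x. dd f x v)" for v
      by (rule Suc.IH) (use Suc.prems in force)
    then show ?case using Suc.prems by fastforce
  qed
qed

lemma smooth_on_imp_differentiable:
  "smooth_on S f \<Longrightarrow> x \<in> S \<Longrightarrow> f differentiable (at x)"
  unfolding smooth_on_def using continuously_differentiable_on.simps(2)[of 0 S f] by blast

lemma smooth_on_imp_has_derivative:
  "smooth_on S f \<Longrightarrow> x \<in> S \<Longrightarrow> (f has_derivative dd f x) (at x)"
  using smooth_on_imp_differentiable frechet_derivative_works by blast

lemma smooth_on_imp_continuous_on: "smooth_on S f \<Longrightarrow> continuous_on S f"
  unfolding smooth_on_def using continuously_differentiable_on.simps(1) by blast

lemma smooth_on_dd: "smooth_on S f \<Longrightarrow> smooth_on S (\<lambda>x. dd f x v)"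
  unfolding smooth_on_def using continuously_differentiable_on_Suc_dd by blast

lemma linear_dd: "smooth_on S f \<Longrightarrow> x \<in> S \<Longrightarrow> linear (dd f x)"
  using smooth_on_imp_has_derivative has_derivative_linear by blast

lemma continuously_differentiable_on_SucD:
  "continuously_differentiable_on (Suc k) S f \<Longrightarrow> continuously_differentiable_on k S f"
proof (induction k arbitrary: f)
  case 0
  then show ?case
    by (simp add: continuous_at_imp_continuous_on differentiable_imp_continuous_within)
qed auto

text \<open>Any formula \<open>f'\<close> for the derivative on \<open>S\<close> may replace
  \<open>frechet_derivative\<close> in the recursive definition, since on an open set both have the
  same derivatives.\<close>

lemma continuously_differentiable_on_SucI:
  assumes "open S" "\<And>x. x \<in> S \<Longrightarrow> (f has_derivative f' x) (at x)"
    "\<And>v. continuously_differentiable_on k S (\<lambda>x. f' x v)"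
  shows "continuously_differentiable_on (Suc k) S f"
proof -
  have "continuously_differentiable_on k S (\<lambda>x. dd f x v)" for v
    by (rule continuously_differentiable_on_cong[OF assms(1) _ assms(3)[of v]])
      (metis assms(2) dd_eqI)
  then show ?thesis using assms(2) by (auto simp: differentiable_def)
qed

text \<open>Order \<open>k\<close> of the directional derivatives gives order \<open>Suc k\<close>
  of \<open>f\<close>; dropping one order again covers every order, including 0.\<close>

lemma smooth_onI:
  assumes "open S" "\<And>x. x \<in> S \<Longrightarrow> (f has_derivative f' x) (at x)"
    "\<And>v. smooth_on S (\<lambda>x. f' x v)"
  shows "smooth_on S f"
  using continuously_differentiable_on_SucI[OF assms(1,2)] assms(3)
    continuously_differentiable_on_SucD
  unfolding smooth_on_def by blast

lemma continuously_differentiable_on_const: "continuously_differentiable_on k S (\<lambda>x. a)"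
  by (induction k arbitrary: a) auto

lemma continuously_differentiable_on_linear:
  assumes "open S" "bounded_linear L" "continuously_differentiable_on k S f"
  shows "continuously_differentiable_on k S (\<lambda>x. L (f x))"
  using assms(3)
proof (induction k arbitrary: f)
  case 0
  then show ?case using bounded_linear.continuous_on[OF assms(2)] by simp
next
  case (Suc k)
  have *: "((\<lambda>x. L (f x)) has_derivative (\<lambda>h. L (dd f x h))) (at x)" if "x \<in> S" for x
    by (rule bounded_linear.has_derivative[OF assms(2)
          continuously_differentiable_on_Suc_has_derivative[OF Suc.prems that]])
  show ?case
    by (rule continuously_differentiable_on_SucI[OF assms(1)], erule *)
      (intro Suc.IH continuously_differentiable_on_Suc_dd Suc.prems)
qed

lemma continuously_differentiable_on_add:
  assumes "open S" "continuously_differentiable_on k S f" "continuously_differentiable_on k S g"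
  shows "continuously_differentiable_on k S (\<lambda>x. f x + g x)"
  using assms(2,3)
proof (induction k arbitrary: f g)
  case 0
  then show ?case by (simp add: continuous_on_add)
next
  case (Suc k)
  have *: "((\<lambda>x. f x + g x) has_derivative (\<lambda>h. dd f x h + dd g x h)) (at x)" if "x \<in> S" for x
    by (rule has_derivative_add[OF
        continuously_differentiable_on_Suc_has_derivative[OF Suc.prems(1) that]
        continuously_differentiable_on_Suc_has_derivative[OF Suc.prems(2) that]])
  show ?case
    by (rule continuously_differentiable_on_SucI[OF assms(1)], erule *)
      (intro Suc.IH continuously_differentiable_on_Suc_dd Suc.prems)
qed

lemma continuously_differentiable_on_sum:
  assumes "open S" "\<And>i. i \<in> I \<Longrightarrow> continuously_differentiable_on k S (f i)"
  shows "continuously_differentiable_on k S (\<lambda>x. \<Sum>i\<in>I. f i x)"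
  using assms(2)
  by (induction I rule: infinite_finite_induct)
    (auto intro!: continuously_differentiable_on_add assms(1) continuously_differentiable_on_const)

lemma continuously_differentiable_on_bilinear:
  assumes "open S" "bounded_bilinear B"
    "continuously_differentiable_on k S f" "continuously_differentiable_on k S g"
  shows "continuously_differentiable_on k S (\<lambda>x. B (f x) (g x))"
  using assms(3,4)
proof (induction k arbitrary: f g)
  case 0
  then show ?case using bounded_bilinear.continuous_on[OF assms(2)] by simp
next
  case (Suc k)
  have *: "((\<lambda>x. B (f x) (g x)) has_derivative (\<lambda>h. B (f x) (dd g x h) + B (dd f x h) (g x))) (at x)"
    if "x \<in> S" for x
    by (rule bounded_bilinear.FDERIV[OF assms(2)
        continuously_differentiable_on_Suc_has_derivative[OF Suc.prems(1) that]
        continuously_differentiable_on_Suc_has_derivative[OF Suc.prems(2) that]])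
  show ?case
    by (rule continuously_differentiable_on_SucI[OF assms(1)], erule *)
      (intro continuously_differentiable_on_add assms(1) Suc.IH continuously_differentiable_on_Suc_dd
        continuously_differentiable_on_SucD[OF Suc.prems(1)]
        continuously_differentiable_on_SucD[OF Suc.prems(2)] Suc.prems)
qed

text \<open>The recursion differentiates along fixed vectors, but the chain rule differentiates
  \<open>g\<close> along \<open>dd f x h\<close>, which moves with \<open>x\<close>. Expanding this
  vector in \<open>Basis\<close> restores fixed directions, so that the induction hypothesis applies
  to the partial derivatives of \<open>g\<close>.\<close>

lemma continuously_differentiable_on_compose:
  fixes f :: "'a::real_normed_vector \<Rightarrow> 'b::euclidean_space"
  assumes "open S" "open T" "f ` S \<subseteq> T"
    "continuously_differentiable_on k S f" "continuously_differentiable_on k T g"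
  shows "continuously_differentiable_on k S (\<lambda>x. g (f x))"
  using assms(4,5)
proof (induction k arbitrary: g)
  case 0
  then show ?case using assms(3) by (auto intro: continuous_on_compose2)
next
  case (Suc k)
  have "((\<lambda>x. g (f x)) has_derivative (\<lambda>h. \<Sum>b\<in>Basis. (dd f x h \<bullet> b) *\<^sub>R dd g (f x) b)) (at x)"
    if "x \<in> S" for x
  proof -
    have *: "(f has_derivative dd f x) (at x)" "(g has_derivative dd g (f x)) (at (f x))"
      by (rule continuously_differentiable_on_Suc_has_derivative[OF Suc.prems(1) that])
        (rule continuously_differentiable_on_Suc_has_derivative[OF Suc.prems(2)],
          use that assms(3) in blast)
    have 1: "dd g (f x) w = (\<Sum>b\<in>Basis. (w \<bullet> b) *\<^sub>R dd g (f x) b)" for w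
      by (subst euclidean_representation[symmetric, of w])
        (simp del: euclidean_representation add: linear_sum[OF has_derivative_linear[OF *(2)]]
          linear_scale[OF has_derivative_linear[OF *(2)]])
    show ?thesis by (rule has_derivative_eq_rhs[OF has_derivative_compose[OF *]]) (rule ext, rule 1)
  qed
  then show ?case
  proof (rule continuously_differentiable_on_SucI[OF assms(1)])
    fix v
    show "continuously_differentiable_on k S
        (\<lambda>x. \<Sum>b\<in>Basis. (dd f x v \<bullet> b) *\<^sub>R dd g (f x) b)"
      by (intro continuously_differentiable_on_sum assms(1)
          continuously_differentiable_on_bilinear[OF _ bounded_bilinear_scaleR]
          continuously_differentiable_on_linear[OF _ bounded_linear_inner_left]
          continuously_differentiable_on_Suc_dd Suc.prems Suc.IH
          continuously_differentiable_on_SucD[OF Suc.prems(1)])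
  qed
qed

section \<open>Closure properties of smooth maps\<close>

named_theorems smooth_intros

lemma smooth_on_const [smooth_intros]: "smooth_on S (\<lambda>x. a)"
  unfolding smooth_on_def using continuously_differentiable_on_const by blast

lemma smooth_on_bounded_linear:
  "open S \<Longrightarrow> bounded_linear L \<Longrightarrow> smooth_on S f \<Longrightarrow> smooth_on S (\<lambda>x. L (f x))"
  unfolding smooth_on_def using continuously_differentiable_on_linear by blast

lemma smooth_on_bounded_bilinear:
  "open S \<Longrightarrow> bounded_bilinear B \<Longrightarrow> smooth_on S f \<Longrightarrow> smooth_on S g \<Longrightarrow> smooth_on S (\<lambda>x. B (f x) (g x))"
  unfolding smooth_on_def using continuously_differentiable_on_bilinear by blast

lemma smooth_on_compose:
  fixes f :: "'a::real_normed_vector \<Rightarrow> 'b::euclidean_space"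
  shows "open S \<Longrightarrow> open T \<Longrightarrow> f ` S \<subseteq> T \<Longrightarrow> smooth_on S f \<Longrightarrow> smooth_on T g \<Longrightarrow>
    smooth_on S (\<lambda>x. g (f x))"
  unfolding smooth_on_def using continuously_differentiable_on_compose by blast

lemma smooth_on_id [smooth_intros]: "open S \<Longrightarrow> smooth_on S (\<lambda>x. x)"
  by (rule smooth_onI[of _ _ "\<lambda>x v. v"]) (auto intro: smooth_on_const)

lemma smooth_on_add [smooth_intros]:
  "open S \<Longrightarrow> smooth_on S f \<Longrightarrow> smooth_on S g \<Longrightarrow> smooth_on S (\<lambda>x. f x + g x)"
  unfolding smooth_on_def using continuously_differentiable_on_add by blast

lemma smooth_on_minus [smooth_intros]:
  "open S \<Longrightarrow> smooth_on S f \<Longrightarrow> smooth_on S (\<lambda>x. - f x)"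
  by (rule smooth_on_bounded_linear[OF _ bounded_linear_minus[OF bounded_linear_ident]])

lemma smooth_on_diff [smooth_intros]:
  "open S \<Longrightarrow> smooth_on S f \<Longrightarrow> smooth_on S g \<Longrightarrow> smooth_on S (\<lambda>x. f x - g x)"
  using smooth_on_add[OF _ _ smooth_on_minus] by fastforce

lemma smooth_on_scaleR [smooth_intros]:
  "open S \<Longrightarrow> smooth_on S f \<Longrightarrow> smooth_on S g \<Longrightarrow> smooth_on S (\<lambda>x. f x *\<^sub>R g x)"
  by (rule smooth_on_bounded_bilinear[OF _ bounded_bilinear_scaleR])

lemma smooth_on_mult [smooth_intros]:
  fixes f :: "'a::real_normed_vector \<Rightarrow> real"
  shows "open S \<Longrightarrow> smooth_on S f \<Longrightarrow> smooth_on S g \<Longrightarrow> smooth_on S (\<lambda>x. f x * g x)"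
  by (rule smooth_on_bounded_bilinear[OF _ bounded_bilinear_mult])

lemma smooth_on_power [smooth_intros]:
  fixes f :: "'a::real_normed_vector \<Rightarrow> real"
  shows "open S \<Longrightarrow> smooth_on S f \<Longrightarrow> smooth_on S (\<lambda>x. f x ^ n)"
  by (induction n) (simp_all add: smooth_on_const smooth_on_mult)

lemma smooth_on_fst [smooth_intros]:
  "open S \<Longrightarrow> smooth_on S f \<Longrightarrow> smooth_on S (\<lambda>x. fst (f x))"
  by (rule smooth_on_bounded_linear[OF _ bounded_linear_fst])

lemma smooth_on_snd [smooth_intros]:
  "open S \<Longrightarrow> smooth_on S f \<Longrightarrow> smooth_on S (\<lambda>x. snd (f x))"
  by (rule smooth_on_bounded_linear[OF _ bounded_linear_snd])

lemma smooth_on_Pair [smooth_intros]: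
  assumes "open S" "smooth_on S f" "smooth_on S g"
  shows "smooth_on S (\<lambda>x. (f x, g x))"
proof -
  have "smooth_on S (\<lambda>x. (f x, 0))"
    by (rule smooth_on_bounded_linear[OF assms(1)
          bounded_linear_Pair[OF bounded_linear_ident bounded_linear_zero] assms(2)])
  moreover have "smooth_on S (\<lambda>x. (0, g x))"
    by (rule smooth_on_bounded_linear[OF assms(1)
          bounded_linear_Pair[OF bounded_linear_zero bounded_linear_ident] assms(3)])
  ultimately have "smooth_on S (\<lambda>x. (f x, 0))" "smooth_on S (\<lambda>x. (0, g x))" .
  from smooth_on_add[OF assms(1) this] show ?thesis by simp
qed

text \<open>The derivative is built from products of \<open>inverse\<close> with itself, so the
  induction hypothesis for the function serves its derivative.\<close>

lemma smooth_on_inverse_real: "smooth_on {x. x \<noteq> (0::real)} inverse"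
proof -
  have o: "open {x. x \<noteq> (0::real)}" by (simp add: open_Collect_neq)
  have "continuously_differentiable_on k {x. x \<noteq> (0::real)} inverse" for k
  proof (induction k)
    case 0
    then show ?case by (auto intro: continuous_on_inverse)
  next
    case (Suc k)
    have "((inverse :: real \<Rightarrow> real) has_derivative (\<lambda>h. (- h) * (inverse x * inverse x))) (at x)"
      if "x \<in> {x. x \<noteq> 0}" for x :: real
      using has_derivative_inverse'[of x] that by (simp add: algebra_simps)
    then show ?case
    proof (rule continuously_differentiable_on_SucI[OF o])
      show "continuously_differentiable_on k {x. x \<noteq> 0} (\<lambda>x. - v * (inverse x * inverse x))" for v :: real
        by (intro continuously_differentiable_on_bilinear[OF _ bounded_bilinear_mult] o Suc
          continuously_differentiable_on_const)
    qed
  qed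
  then show ?thesis unfolding smooth_on_def by blast
qed

lemma smooth_on_inverse [smooth_intros]:
  fixes f :: "'a::real_normed_vector \<Rightarrow> real"
  assumes "open S" "smooth_on S f" "\<And>x. x \<in> S \<Longrightarrow> f x \<noteq> 0"
  shows "smooth_on S (\<lambda>x. inverse (f x))"
  by (rule smooth_on_compose[OF assms(1) _ _ assms(2) smooth_on_inverse_real])
    (use assms(3) in \<open>auto simp: open_Collect_neq\<close>)

lemma smooth_on_divide [smooth_intros]:
  fixes f :: "'a::real_normed_vector \<Rightarrow> real"
  assumes "open S" "smooth_on S g" "smooth_on S f" "\<And>x. x \<in> S \<Longrightarrow> f x \<noteq> 0"
  shows "smooth_on S (\<lambda>x. g x / f x)"
  unfolding divide_inverse using assms by (intro smooth_intros) auto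

text \<open>The derivative is half the reciprocal of \<open>sqrt\<close>; the induction step
  composes the hypothesis with \<open>inverse\<close>.\<close>

lemma smooth_on_sqrt_real: "smooth_on {x. x > (0::real)} sqrt"
proof -
  have o: "open {x. x > (0::real)}" by (simp add: open_Collect_less)
  have "continuously_differentiable_on k {x. x > (0::real)} sqrt" for k
  proof (induction k)
    case 0
    then show ?case by (auto intro!: continuous_intros)
  next
    case (Suc k)
    have "continuously_differentiable_on k {x. x > (0::real)} (\<lambda>x. inverse (sqrt x))"
      by (rule continuously_differentiable_on_compose[of _ "{x. x \<noteq> 0}"])
        (use o Suc smooth_on_inverse_real in \<open>auto simp: open_Collect_neq smooth_on_def\<close>)
    moreover have "(sqrt has_derivative (\<lambda>h. h / 2 * inverse (sqrt x))) (at x)"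
      if "x \<in> {x. x > 0}" for x :: real
      using DERIV_real_sqrt[of x] that
      by (auto simp: has_field_derivative_def divide_simps elim!: has_derivative_eq_rhs)
    ultimately show ?case
      by (intro continuously_differentiable_on_SucI[OF o, where f' = "\<lambda>x h. h / 2 * inverse (sqrt x)"]
          continuously_differentiable_on_bilinear[OF _ bounded_bilinear_mult] o
          continuously_differentiable_on_const)
  qed
  then show ?thesis unfolding smooth_on_def by blast
qed

lemma smooth_on_sqrt [smooth_intros]:
  assumes "open S" "smooth_on S f" "\<And>x. x \<in> S \<Longrightarrow> f x > 0"
  shows "smooth_on S (\<lambda>x. sqrt (f x))"
  by (rule smooth_on_compose[OF assms(1) _ _ assms(2) smooth_on_sqrt_real])
    (use assms(3) in \<open>auto simp: open_Collect_less\<close>)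

lemma dd_compose:
  assumes "f differentiable (at x)" "g differentiable (at (f x))"
  shows "dd (\<lambda>y. g (f y)) x v = dd g (f x) (dd f x v)"
  using frechet_derivative_compose[OF assms] by (simp add: o_def)

section \<open>Symmetry of second derivatives\<close>

text \<open>One mean value theorem per direction: the first for the difference of \<open>f\<close>
  along two parallel segments, the second for the resulting first derivative.\<close>

lemma second_difference_mean_value:
  fixes f :: "'a::real_normed_vector \<Rightarrow> real"
  assumes f: "smooth_on S f" and h: "h > 0"
    and S: "\<And>s t. s \<in> {0..h} \<Longrightarrow> t \<in> {0..h} \<Longrightarrow> p + s *\<^sub>R x + t *\<^sub>R y \<in> S"
  shows "\<exists>s\<in>{0..h}. \<exists>t\<in>{0..h}. f (p + h *\<^sub>R x + h *\<^sub>R y) - f (p + h *\<^sub>R x) - f (p + h *\<^sub>R y) + f p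
    = h * h * dd (\<lambda>q. dd f q x) (p + s *\<^sub>R x + t *\<^sub>R y) y"
proof -
  have line: "((\<lambda>s. g (q + s *\<^sub>R z)) has_real_derivative dd g (q + s *\<^sub>R z) z) (at s)"
    if "smooth_on S g" "q + s *\<^sub>R z \<in> S" for g :: "'a \<Rightarrow> real" and q z s
  proof -
    note g = smooth_on_imp_has_derivative[OF that]
    have "((\<lambda>s. q + s *\<^sub>R z) has_derivative (\<lambda>h. h *\<^sub>R z)) (at s)"
      by (auto intro!: derivative_eq_intros)
    from has_derivative_compose[OF this g] show ?thesis
      by (auto simp: has_field_derivative_def linear_scale[OF has_derivative_linear[OF g]]
          elim!: has_derivative_eq_rhs)
  qed
  have "\<exists>s>0. s < h \<and> (\<lambda>s. f (p + h *\<^sub>R y + s *\<^sub>R x) - f (p + s *\<^sub>R x)) h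
      - (\<lambda>s. f (p + h *\<^sub>R y + s *\<^sub>R x) - f (p + s *\<^sub>R x)) 0
      = (h - 0) * (dd f (p + h *\<^sub>R y + s *\<^sub>R x) x - dd f (p + s *\<^sub>R x) x)"
  proof (rule MVT2)
    fix s assume "0 \<le> s" "s \<le> h"
    then have "p + h *\<^sub>R y + s *\<^sub>R x \<in> S" "p + s *\<^sub>R x \<in> S"
      using S[of s h] S[of s 0] h by (auto simp: algebra_simps)
    then show "((\<lambda>s. f (p + h *\<^sub>R y + s *\<^sub>R x) - f (p + s *\<^sub>R x)) has_real_derivative
        dd f (p + h *\<^sub>R y + s *\<^sub>R x) x - dd f (p + s *\<^sub>R x) x) (at s)"
      by (intro DERIV_diff line f)
  qed (use h in auto)
  then obtain s where s: "s > 0" "s < h"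
    and 1: "f (p + h *\<^sub>R y + h *\<^sub>R x) - f (p + h *\<^sub>R x) - f (p + h *\<^sub>R y) + f p
      = h * (dd f (p + h *\<^sub>R y + s *\<^sub>R x) x - dd f (p + s *\<^sub>R x) x)"
    by auto
  have "\<exists>t>0. t < h \<and> dd f (p + s *\<^sub>R x + h *\<^sub>R y) x - dd f (p + s *\<^sub>R x + 0 *\<^sub>R y) x
      = (h - 0) * dd (\<lambda>q. dd f q x) (p + s *\<^sub>R x + t *\<^sub>R y) y"
  proof (rule MVT2)
    fix t assume "0 \<le> t" "t \<le> h"
    then have "p + s *\<^sub>R x + t *\<^sub>R y \<in> S" using S s by auto
    then show "((\<lambda>t. dd f (p + s *\<^sub>R x + t *\<^sub>R y) x) has_real_derivative
       dd (\<lambda>q. dd f q x) (p + s *\<^sub>R x + t *\<^sub>R y) y) (at t)"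
      by (intro line smooth_on_dd f)
  qed (use h in auto)
  then obtain t where t: "t > 0" "t < h"
    and 2: "dd f (p + s *\<^sub>R x + h *\<^sub>R y) x - dd f (p + s *\<^sub>R x) x
      = h * dd (\<lambda>q. dd f q x) (p + s *\<^sub>R x + t *\<^sub>R y) y" by auto
  show ?thesis
    using s t by (intro bexI[of _ s] bexI[of _ t]) (use 1 2 in \<open>auto simp: algebra_simps\<close>)
qed

text \<open>The second difference over a parallelogram is symmetric in its sides, so it is
  \<open>h * h\<close> times either mixed derivative, each at a point near \<open>p\<close>. If the
  two differed at \<open>p\<close>, continuity would keep them apart.\<close>

lemma second_derivative_symmetric_real:
  fixes f :: "'a::real_normed_vector \<Rightarrow> real"
  assumes "open S" and f: "smooth_on S f" and p: "p \<in> S"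
  shows "dd (\<lambda>q. dd f q y) p x = dd (\<lambda>q. dd f q x) p y"
proof (rule ccontr)
  define A where "A q = dd (\<lambda>q. dd f q x) q y" for q
  define B where "B q = dd (\<lambda>q. dd f q y) q x" for q
  assume "\<not> ?thesis"
  then have e: "\<bar>A p - B p\<bar> / 2 > 0" by (simp add: A_def B_def)
  have "continuous_on S A" "continuous_on S B"
    unfolding A_def B_def by (intro smooth_on_imp_continuous_on smooth_on_dd f)+
  then have "isCont A p" "isCont B p"
    using assms(1) p continuous_on_eq_continuous_at by blast+
  then obtain d1 d2 where d: "d1 > 0" "\<And>q. dist q p < d1 \<Longrightarrow> \<bar>A q - A p\<bar> < \<bar>A p - B p\<bar> / 2"
    "d2 > 0" "\<And>q. dist q p < d2 \<Longrightarrow> \<bar>B q - B p\<bar> < \<bar>A p - B p\<bar> / 2"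
    using e unfolding continuous_at_eps_delta dist_real_def by metis
  obtain r where r: "r > 0" "ball p r \<subseteq> S" using assms(1) p open_contains_ball by blast
  \<comment> \<open>Within distance \<open>m\<close> of \<open>p\<close> both mixed derivatives stay
    closer than half their gap to their values at \<open>p\<close>. The choice of \<open>h\<close>
    puts the parallelogram into that ball; the \<open>+ 1\<close> keeps \<open>h\<close> positive
    when \<open>x\<close> and \<open>y\<close> are zero.\<close>
  define m where "m = min r (min d1 d2)"
  define h where "h = m / (norm x + norm y + 1)"
  have m: "m > 0" using d r by (simp add: m_def)
  have n: "norm x + norm y + 1 > 0" using norm_ge_zero[of x] norm_ge_zero[of y] by linarith
  then have h: "h > 0" using m by (simp add: h_def)
  have near: "dist (p + s *\<^sub>R x + t *\<^sub>R y) p < m" if "s \<in> {0..h}" "t \<in> {0..h}" for s t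
  proof -
    have "dist (p + s *\<^sub>R x + t *\<^sub>R y) p \<le> s * norm x + t * norm y"
      using norm_triangle_ineq[of "s *\<^sub>R x" "t *\<^sub>R y"] that by (simp add: dist_norm)
    also have "\<dots> \<le> h * norm x + h * norm y"
      using that by (auto intro!: add_mono mult_right_mono)
    also have "\<dots> < h * (norm x + norm y + 1)" using h by (simp add: algebra_simps)
    also have "\<dots> = m" using n by (simp add: h_def)
    finally show ?thesis .
  qed
  then have S: "p + s *\<^sub>R x + t *\<^sub>R y \<in> S" if "s \<in> {0..h}" "t \<in> {0..h}" for s t
    using that r(2) by (force simp: m_def dist_commute)
  obtain s t where st: "s \<in> {0..h}" "t \<in> {0..h}"
    "f (p + h *\<^sub>R x + h *\<^sub>R y) - f (p + h *\<^sub>R x) - f (p + h *\<^sub>R y) + f p = h * h * A (p + s *\<^sub>R x + t *\<^sub>R y)"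
    using second_difference_mean_value[OF f h S] unfolding A_def by blast
  have S': "p + s *\<^sub>R y + t *\<^sub>R x \<in> S" if "s \<in> {0..h}" "t \<in> {0..h}" for s t
    using S[OF that(2,1)] by (simp add: algebra_simps)
  obtain s' t' where st': "s' \<in> {0..h}" "t' \<in> {0..h}"
    "f (p + h *\<^sub>R y + h *\<^sub>R x) - f (p + h *\<^sub>R y) - f (p + h *\<^sub>R x) + f p = h * h * B (p + s' *\<^sub>R y + t' *\<^sub>R x)"
    using second_difference_mean_value[OF f h S'] unfolding B_def by blast
  have "h * h * A (p + s *\<^sub>R x + t *\<^sub>R y) = h * h * B (p + s' *\<^sub>R y + t' *\<^sub>R x)"
    using st(3) st'(3) by (simp add: algebra_simps)
  then have "A (p + s *\<^sub>R x + t *\<^sub>R y) = B (p + t' *\<^sub>R x + s' *\<^sub>R y)" using h by (simp add: algebra_simps)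
  moreover have "\<bar>A (p + s *\<^sub>R x + t *\<^sub>R y) - A p\<bar> < \<bar>A p - B p\<bar> / 2"
    using d(2) near[OF st(1,2)] by (simp add: m_def)
  moreover have "\<bar>B (p + t' *\<^sub>R x + s' *\<^sub>R y) - B p\<bar> < \<bar>A p - B p\<bar> / 2"
    using d(4) near[OF st'(2,1)] by (simp add: m_def)
  ultimately show False by (smt (verit) field_sum_of_halves)
qed

lemma dd_bounded_linear:
  assumes "bounded_linear L" "f differentiable (at x)"
  shows "dd (\<lambda>y. L (f y)) x v = L (dd f x v)"
  using assms bounded_linear.has_derivative dd_eqI frechet_derivative_works by metis

text \<open>Pairing with a fixed vector reduces to real-valued maps, for which the mean value
  theorem is available.\<close>

lemma second_derivative_symmetric:
  fixes f :: "'a::real_normed_vector \<Rightarrow> 'b::real_inner"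
  assumes "open S" and f: "smooth_on S f" and p: "p \<in> S"
  shows "dd (\<lambda>q. dd f q y) p x = dd (\<lambda>q. dd f q x) p y"
proof -
  have "dd (\<lambda>q. dd f q y) p x \<bullet> w = dd (\<lambda>q. dd f q x) p y \<bullet> w" for w
  proof -
    define F where "F q = f q \<bullet> w" for q
    have F: "smooth_on S F"
      unfolding F_def by (rule smooth_on_bounded_linear[OF assms(1) bounded_linear_inner_left f])
    have D: "dd F q z = dd f q z \<bullet> w" if "q \<in> S" for q z
      unfolding F_def
      by (rule dd_bounded_linear[OF bounded_linear_inner_left smooth_on_imp_differentiable[OF f that]])
    have "dd (\<lambda>q. dd F q z) p z' = dd (\<lambda>q. dd f q z) p z' \<bullet> w" for z z'
    proof -
      have "dd (\<lambda>q. dd F q z) p z' = dd (\<lambda>q. dd f q z \<bullet> w) p z'"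
        by (rule dd_cong_open[OF assms(1) p]) (rule D)
      also have "\<dots> = dd (\<lambda>q. dd f q z) p z' \<bullet> w"
        by (rule dd_bounded_linear[OF bounded_linear_inner_left
          smooth_on_imp_differentiable[OF smooth_on_dd[OF f] p]])
      finally show ?thesis .
    qed
    with second_derivative_symmetric_real[OF assms(1) F p] show ?thesis by simp
  qed
  then show ?thesis using inner_eq_zero_iff by (metis inner_commute vector_eq_rdot)
qed

lemma dd_plane:
  fixes f :: "plane \<Rightarrow> 'a::real_normed_vector"
  assumes "f differentiable (at p)"
  shows "dd f p v = fst v *\<^sub>R dd f p (1, 0) + snd v *\<^sub>R dd f p (0, 1)"
proof -
  have l: "linear (dd f p)" using assms linear_frechet_derivative by blast
  have "dd f p (fst v *\<^sub>R (1, 0) + snd v *\<^sub>R (0, 1)) = fst v *\<^sub>R dd f p (1, 0) + snd v *\<^sub>R dd f p (0, 1)"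
    by (simp only: linear_add[OF l] linear_scale[OF l])
  then show ?thesis by simp
qed

section \<open>Poincare lemma and inverse functions in the plane\<close>

text \<open>The primitive is the integral of \<open>P du + Q dv\<close> along the segment from a
  base point, which convexity keeps inside \<open>S\<close>. Closedness turns the differentiated
  integrand into an exact derivative in the segment parameter.\<close>

lemma poincare_plane:
  fixes P Q :: "plane \<Rightarrow> real"
  assumes S: "open S" "convex S" and P: "smooth_on S P" and Q: "smooth_on S Q"
    and closed: "\<And>p. p \<in> S \<Longrightarrow> dd P p (0, 1) = dd Q p (1, 0)"
  obtains z where "\<And>p. p \<in> S \<Longrightarrow> (z has_derivative (\<lambda>v. P p * fst v + Q p * snd v)) (at p)"
    "smooth_on S z"
proof (cases "S = {}")
  case True
  have "smooth_on {} z" for z :: "plane \<Rightarrow> real"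
    by (rule smooth_on_locally) simp
  with True show ?thesis using that by blast
next
  case False
  then obtain o' where o': "o' \<in> S" by blast
  define m where "m p t = o' + t *\<^sub>R (p - o')" for p :: plane and t :: real
  define F where "F p t = P (m p t) * fst (p - o') + Q (m p t) * snd (p - o')" for p t
  \<comment> \<open>\<open>A\<close> and \<open>B\<close> are the partial derivatives of the
    integrand \<open>F\<close> with respect to the end point \<open>p\<close>.\<close>
  define A where "A p t = t * (dd P (m p t) (1, 0) * fst (p - o') + dd Q (m p t) (1, 0) * snd (p - o')) + P (m p t)" for p t
  define B where "B p t = t * (dd P (m p t) (0, 1) * fst (p - o') + dd Q (m p t) (0, 1) * snd (p - o')) + Q (m p t)" for p t
  define z where "z p = integral (cbox 0 1) (F p)" for p
  \<comment> \<open>Both partial derivatives are packed into one bounded linear map, so that a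
    single differentiation under the integral and a single application of the fundamental theorem
    suffice.\<close>
  define D :: "plane \<Rightarrow> real \<Rightarrow> plane \<Rightarrow>\<^sub>L real"
    where "D p t = A p t *\<^sub>R fst_blinfun + B p t *\<^sub>R snd_blinfun" for p t
  have D: "blinfun_apply (D p t) v = A p t * fst v + B p t * snd v" for p t v
    by (simp add: D_def blinfun.add_left blinfun.scaleR_left)
  have mS: "m p t \<in> S" if "p \<in> S" "t \<in> cbox 0 1" for p t
  proof -
    have "m p t = (1 - t) *\<^sub>R o' + t *\<^sub>R p" by (simp add: m_def algebra_simps)
    then show ?thesis using convexD_alt[OF S(2) o' that(1)] that(2) by auto
  qed
  have mc: "continuous_on (S \<times> cbox 0 1) (\<lambda>x. m (fst x) (snd x))"
    unfolding m_def by (intro continuous_intros)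
  have comp: "continuous_on (S \<times> cbox 0 1) (\<lambda>x. g (m (fst x) (snd x)))"
    if "smooth_on S g" for g :: "plane \<Rightarrow> real"
    by (rule continuous_on_compose2[OF smooth_on_imp_continuous_on[OF that] mc]) (use mS in auto)
  have "(z has_derivative (\<lambda>v. P p * fst v + Q p * snd v)) (at p)" if p: "p \<in> S" for p
  proof -
    have "((\<lambda>p. integral (cbox 0 1) (F p)) has_derivative blinfun_apply (integral (cbox 0 1) (D p))) (at p within S)"
    proof (rule leibniz_rule[where fx = D])
      show "((\<lambda>x. F x t) has_derivative blinfun_apply (D x t)) (at x within S)"
        if "x \<in> S" "t \<in> cbox 0 1" for x t
      proof -
        have "((\<lambda>x. m x t) has_derivative (\<lambda>v. t *\<^sub>R v)) (at x)"
          unfolding m_def by (auto intro!: derivative_eq_intros)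
        from has_derivative_compose[OF this smooth_on_imp_has_derivative[OF P mS[OF that]]]
          has_derivative_compose[OF this smooth_on_imp_has_derivative[OF Q mS[OF that]]]
        have 1: "((\<lambda>x. P (m x t)) has_derivative (\<lambda>v. dd P (m x t) (t *\<^sub>R v))) (at x)"
          "((\<lambda>x. Q (m x t)) has_derivative (\<lambda>v. dd Q (m x t) (t *\<^sub>R v))) (at x)" .
        have "((\<lambda>x. F x t) has_derivative (\<lambda>v. P (m x t) * fst v + dd P (m x t) (t *\<^sub>R v) * fst (x - o') +
           (Q (m x t) * snd v + dd Q (m x t) (t *\<^sub>R v) * snd (x - o')))) (at x)"
          unfolding F_def by (auto intro!: derivative_eq_intros 1)
        moreover have "P (m x t) * fst v + dd P (m x t) (t *\<^sub>R v) * fst (x - o') +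
           (Q (m x t) * snd v + dd Q (m x t) (t *\<^sub>R v) * snd (x - o')) = blinfun_apply (D x t) v" for v
          using dd_plane[OF smooth_on_imp_differentiable[OF P mS[OF that]], of "t *\<^sub>R v"]
            dd_plane[OF smooth_on_imp_differentiable[OF Q mS[OF that]], of "t *\<^sub>R v"]
          by (simp add: D A_def B_def algebra_simps)
        ultimately show ?thesis by (simp add: has_derivative_at_withinI)
      qed
      show "F x integrable_on cbox 0 1" if "x \<in> S" for x
      proof (rule integrable_continuous)
        have m: "continuous_on (cbox 0 1) (\<lambda>t. m x t)" unfolding m_def by (intro continuous_intros)
        have im: "(\<lambda>t. m x t) ` cbox 0 1 \<subseteq> S" using mS[OF that] by blast
        show "continuous_on (cbox 0 1) (F x)"
          unfolding F_def
          by (intro continuous_intros continuous_on_compose2[OF smooth_on_imp_continuous_on[OF P] m im]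
              continuous_on_compose2[OF smooth_on_imp_continuous_on[OF Q] m im])
      qed
      show "continuous_on (S \<times> cbox 0 1) (\<lambda>(x, t). D x t)"
        unfolding D_def A_def B_def case_prod_unfold
        by (intro continuous_intros comp smooth_on_dd P Q)
    qed (use p S in auto)
    \<comment> \<open>By closedness \<open>A\<close> and \<open>B\<close> are the
      \<open>t\<close>-derivatives of \<open>t * P\<close> and \<open>t * Q\<close> along the
      segment. The factor \<open>t\<close> removes the contribution at 0, and
      \<open>m p 1 = p\<close>.\<close>
    moreover have "(D p has_integral (1 *\<^sub>R P (m p 1)) *\<^sub>R fst_blinfun + (1 *\<^sub>R Q (m p 1)) *\<^sub>R snd_blinfun
        - ((0 *\<^sub>R P (m p 0)) *\<^sub>R fst_blinfun + (0 *\<^sub>R Q (m p 0)) *\<^sub>R snd_blinfun)) {0..1}"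
    proof (rule fundamental_theorem_of_calculus)
      fix t :: real assume t: "t \<in> {0..1}"
      then have mt: "m p t \<in> S" using mS p by auto
      have "((\<lambda>t. m p t) has_derivative (\<lambda>h. h *\<^sub>R (p - o'))) (at t)"
        unfolding m_def by (auto intro!: derivative_eq_intros)
      from has_derivative_compose[OF this smooth_on_imp_has_derivative[OF P mt]]
        has_derivative_compose[OF this smooth_on_imp_has_derivative[OF Q mt]]
      have 1: "((\<lambda>t. P (m p t)) has_derivative (\<lambda>h. dd P (m p t) (h *\<^sub>R (p - o')))) (at t)"
          "((\<lambda>t. Q (m p t)) has_derivative (\<lambda>h. dd Q (m p t) (h *\<^sub>R (p - o')))) (at t)" .
      have 2: "((\<lambda>t. (t *\<^sub>R P (m p t)) *\<^sub>R fst_blinfun + (t *\<^sub>R Q (m p t)) *\<^sub>R snd_blinfun) has_derivative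
        (\<lambda>h. (t * dd P (m p t) (h *\<^sub>R (p - o')) + h * P (m p t)) *\<^sub>R fst_blinfun +
          (t * dd Q (m p t) (h *\<^sub>R (p - o')) + h * Q (m p t)) *\<^sub>R snd_blinfun)) (at t)"
        by (auto intro!: derivative_eq_intros 1)
      have 3: "(t * dd P (m p t) (h *\<^sub>R (p - o')) + h * P (m p t)) *\<^sub>R fst_blinfun +
          (t * dd Q (m p t) (h *\<^sub>R (p - o')) + h * Q (m p t)) *\<^sub>R snd_blinfun = h *\<^sub>R D p t" for h
        unfolding dd_plane[OF smooth_on_imp_differentiable[OF P mt], of "h *\<^sub>R (p - o')"]
            dd_plane[OF smooth_on_imp_differentiable[OF Q mt], of "h *\<^sub>R (p - o')"] closed[OF mt]
        by (simp add: D_def A_def B_def closed[OF mt] algebra_simps)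
      show "((\<lambda>t. (t *\<^sub>R P (m p t)) *\<^sub>R fst_blinfun + (t *\<^sub>R Q (m p t)) *\<^sub>R snd_blinfun)
          has_vector_derivative D p t) (at t within {0..1})"
        unfolding has_vector_derivative_def
        by (rule has_derivative_at_withinI, rule has_derivative_eq_rhs[OF 2], rule ext, rule 3)
    qed simp
    then have "(D p has_integral P p *\<^sub>R fst_blinfun + Q p *\<^sub>R snd_blinfun) (cbox 0 1)"
      by (simp add: m_def)
    then have "integral (cbox 0 1) (D p) = P p *\<^sub>R fst_blinfun + Q p *\<^sub>R snd_blinfun"
      by (rule integral_unique)
    moreover have "blinfun_apply (P p *\<^sub>R fst_blinfun + Q p *\<^sub>R snd_blinfun)
        = (\<lambda>v. P p * fst v + Q p * snd v)"
      by (rule ext) (simp add: blinfun.add_left blinfun.scaleR_left)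
    ultimately show ?thesis
      unfolding z_def at_within_open[OF p S(1)] by simp
  qed
  moreover from this have "smooth_on S z"
    by - (rule smooth_onI[OF S(1)], assumption, intro smooth_intros S P Q)
  ultimately show ?thesis by (rule that)
qed

text \<open>\<open>e1\<close> and \<open>e2\<close> are the columns of the inverse Jacobian,
  supplied as smooth fields. The derivative of \<open>G\<close> is then built from \<open>e1\<close>
  and \<open>e2\<close> composed with \<open>G\<close>, so each order of differentiability of
  \<open>G\<close> yields the next.\<close>

lemma smooth_inverse_plane:
  fixes F :: "plane \<Rightarrow> plane"
  assumes S: "open S" and F: "smooth_on S F" and p: "p \<in> S"
    and e: "smooth_on S e1" "smooth_on S e2"
      "\<And>q. q \<in> S \<Longrightarrow> dd F q (e1 q) = (1, 0)" "\<And>q. q \<in> S \<Longrightarrow> dd F q (e2 q) = (0, 1)"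
  obtains U r G where "open U" "p \<in> U" "U \<subseteq> S" "r > 0" "homeomorphism U (ball (F p) r) F G"
    "smooth_on (ball (F p) r) G"
    "\<And>q w. q \<in> ball (F p) r \<Longrightarrow> dd G q w = fst w *\<^sub>R e1 (G q) + snd w *\<^sub>R e2 (G q)"
proof -
  define F' where "F' x = Blinfun (dd F x)" for x
  have F': "blinfun_apply (F' x) = dd F x" if "x \<in> S" for x
    unfolding F'_def
    by (rule bounded_linear_Blinfun_apply[OF has_derivative_bounded_linear[OF smooth_on_imp_has_derivative[OF F that]]])
  define E where "E x w = fst w *\<^sub>R e1 x + snd w *\<^sub>R e2 x" for x and w :: plane
  have bE: "bounded_linear (E x)" for x
    unfolding E_def
    by (intro bounded_linear_add bounded_linear_scaleR_left bounded_linear_compose[OF bounded_linear_scaleR_left]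
        bounded_linear_fst bounded_linear_snd)
  have lE: "linear (E x)" for x
    using bE bounded_linear.linear by blast
  have FE: "dd F x (E x w) = w" if "x \<in> S" for x w
    using linear_dd[OF F that] e(3,4)[OF that] by (cases w) (simp add: E_def linear_add linear_scale)
  have EF: "E x (dd F x w) = w" if "x \<in> S" for x w
    using linear_inverse_left[OF linear_dd[OF F that] lE[of x]] FE[OF that] by (metis eq_id_iff o_apply)
  have 1: "(F has_derivative blinfun_apply (F' x)) (at x)" if "x \<in> S" for x
    using smooth_on_imp_has_derivative[OF F that] F'[OF that] by simp
  have 2: "continuous_on S F'"
  proof (rule continuous_on_blinfun_componentwise)
    fix i :: plane
    have "continuous_on S (\<lambda>x. dd F x i)" by (intro smooth_on_imp_continuous_on smooth_on_dd F)
    then show "continuous_on S (\<lambda>x. blinfun_apply (F' x) i)" by (simp add: F' cong: continuous_on_cong)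
  qed
  have 3: "Blinfun (E p) o\<^sub>L F' p = id_blinfun"
    by (rule blinfun_eqI) (simp add: bounded_linear_Blinfun_apply[OF bE] F'[OF p] EF[OF p])
  from inverse_function_theorem[OF S 1 2 p 3]
  obtain U V G G' where UV: "open U" "U \<subseteq> S" "p \<in> U" "open V" "F p \<in> V" "homeomorphism U V F G"
    and G: "\<And>y. y \<in> V \<Longrightarrow> (G has_derivative (G' y)) (at y)"
      "\<And>y. y \<in> V \<Longrightarrow> G' y = inv (blinfun_apply (F' (G y)))"
      "\<And>y. y \<in> V \<Longrightarrow> bij (blinfun_apply (F' (G y)))" by metis
  obtain r where r: "r > 0" "ball (F p) r \<subseteq> V" using UV(4,5) open_contains_ball by blast
  have GS: "G q \<in> S" if "q \<in> V" for q
    using UV(2,6) that by (auto simp: homeomorphism_def)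
  have dG: "(G has_derivative E (G q)) (at q)" if "q \<in> V" for q
  proof -
    have "G' q w = E (G q) w" for w
      using G(2,3)[OF that] F'[OF GS[OF that]] FE[OF GS[OF that]] by (metis bij_inv_eq_iff)
    then have "G' q = E (G q)" by blast
    then show ?thesis using G(1)[OF that] by simp
  qed
  have "continuously_differentiable_on k V G" for k
  proof (induction k)
    case 0
    then show ?case using UV(6) by (simp add: homeomorphism_def)
  next
    case (Suc k)
    have "continuously_differentiable_on k V (\<lambda>q. e1 (G q))" "continuously_differentiable_on k V (\<lambda>q. e2 (G q))"
      by (rule continuously_differentiable_on_compose[OF UV(4) S _ Suc];
          use GS e in \<open>auto simp: smooth_on_def\<close>)+
    then show ?case
      by (intro continuously_differentiable_on_SucI[OF UV(4) dG])
        (auto simp: E_def intro!: continuously_differentiable_on_add UV(4)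
          continuously_differentiable_on_const
          continuously_differentiable_on_bilinear[OF _ bounded_bilinear_scaleR])
  qed
  then have sG: "smooth_on (ball (F p) r) G"
    unfolding smooth_on_def using continuously_differentiable_on_subset[OF r(2)] by blast
  \<comment> \<open>Shrinking the target to a ball makes it convex, as needed when vanishing
    derivatives are integrated to constancy.\<close>
  define W where "W = U \<inter> F -` ball (F p) r"
  have "continuous_on U F" using UV(6) by (simp add: homeomorphism_def)
  then have W: "open W" unfolding W_def using UV(1) open_ball by (rule continuous_open_preimage)
  have FW: "F ` W = ball (F p) r"
  proof
    show "ball (F p) r \<subseteq> F ` W"
    proof
      fix y assume y: "y \<in> ball (F p) r"
      then have "F (G y) = y" "G y \<in> U" using UV(6) r(2) by (auto simp: homeomorphism_def)
      then show "y \<in> F ` W" using y by (force simp: W_def)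
    qed
  qed (auto simp: W_def)
  have hom: "homeomorphism W (ball (F p) r) F G"
    using homeomorphism_of_subsets[OF UV(6) _ r(2) FW] by (simp add: W_def)
  show ?thesis
    by (rule that[OF W _ _ r(1) hom sG])
      (use UV(2,3) r W_def E_def dd_eqI[OF dG] in auto)
qed

section \<open>The ambient space\<close>

text \<open>The part tangent to the space form factor. Applied to a point \<open>q\<close> instead
  of a vector, the same map yields the position vector of the space form, which spans the normal
  line at \<open>q\<close>.\<close>

definition hor :: "ambient \<Rightarrow> ambient" where "hor w = (fst w, 0)"

lemma fst_hor [simp]: "fst (hor w) = fst w" and snd_hor [simp]: "snd (hor w) = 0"
  by (simp_all add: hor_def)

lemma hor_eq_self: "snd w = 0 \<Longrightarrow> hor w = w"
  by (simp add: prod_eq_iff)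

lemma bounded_bilinear_inn: "bounded_bilinear (inn c)"
  unfolding bilinear_conv_bounded_bilinear[symmetric] bilinear_def
  by (auto intro!: linearI simp: inn_def algebra_simps inner_add_left inner_add_right)

lemma inn_commute: "inn c v w = inn c w v"
  by (simp add: inn_def inner_commute mult.commute mult.left_commute)

lemmas inn_simps =
  bounded_bilinear.add_left[OF bounded_bilinear_inn] bounded_bilinear.add_right[OF bounded_bilinear_inn]
  bounded_bilinear.diff_left[OF bounded_bilinear_inn] bounded_bilinear.diff_right[OF bounded_bilinear_inn]
  bounded_bilinear.minus_left[OF bounded_bilinear_inn] bounded_bilinear.minus_right[OF bounded_bilinear_inn]
  bounded_bilinear.zero_left[OF bounded_bilinear_inn] bounded_bilinear.zero_right[OF bounded_bilinear_inn]
  bounded_bilinear.scaleR_left[OF bounded_bilinear_inn] bounded_bilinear.scaleR_right[OF bounded_bilinear_inn]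

lemma linear_inn_left: "linear (\<lambda>v. inn c v w)"
  using bounded_bilinear.bounded_linear_left[OF bounded_bilinear_inn] bounded_linear.linear by blast

lemma linear_inn_right: "linear (inn c w)"
  using bounded_bilinear.bounded_linear_right[OF bounded_bilinear_inn] bounded_linear.linear by blast

lemma bounded_linear_hor: "bounded_linear hor"
  unfolding hor_def by (intro bounded_linear_Pair bounded_linear_fst bounded_linear_zero)

lemma hor_simps: "hor (v + w) = hor v + hor w" "hor (v - w) = hor v - hor w" "hor (r *\<^sub>R v) = r *\<^sub>R hor v"
  "hor (- v) = - hor v" "hor 0 = 0"
  by (simp_all add: prod_eq_iff)

lemma inn_hor_left [simp]: "inn c (hor v) w = inn c v (hor w)"
  by (simp add: inn_def)

lemma inn_hor_commute: "inn c v (hor w) = inn c w (hor v)"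
  by (simp add: inn_def inner_commute mult.commute mult.left_commute)

lemma inn_hor_right: "inn c v (hor w) = inn c v w - snd v * snd w"
  by (simp add: inn_def)

lemma inn_xi: "inn c w xi = snd w" "inn c xi w = snd w"
  by (simp_all add: inn_def xi_def)

lemma inn_hor_hor [simp]: "inn c v (hor (hor w)) = inn c v (hor w)"
  by (simp add: inn_def)

lemma inn_hor_self: "c \<noteq> 0 \<Longrightarrow> fst q \<in> space_form c \<Longrightarrow> inn c q (hor q) = 1 / c"
  by (simp add: space_form_def inn_def power2_eq_square mult.assoc)

text \<open>For \<open>c < 0\<close> the point is that vectors orthogonal to a point of the
  hyperboloid are spacelike: orthogonality reads \<open>v0 * x0 = V \<bullet> X\<close>, and because
  \<open>X \<bullet> X < x0\<^sup>2\<close>, Cauchy-Schwarz forces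
  \<open>v0\<^sup>2 < V \<bullet> V\<close> unless \<open>V = 0\<close>.\<close>

lemma inn_pos:
  assumes q: "fst q \<in> space_form c" and w: "inn c w (hor q) = 0" "w \<noteq> 0" and c: "c \<noteq> 0"
  shows "inn c w w > 0"
proof -
  obtain v0 V s where W: "w = ((v0, V), s)" by (metis prod.exhaust)
  obtain x0 X r where Q: "q = ((x0, X), r)" by (metis prod.exhaust)
  show ?thesis
  proof (cases "c > 0")
    case True
    have "v0 \<noteq> 0 \<or> V \<noteq> 0 \<or> s \<noteq> 0" using w(2) W by (auto simp: zero_prod_def)
    then have "v0 * v0 + V \<bullet> V + s * s > 0"
      by (metis add_nonneg_pos add_pos_nonneg inner_ge_zero inner_gt_zero_iff not_square_less_zero
          linorder_neqE_linordered_idom zero_le_square mult_eq_0_iff add_nonneg_nonneg)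
    then show ?thesis using True by (simp add: W inn_def)
  next
    case False
    then have c: "c < 0" using c by simp
    have x0: "x0 > 0" and x: "X \<bullet> X = x0\<^sup>2 + 1 / c" and o: "v0 * x0 = V \<bullet> X"
      using q w(1) c by (auto simp: W Q space_form_def inn_def algebra_simps)
    have "(V \<bullet> X)\<^sup>2 \<le> (V \<bullet> V) * (X \<bullet> X)" by (rule Cauchy_Schwarz_ineq)
    then have ineq: "v0\<^sup>2 * x0\<^sup>2 \<le> (V \<bullet> V) * (x0\<^sup>2 + 1 / c)" by (simp add: o[symmetric] x power_mult_distrib)
    show ?thesis
    proof (cases "V = 0")
      case True
      then have "v0 = 0" using o x0 by simp
      then have "s \<noteq> 0" using w(2) W True by (auto simp: zero_prod_def)
      then show ?thesis using True \<open>v0 = 0\<close> by (simp add: W inn_def zero_less_mult_iff)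
        (metis linorder_neqE_linordered_idom)
    next
      case False
      then have "V \<bullet> V * (1 / c) < 0" using c by (simp add: divide_pos_neg)
      then have "x0\<^sup>2 * v0\<^sup>2 < x0\<^sup>2 * (V \<bullet> V)" using ineq by (simp add: algebra_simps)
      then have "v0\<^sup>2 < V \<bullet> V" using x0 by simp
      moreover have "s * s \<ge> 0" by simp
      ultimately have "- (v0 * v0) + V \<bullet> V + s * s > 0" unfolding power2_eq_square by linarith
      then show ?thesis using c by (simp add: W inn_def)
    qed
  qed
qed

text \<open>Testing against \<open>v\<close> with its first coordinate multiplied by
  \<open>sgn c\<close> produces a sum of squares.\<close>

lemma inn_nondegenerate:
  assumes "c \<noteq> 0" "\<And>w. inn c v w = 0"
  shows "v = 0"
proof -
  obtain v0 V s where v: "v = ((v0, V), s)" by (metis prod.exhaust)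
  have "sgn c * v0 * (sgn c * v0) = v0 * v0" using assms(1) by (simp add: sgn_real_def)
  moreover have "sgn c * v0 * (sgn c * v0) + V \<bullet> V + s * s = 0"
    using assms(2)[of "((sgn c * v0, V), s)"] by (simp add: v inn_def)
  ultimately have "v0 * v0 + V \<bullet> V + s * s = 0" by linarith
  moreover have "v0 * v0 \<ge> 0" "V \<bullet> V \<ge> 0" "s * s \<ge> 0" by simp_all
  ultimately have "v0 * v0 = 0" "V \<bullet> V = 0" "s * s = 0" by linarith+
  then show ?thesis by (simp add: v zero_prod_def)
qed

text \<open>The squares are only required to be nonzero: the frames in use are not normalised, and
  the position vector has square \<open>1 / c\<close>, which may be negative.\<close>

definition orthobasis :: "real \<Rightarrow> ambient \<Rightarrow> ambient \<Rightarrow> ambient \<Rightarrow> ambient \<Rightarrow> ambient \<Rightarrow> bool" where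
  "orthobasis c b1 b2 b3 b4 b5 \<longleftrightarrow>
     inn c b1 b1 \<noteq> 0 \<and> inn c b2 b2 \<noteq> 0 \<and> inn c b3 b3 \<noteq> 0 \<and> inn c b4 b4 \<noteq> 0 \<and> inn c b5 b5 \<noteq> 0 \<and>
     inn c b1 b2 = 0 \<and> inn c b1 b3 = 0 \<and> inn c b1 b4 = 0 \<and> inn c b1 b5 = 0 \<and> inn c b2 b3 = 0 \<and>
     inn c b2 b4 = 0 \<and> inn c b2 b5 = 0 \<and> inn c b3 b4 = 0 \<and> inn c b3 b5 = 0 \<and> inn c b4 b5 = 0"

text \<open>Five mutually orthogonal non-null vectors are independent, so they span the
  five-dimensional space, and the form is nondegenerate.\<close>

lemma orthobasis_eqI:
  assumes c: "c \<noteq> 0" and b: "orthobasis c b1 b2 b3 b4 b5"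
    and eq: "inn c v b1 = inn c w b1" "inn c v b2 = inn c w b2" "inn c v b3 = inn c w b3"
      "inn c v b4 = inn c w b4" "inn c v b5 = inn c w b5"
  shows "v = w"
proof -
  let ?B = "{b1, b2, b3, b4, b5}"
  have comm: "inn c b2 b1 = 0" "inn c b3 b1 = 0" "inn c b4 b1 = 0" "inn c b5 b1 = 0" "inn c b3 b2 = 0"
     "inn c b4 b2 = 0" "inn c b5 b2 = 0" "inn c b4 b3 = 0" "inn c b5 b3 = 0" "inn c b5 b4 = 0"
    using b unfolding orthobasis_def by (simp_all add: inn_commute)
  have orth: "inn c x y = 0" if "x \<in> ?B" "y \<in> ?B" "x \<noteq> y" for x y
    using that b comm unfolding orthobasis_def by auto
  have pos: "inn c x x \<noteq> 0" if "x \<in> ?B" for x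
    using that b unfolding orthobasis_def by auto
  have card: "card ?B = 5"
    using b unfolding orthobasis_def by (auto simp: card_insert_if)
  have "independent ?B"
  proof
    assume "dependent ?B"
    then obtain u x where x: "x \<in> ?B" "u x \<noteq> 0" and "(\<Sum>v\<in>?B. u v *\<^sub>R v) = 0"
      using dependent_finite[of ?B] by blast
    then have "0 = inn c (\<Sum>v\<in>?B. u v *\<^sub>R v) x" by (simp add: inn_simps)
    also have "\<dots> = (\<Sum>v\<in>?B. u v * inn c v x)"
      by (simp only: linear_sum[OF linear_inn_left] inn_simps real_scaleR_def)
    also have "\<dots> = (\<Sum>v\<in>{x}. u v * inn c v x)"
      by (rule sum.mono_neutral_right) (use x(1) orth in auto)
    finally show False using x pos by simp
  qed
  moreover have "dim (UNIV :: ambient set) \<le> card ?B" unfolding card by simp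
  ultimately have "UNIV \<subseteq> span ?B" using card_ge_dim_independent by blast
  have "inn c (v - w) x = 0" for x
  proof (rule span_induct[of x ?B])
    show "x \<in> span ?B" using \<open>UNIV \<subseteq> span ?B\<close> by blast
    show "subspace {x. inn c (v - w) x = 0}" by (simp add: subspace_def inn_simps)
  qed (use eq in \<open>auto simp: inn_simps\<close>)
  then show ?thesis using inn_nondegenerate[OF c] by fastforce
qed

lemma orthobasis_expansion:
  assumes c: "c \<noteq> 0" and b: "orthobasis c b1 b2 b3 b4 b5"
  shows "v = (inn c v b1 / inn c b1 b1) *\<^sub>R b1 + (inn c v b2 / inn c b2 b2) *\<^sub>R b2 +
     (inn c v b3 / inn c b3 b3) *\<^sub>R b3 + (inn c v b4 / inn c b4 b4) *\<^sub>R b4 +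
     (inn c v b5 / inn c b5 b5) *\<^sub>R b5"
proof -
  have comm: "inn c b2 b1 = 0" "inn c b3 b1 = 0" "inn c b4 b1 = 0" "inn c b5 b1 = 0" "inn c b3 b2 = 0"
     "inn c b4 b2 = 0" "inn c b5 b2 = 0" "inn c b4 b3 = 0" "inn c b5 b3 = 0" "inn c b5 b4 = 0"
    using b unfolding orthobasis_def by (simp_all add: inn_commute)
  show ?thesis
    by (rule orthobasis_eqI[OF c b]) (use b comm in \<open>simp_all add: inn_simps orthobasis_def\<close>)
qed

lemma orthobasis_parseval:
  assumes c: "c \<noteq> 0" and b: "orthobasis c b1 b2 b3 b4 b5"
  shows "inn c v w = inn c v b1 * inn c w b1 / inn c b1 b1 + inn c v b2 * inn c w b2 / inn c b2 b2 +
     inn c v b3 * inn c w b3 / inn c b3 b3 + inn c v b4 * inn c w b4 / inn c b4 b4 +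
     inn c v b5 * inn c w b5 / inn c b5 b5"
  by (subst orthobasis_expansion[OF c b, of v]) (simp add: inn_simps inn_commute)

section \<open>Tangential projection and curvature of the product space\<close>

lemma tproj_eq: "tproj c q w = w - (c * inn c w (hor q)) *\<^sub>R hor q"
  by (simp add: tproj_def hor_def)

lemma linear_tproj: "linear (tproj c q)"
  by (rule linearI) (auto simp: tproj_eq inn_simps algebra_simps)

lemma inn_tproj_hor:
  "c \<noteq> 0 \<Longrightarrow> fst q \<in> space_form c \<Longrightarrow> inn c (tproj c q w) (hor q) = 0"
  by (simp add: tproj_eq inn_simps inn_hor_self)

lemma tproj_tangent: "inn c w (hor q) = 0 \<Longrightarrow> tproj c q w = w"
  by (simp add: tproj_eq)

lemma inn_tproj_tangent: "inn c v (hor q) = 0 \<Longrightarrow> inn c (tproj c q w) v = inn c w v"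
  by (simp add: tproj_eq inn_simps inn_commute)

lemma smooth_on_inn [smooth_intros]:
  "open S \<Longrightarrow> smooth_on S f \<Longrightarrow> smooth_on S g \<Longrightarrow> smooth_on S (\<lambda>x. inn c (f x) (g x))"
  by (rule smooth_on_bounded_bilinear[OF _ bounded_bilinear_inn])

lemma smooth_on_hor [smooth_intros]: "open S \<Longrightarrow> smooth_on S f \<Longrightarrow> smooth_on S (\<lambda>x. hor (f x))"
  by (rule smooth_on_bounded_linear[OF _ bounded_linear_hor])

lemma smooth_on_tproj [smooth_intros]:
  "open S \<Longrightarrow> smooth_on S f \<Longrightarrow> smooth_on S g \<Longrightarrow> smooth_on S (\<lambda>x. tproj c (f x) (g x))"
  unfolding tproj_eq by (intro smooth_intros)

lemma has_derivative_inn [derivative_intros]: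
  "(U has_derivative U') (at p within S) \<Longrightarrow> (V has_derivative V') (at p within S) \<Longrightarrow>
    ((\<lambda>q. inn c (U q) (V q)) has_derivative (\<lambda>h. inn c (U p) (V' h) + inn c (U' h) (V p))) (at p within S)"
  by (rule bounded_bilinear.FDERIV[OF bounded_bilinear_inn])

lemma has_derivative_hor [derivative_intros]:
  "(U has_derivative U') F \<Longrightarrow> ((\<lambda>q. hor (U q)) has_derivative (\<lambda>h. hor (U' h))) F"
  by (rule bounded_linear.has_derivative[OF bounded_linear_hor])

lemma dd_inn:
  assumes "U differentiable (at p)" "V differentiable (at p)"
  shows "dd (\<lambda>q. inn c (U q) (V q)) p x = inn c (U p) (dd V p x) + inn c (dd U p x) (V p)"
  by (rule dd_eqI) (intro has_derivative_inn assms[unfolded frechet_derivative_works])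

lemma dd_hor: "U differentiable (at p) \<Longrightarrow> dd (\<lambda>q. hor (U q)) p x = hor (dd U p x)"
  by (rule dd_bounded_linear[OF bounded_linear_hor])

lemma dd_eq_0:
  assumes "open S" "p \<in> S" "\<And>q. q \<in> S \<Longrightarrow> F q = k"
  shows "dd F p x = 0"
  using dd_cong_open[OF assms, where v = x] by simp

lemma inn_const_derivative:
  assumes S: "open S" "p \<in> S" and "smooth_on S U" "smooth_on S V"
    and k: "\<And>q. q \<in> S \<Longrightarrow> inn c (U q) (V q) = k"
  shows "inn c (dd U p x) (V p) = - inn c (U p) (dd V p x)"
  using dd_inn[of U p V c x] smooth_on_imp_differentiable[OF assms(3) S(2)]
    smooth_on_imp_differentiable[OF assms(4) S(2)] dd_eq_0[of S p "\<lambda>q. inn c (U q) (V q)" k x] S k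
  by (simp add: add_eq_0_iff)

lemma dd_tproj_const:
  "dd (\<lambda>r. tproj c r x) r v = - (c * inn c x (hor v)) *\<^sub>R hor r - (c * inn c x (hor r)) *\<^sub>R hor v"
proof -
  have "((\<lambda>r. tproj c r x) has_derivative
      (\<lambda>v. - (c * inn c x (hor v)) *\<^sub>R hor r - (c * inn c x (hor r)) *\<^sub>R hor v)) (at r)"
    unfolding tproj_eq
    by (rule has_derivative_eq_rhs, (rule has_derivative_diff has_derivative_scaleR has_derivative_minus has_derivative_const
        has_derivative_mult_right has_derivative_inn has_derivative_hor has_derivative_ident)+) (simp add: inn_simps algebra_simps)
  then show ?thesis by (rule dd_eqI)
qed

text \<open>Only the space form factor is curved, which is why horizontal parts appear. Of each
  iterated covariant derivative of the extended fields a single term survives at \<open>q\<close>,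
  and their bracket vanishes there.\<close>

lemma amb_curv_eq:
  assumes c: "c \<noteq> 0" and q: "fst q \<in> space_form c"
    and tan: "inn c x (hor q) = 0" "inn c y (hor q) = 0" "inn c z (hor q) = 0"
  shows "amb_curv c q x y z = c *\<^sub>R (inn c z (hor y) *\<^sub>R hor x - inn c z (hor x) *\<^sub>R hor y)"
proof -
  have cov: "amb_cov c (\<lambda>r. tproj c r x) (amb_cov c (\<lambda>r. tproj c r y) (\<lambda>r. tproj c r z)) q
      = - (c * inn c z (hor x)) *\<^sub>R hor y"
    if tan: "inn c x (hor q) = 0" "inn c y (hor q) = 0" for x y
  proof -
    define W where "W r = tproj c r y" for r
    \<comment> \<open>\<open>A r\<close> is \<open>tproj c r (hor r)\<close>. It vanishes on the
      space form but not off it, so its derivative along tangent vectors has to be examined as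
      well.\<close>
    define A where "A r = (1 - c * inn c (hor r) (hor r)) *\<^sub>R hor r" for r
    define \<alpha> where "\<alpha> r = - (c * inn c z (hor (W r)))" for r
    define \<beta> where "\<beta> r = - (c * inn c z (hor r))" for r
    define B where "B r = tproj c r (hor (W r))" for r
    have sm: "smooth_on UNIV W" "smooth_on UNIV A" "smooth_on UNIV \<alpha>" "smooth_on UNIV \<beta>" "smooth_on UNIV B"
      unfolding W_def A_def \<alpha>_def \<beta>_def B_def
      by (intro smooth_intros open_UNIV)+
    have eq: "amb_cov c (\<lambda>r. tproj c r y) (\<lambda>r. tproj c r z) = (\<lambda>r. \<alpha> r *\<^sub>R A r + \<beta> r *\<^sub>R B r)"
    proof
      fix r
      have "amb_cov c (\<lambda>r. tproj c r y) (\<lambda>r. tproj c r z) r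
          = tproj c r (\<alpha> r *\<^sub>R hor r + \<beta> r *\<^sub>R hor (W r))"
        by (simp add: amb_cov_def dd_tproj_const \<alpha>_def \<beta>_def W_def)
      also have "\<dots> = \<alpha> r *\<^sub>R A r + \<beta> r *\<^sub>R B r"
        by (simp only: linear_add[OF linear_tproj] linear_scale[OF linear_tproj] A_def B_def)
          (simp add: tproj_eq algebra_simps)
      finally show "amb_cov c (\<lambda>r. tproj c r y) (\<lambda>r. tproj c r z) r = \<alpha> r *\<^sub>R A r + \<beta> r *\<^sub>R B r" .
    qed
    have A0: "A q = 0" using inn_hor_self[OF c q] c by (simp add: A_def)
    have "(A has_derivative (\<lambda>v. (1 - c * inn c (hor q) (hor q)) *\<^sub>R hor v +
       (- (c * (inn c (hor q) (hor v) + inn c (hor v) (hor q)))) *\<^sub>R hor q)) (at q)"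
      unfolding A_def
      by (rule has_derivative_eq_rhs, (rule has_derivative_diff has_derivative_scaleR has_derivative_minus has_derivative_const
        has_derivative_mult_right has_derivative_inn has_derivative_hor has_derivative_ident)+) (simp add: algebra_simps)
    from dd_eqI[OF this, of x] have dA: "dd A q x = 0"
      using inn_hor_self[OF c q] c tan(1) inn_hor_commute[of c q x] by simp
    have "(\<beta> has_derivative (\<lambda>v. - (c * inn c z (hor v)))) (at q)"
      unfolding \<beta>_def
      by (rule has_derivative_eq_rhs, (rule has_derivative_diff has_derivative_scaleR has_derivative_minus has_derivative_const
        has_derivative_mult_right has_derivative_inn has_derivative_hor has_derivative_ident)+) (simp add: inn_simps)
    from dd_eqI[OF this, of x] have d\<beta>: "dd \<beta> q x = - (c * inn c z (hor x))" .
    \<comment> \<open>Tangency of \<open>z\<close> makes \<open>\<beta>\<close> vanish at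
      \<open>q\<close>. Together with \<open>A q = 0\<close> and \<open>dd A q x = 0\<close> this
      leaves only the term with \<open>dd \<beta> q x\<close> and \<open>B q\<close>.\<close>
    have \<beta>0: "\<beta> q = 0" using \<open>inn c z (hor q) = 0\<close> by (simp add: \<beta>_def)
    have Bq: "B q = hor y" using tan(2) by (simp add: B_def W_def tproj_tangent)
    have "((\<lambda>r. \<alpha> r *\<^sub>R A r + \<beta> r *\<^sub>R B r) has_derivative
      (\<lambda>v. \<alpha> q *\<^sub>R dd A q v + dd \<alpha> q v *\<^sub>R A q + (\<beta> q *\<^sub>R dd B q v + dd \<beta> q v *\<^sub>R B q))) (at q)"
      by (intro has_derivative_add has_derivative_scaleR smooth_on_imp_has_derivative[OF _ UNIV_I] sm)
    from dd_eqI[OF this, of x] have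
      "dd (\<lambda>r. \<alpha> r *\<^sub>R A r + \<beta> r *\<^sub>R B r) q x = - (c * inn c z (hor x)) *\<^sub>R hor y"
      by (simp add: A0 dA \<beta>0 d\<beta> Bq)
    then show ?thesis
      unfolding eq using tan by (simp add: amb_cov_def tproj_tangent inn_simps)
  qed
  have br: "bracket (\<lambda>r. tproj c r x) (\<lambda>r. tproj c r y) q = 0"
    using tan inn_hor_commute[of c x y] by (simp add: bracket_def dd_tproj_const tproj_tangent)
  have "amb_cov c (bracket (\<lambda>r. tproj c r x) (\<lambda>r. tproj c r y)) (\<lambda>r. tproj c r z) q = 0"
    unfolding amb_cov_def br dd_tproj_const by (simp add: inn_simps hor_simps linear_0[OF linear_tproj])
  then show ?thesis
    unfolding amb_curv_def amb_curv_field_def cov[OF tan(1,2)] cov[OF tan(2,1)]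
    by (simp add: scaleR_diff_right)
qed

section \<open>Immersed patches\<close>

abbreviation hess :: "('a::real_normed_vector \<Rightarrow> 'b::real_normed_vector) \<Rightarrow> 'a \<Rightarrow> 'a \<Rightarrow> 'a \<Rightarrow> 'b" where
  "hess \<phi> p x y \<equiv> dd (\<lambda>q. dd \<phi> q y) p x"

lemma smooth_on_dd_field [smooth_intros]:
  fixes \<phi> :: "plane \<Rightarrow> 'b::real_normed_vector"
  assumes "open S" "smooth_on S \<phi>" "smooth_on S v"
  shows "smooth_on S (\<lambda>p. dd \<phi> p (v p))"
proof -
  have "smooth_on S (\<lambda>p. fst (v p) *\<^sub>R dd \<phi> p (1, 0) + snd (v p) *\<^sub>R dd \<phi> p (0, 1))"
    by (intro smooth_intros smooth_on_dd assms)
  moreover have "dd \<phi> p (v p) = fst (v p) *\<^sub>R dd \<phi> p (1, 0) + snd (v p) *\<^sub>R dd \<phi> p (0, 1)"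
    if "p \<in> S" for p
    by (rule dd_plane[OF smooth_on_imp_differentiable[OF assms(2) that]])
  ultimately show ?thesis
    using smooth_on_cong[OF assms(1), of "\<lambda>p. dd \<phi> p (v p)"
        "\<lambda>p. fst (v p) *\<^sub>R dd \<phi> p (1, 0) + snd (v p) *\<^sub>R dd \<phi> p (0, 1)"] by simp
qed

lemma linear_metric_trace:
  assumes "linear L"
  shows "L (metric_trace c f p b) = metric_trace c f p (\<lambda>x y. L (b x y))"
  by (simp add: metric_trace_def Let_def linear_scale[OF assms] linear_add[OF assms] linear_diff[OF assms])

lemma metric_trace_diff: "metric_trace c f p (\<lambda>x y. b x y - b' x y) = metric_trace c f p b - metric_trace c f p b'"
  by (simp add: metric_trace_def Let_def algebra_simps)

lemma metric_trace_minus: "metric_trace c f p (\<lambda>x y. - b x y) = - metric_trace c f p b"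
  by (simp add: metric_trace_def Let_def algebra_simps)

lemma metric_trace_scaleR:
  "metric_trace c f p (\<lambda>x y. k x y *\<^sub>R w) = metric_trace c f p k *\<^sub>R w"
  by (rule linear_metric_trace[of "\<lambda>r. r *\<^sub>R w", symmetric]) (auto intro: linearI simp: algebra_simps)

lemma metric_trace_cmult:
  fixes b :: "plane \<Rightarrow> plane \<Rightarrow> real"
  shows "metric_trace c f p (\<lambda>x y. r * b x y) = r * metric_trace c f p b"
  by (rule linear_metric_trace[of "(*) r", symmetric]) (auto intro: linearI simp: algebra_simps)

text \<open>The Laplace-Beltrami operator of the induced metric, applied componentwise to
  vector-valued maps. The tension field and, for horizontal tension, its rough Laplacian are
  obtained from it by projection.\<close>

definition laplace :: "real \<Rightarrow> (plane \<Rightarrow> ambient) \<Rightarrow> (plane \<Rightarrow> 'b::real_normed_vector) \<Rightarrow> plane \<Rightarrow> 'b" where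
  "laplace c f \<phi> p = metric_trace c f p (\<lambda>x y. hess \<phi> p x y - dd \<phi> p (christoffel c f p x y))"

locale patch =
  fixes c :: real and D :: "plane set" and f :: "plane \<Rightarrow> ambient"
  assumes c: "c \<noteq> 0" and openD: "open D" and imm: "immersion c D f"
begin

lemma smooth: "smooth_on D f"
  and space_form: "p \<in> D \<Longrightarrow> fst (f p) \<in> space_form c"
  and inj: "p \<in> D \<Longrightarrow> inj (dd f p)"
  using imm by (auto simp: immersion_def)

lemma linear_df: "p \<in> D \<Longrightarrow> linear (dd f p)"
  using linear_dd smooth by blast

lemma smooth_df: "smooth_on D (\<lambda>p. dd f p x)"
  using smooth_on_dd smooth by blast

lemmas diff_f = smooth_on_imp_differentiable[OF smooth]

lemmas diff_df = smooth_on_imp_differentiable[OF smooth_df]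

lemma hess_commute: "p \<in> D \<Longrightarrow> hess f p x y = hess f p y x"
  by (rule second_derivative_symmetric[OF openD smooth])

lemma inn_f_hor: "p \<in> D \<Longrightarrow> inn c (f p) (hor (f p)) = 1 / c"
  using inn_hor_self[OF c space_form] .

lemma df_tangent: assumes "p \<in> D" shows "inn c (dd f p x) (hor (f p)) = 0"
proof -
  have "inn c (dd f p x) (hor (f p)) = - inn c (f p) (dd (\<lambda>q. hor (f q)) p x)"
    by (rule inn_const_derivative[OF openD assms smooth _ inn_f_hor])
      (intro smooth_intros openD smooth)
  also have "\<dots> = - inn c (dd f p x) (hor (f p))"
    by (simp add: dd_hor diff_f assms inn_hor_commute)
  finally show ?thesis by simp
qed

lemma inn_hess_hor: assumes "p \<in> D"
  shows "inn c (hess f p x y) (hor (f p)) = - inn c (dd f p x) (hor (dd f p y))"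
proof -
  have "inn c (hess f p x y) (hor (f p)) = - inn c (dd f p y) (dd (\<lambda>q. hor (f q)) p x)"
    by (rule inn_const_derivative[OF openD assms smooth_df _ df_tangent])
      (intro smooth_intros openD smooth)
  then show ?thesis by (simp add: dd_hor diff_f assms inn_hor_commute)
qed

lemma fff_pos: assumes "p \<in> D" "x \<noteq> 0" shows "fff c f p x x > 0"
proof -
  have "dd f p x \<noteq> 0"
    using inj[OF assms(1)] assms(2) linear_0[OF linear_df[OF assms(1)]] by (metis injD)
  then show ?thesis
    unfolding fff_def using inn_pos[OF space_form df_tangent] assms(1) c by blast
qed

lemma fff_commute: "fff c f p x y = fff c f p y x"
  by (simp add: fff_def inn_commute)

lemma linear_fff: "p \<in> D \<Longrightarrow> linear (fff c f p x)"
  unfolding fff_def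
  using linear_compose[OF linear_df linear_inn_right] by (simp add: o_def)

lemma fff_expand: assumes "p \<in> D"
  shows "fff c f p x y = fst x * fst y * fff c f p (1, 0) (1, 0)
    + (fst x * snd y + snd x * fst y) * fff c f p (1, 0) (0, 1) + snd x * snd y * fff c f p (0, 1) (0, 1)"
  unfolding fff_def dd_plane[OF diff_f[OF assms], of x] dd_plane[OF diff_f[OF assms], of y]
  by (simp add: inn_simps inn_commute[of c "dd f p (0,1)" "dd f p (1,0)"] algebra_simps)

definition gram :: "plane \<Rightarrow> real" where
  "gram p = fff c f p (1, 0) (1, 0) * fff c f p (0, 1) (0, 1) - (fff c f p (1, 0) (0, 1))\<^sup>2"

text \<open>The vector \<open>(- F, E)\<close> is orthogonal to the first basis vector and has
  square \<open>E * gram p\<close>.\<close>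

lemma gram_pos: assumes "p \<in> D" shows "gram p > 0"
proof -
  let ?E = "fff c f p (1, 0) (1, 0)" and ?F = "fff c f p (1, 0) (0, 1)" and ?G = "fff c f p (0, 1) (0, 1)"
  have E: "?E > 0" by (rule fff_pos[OF assms]) (simp add: zero_prod_def)
  have "fff c f p (- ?F, ?E) (- ?F, ?E) > 0"
    by (rule fff_pos[OF assms]) (use E in \<open>simp add: zero_prod_def\<close>)
  also have "fff c f p (- ?F, ?E) (- ?F, ?E) = ?E * gram p"
    unfolding fff_expand[OF assms, of "(- ?F, ?E)"] by (simp add: gram_def power2_eq_square algebra_simps)
  finally show ?thesis using E by (simp add: zero_less_mult_iff)
qed

lemma metric_trace_eq:
  "metric_trace c f p b = (1 / gram p) *\<^sub>R (fff c f p (0, 1) (0, 1) *\<^sub>R b (1, 0) (1, 0)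
    - fff c f p (1, 0) (0, 1) *\<^sub>R (b (1, 0) (0, 1) + b (0, 1) (1, 0))
    + fff c f p (1, 0) (1, 0) *\<^sub>R b (0, 1) (0, 1))"
  by (simp add: metric_trace_def Let_def gram_def)

text \<open>\<open>metric_trace\<close> of \<open>k\<close> times the identity raises the index of
  the linear form \<open>k\<close>. Christoffel vectors, tangential parts, the gradient of the
  height and the shape operator are all of this kind.\<close>

lemma fff_metric_dual:
  assumes p: "p \<in> D" and k: "linear k"
  shows "fff c f p (metric_trace c f p (\<lambda>z w. k z *\<^sub>R w)) v = k v"
proof -
  let ?E = "fff c f p (1, 0) (1, 0)" and ?F = "fff c f p (1, 0) (0, 1)" and ?G = "fff c f p (0, 1) (0, 1)"
  have g: "gram p \<noteq> 0" using gram_pos[OF p] by simp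
  have "v = fst v *\<^sub>R (1, 0) + snd v *\<^sub>R (0, 1)" by (cases v) simp
  then have kv: "k v = fst v * k (1, 0) + snd v * k (0, 1)"
    using linear_add[OF k] linear_scale[OF k] by (metis real_scaleR_def)
  define M where "M = metric_trace c f p (\<lambda>z w. k z *\<^sub>R w)"
  have M: "fst M = (?G * k (1, 0) - ?F * k (0, 1)) / gram p" "snd M = (?E * k (0, 1) - ?F * k (1, 0)) / gram p"
    unfolding M_def metric_trace_eq by (simp_all add: mult.commute)
  have "fst M * ?E + snd M * ?F = k (1, 0) * gram p / gram p"
    unfolding M by (simp add: gram_def power2_eq_square algebra_simps flip: add_divide_distrib)
  moreover have "fst M * ?F + snd M * ?G = k (0, 1) * gram p / gram p"
    unfolding M by (simp add: gram_def power2_eq_square algebra_simps flip: add_divide_distrib)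
  ultimately have *: "fst M * ?E + snd M * ?F = k (1, 0)" "fst M * ?F + snd M * ?G = k (0, 1)"
    using g by simp_all
  have "fff c f p M v = fst v * (fst M * ?E + snd M * ?F) + snd v * (fst M * ?F + snd M * ?G)"
    unfolding fff_expand[OF p, of M v] by (simp add: algebra_simps)
  then show ?thesis unfolding * kv unfolding M_def .
qed

lemma smooth_fff: "smooth_on D (\<lambda>p. fff c f p x y)"
  unfolding fff_def by (intro smooth_intros openD smooth_df)

lemma smooth_gram: "smooth_on D gram"
  unfolding gram_def[abs_def] by (intro smooth_intros openD smooth_fff)

lemma smooth_metric_trace [smooth_intros]:
  "(\<And>x y. smooth_on D (\<lambda>p. b p x y)) \<Longrightarrow> smooth_on D (\<lambda>p. metric_trace c f p (b p))"
  unfolding metric_trace_eq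
  by (intro smooth_intros openD smooth_fff smooth_gram) (use gram_pos in force)+

lemma smooth_christoffel: "smooth_on D (\<lambda>p. christoffel c f p x y)"
  unfolding christoffel_def by (intro smooth_intros openD smooth_on_dd smooth_fff) simp

text \<open>The ambient form is constant, so derivatives of the metric are pairings of
  \<open>hess f\<close> with \<open>dd f\<close>; symmetry of \<open>hess f\<close> cancels all but
  one of them. This ties the intrinsic connection to the flat derivative.\<close>

lemma koszul:
  assumes p: "p \<in> D"
  shows "(dd (\<lambda>q. fff c f q y z) p x + dd (\<lambda>q. fff c f q x z) p y - dd (\<lambda>q. fff c f q x y) p z) / 2
    = inn c (hess f p x y) (dd f p z)"
proof -
  have *: "dd (\<lambda>q. fff c f q u v) p w = inn c (hess f p w u) (dd f p v) + inn c (hess f p w v) (dd f p u)" for u v w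
    unfolding fff_def using dd_inn[OF diff_df[OF p] diff_df[OF p]] by (simp add: inn_commute)
  show ?thesis
    unfolding * hess_commute[OF p, of y x] hess_commute[OF p, of z x] hess_commute[OF p, of z y] by simp
qed

lemma christoffel_eq:
  "p \<in> D \<Longrightarrow> christoffel c f p x y = metric_trace c f p (\<lambda>z w. inn c (hess f p x y) (dd f p z) *\<^sub>R w)"
  by (simp add: christoffel_def koszul)

lemma fff_christoffel:
  assumes "p \<in> D" shows "fff c f p (christoffel c f p x y) z = inn c (hess f p x y) (dd f p z)"
  unfolding christoffel_eq[OF assms]
  by (rule fff_metric_dual[OF assms])
    (use linear_compose[OF linear_df[OF assms] linear_inn_right] in \<open>simp add: o_def\<close>)

lemma tang_eq:
  assumes "p \<in> D"
  shows "tang c f p w = dd f p (metric_trace c f p (\<lambda>x y. inn c w (dd f p x) *\<^sub>R y))"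
  unfolding tang_def linear_metric_trace[OF linear_df[OF assms]]
  by (simp add: linear_scale[OF linear_df[OF assms]])

lemma inn_tang:
  assumes "p \<in> D" shows "inn c (tang c f p w) (dd f p v) = inn c w (dd f p v)"
  unfolding tang_eq[OF assms] fff_def[symmetric]
  by (rule fff_metric_dual[OF assms])
    (use linear_compose[OF linear_df[OF assms] linear_inn_right] in \<open>simp add: o_def\<close>)

lemma tang_unique:
  assumes p: "p \<in> D" and "\<And>v. inn c (dd f p u) (dd f p v) = inn c w (dd f p v)"
  shows "tang c f p w = dd f p u"
proof -
  obtain t where t: "tang c f p w = dd f p t" using tang_eq[OF p] by blast
  have "fff c f p (t - u) (t - u) = 0"
    unfolding fff_def linear_diff[OF linear_df[OF p]]
    using inn_tang[OF p, of w] assms(2) by (simp add: t inn_simps)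
  then have "t - u = 0" using fff_pos[OF p, of "t - u"] by force
  then show ?thesis using t by simp
qed

text \<open>Gauss formula: the tangential part of the second derivative is the Christoffel
  term.\<close>

lemma second_ff_eq:
  assumes "p \<in> D"
  shows "second_ff c f p x y = tproj c (f p) (hess f p x y) - dd f p (christoffel c f p x y)"
proof -
  have "tang c f p (tproj c (f p) (hess f p x y)) = dd f p (christoffel c f p x y)"
    by (rule tang_unique[OF assms])
      (simp add: inn_tproj_tangent df_tangent assms fff_christoffel flip: fff_def)
  then show ?thesis by (simp add: second_ff_def pcov_def)
qed

lemma inn_second_ff_df: "p \<in> D \<Longrightarrow> inn c (second_ff c f p x y) (dd f p z) = 0"
  by (simp add: second_ff_eq inn_simps inn_tproj_tangent df_tangent fff_christoffel flip: fff_def)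

lemma inn_second_ff_hor: "p \<in> D \<Longrightarrow> inn c (second_ff c f p x y) (hor (f p)) = 0"
  by (simp add: second_ff_eq inn_simps inn_tproj_hor c space_form df_tangent)

lemma tension_eq: "p \<in> D \<Longrightarrow> tension c f p = metric_trace c f p (second_ff c f p)"
  unfolding tension_def pcov_def by (simp add: second_ff_eq metric_trace_def)

lemma mean_curv_eq: "p \<in> D \<Longrightarrow> mean_curv c f p = (1 / 2) *\<^sub>R tension c f p"
  by (simp add: mean_curv_def tension_eq)

lemma inn_tension_df: "p \<in> D \<Longrightarrow> inn c (tension c f p) (dd f p z) = 0"
  unfolding tension_eq linear_metric_trace[OF linear_inn_left] inn_second_ff_df
  by (simp add: metric_trace_def Let_def)

lemma inn_tension_hor: "p \<in> D \<Longrightarrow> inn c (tension c f p) (hor (f p)) = 0"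
  unfolding tension_eq linear_metric_trace[OF linear_inn_left] inn_second_ff_hor
  by (simp add: metric_trace_def Let_def)

lemma smooth_laplace:
  fixes \<phi> :: "plane \<Rightarrow> 'b::real_normed_vector"
  shows "smooth_on D \<phi> \<Longrightarrow> smooth_on D (\<lambda>p. laplace c f \<phi> p)"
  unfolding laplace_def
  by (intro smooth_metric_trace smooth_on_diff openD smooth_on_dd smooth_on_dd_field smooth_christoffel)

lemma tension_eq_laplace:
  assumes p: "p \<in> D" shows "tension c f p = tproj c (f p) (laplace c f f p)"
  unfolding tension_eq[OF p] laplace_def linear_metric_trace[OF linear_tproj]
  by (simp add: second_ff_eq p linear_diff[OF linear_tproj] tproj_tangent df_tangent metric_trace_def)

lemma smooth_tension: "smooth_on D (\<lambda>p. tension c f p)"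
proof -
  have "smooth_on D (\<lambda>p. tproj c (f p) (laplace c f f p))"
    by (intro smooth_intros openD smooth smooth_laplace)
  then show ?thesis
    using smooth_on_cong[OF openD, of "tension c f" "\<lambda>p. tproj c (f p) (laplace c f f p)"]
      tension_eq_laplace by simp
qed

text \<open>Squared norm of the horizontal part of the differential, equal to
  \<open>2 - |T|^2\<close> by \<open>hmass_eq\<close>. It governs both the position component of the
  Laplacian of \<open>f\<close> and the curvature term of the bitension field.\<close>

definition hmass :: "plane \<Rightarrow> real" where
  "hmass p = metric_trace c f p (\<lambda>x y. inn c (dd f p x) (hor (dd f p y)))"

text \<open>The component along the position vector comes from differentiating the orthogonality of
  \<open>dd f\<close> and \<open>hor f\<close>.\<close>

lemma laplace_f:
  assumes p: "p \<in> D"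
  shows "laplace c f f p = tension c f p - (c * hmass p) *\<^sub>R hor (f p)"
proof -
  have "inn c (laplace c f f p) (hor (f p)) = - hmass p"
    unfolding laplace_def linear_metric_trace[OF linear_inn_left] hmass_def
    by (simp add: inn_simps inn_hess_hor df_tangent p metric_trace_minus)
  then show ?thesis by (simp add: tension_eq_laplace[OF p] tproj_eq)
qed

end

section \<open>The bitension field for horizontal mean curvature\<close>

locale horizontal_patch = patch +
  assumes snd_tension: "p \<in> D \<Longrightarrow> snd (tension c f p) = 0"
begin

lemma hor_tension: "p \<in> D \<Longrightarrow> hor (tension c f p) = tension c f p"
  by (simp add: hor_eq_self snd_tension)

text \<open>Differentiating the orthogonality of the tension field and \<open>hor f\<close> leaves
  its pairing with \<open>hor (dd f p x)\<close>, zero because the field is both horizontal and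
  normal. Hence its flat derivative is already the covariant one.\<close>

lemma inn_dd_tension_hor:
  assumes p: "p \<in> D" shows "inn c (dd (tension c f) p x) (hor (f p)) = 0"
proof -
  have "inn c (dd (tension c f) p x) (hor (f p)) = - inn c (tension c f p) (dd (\<lambda>q. hor (f q)) p x)"
    by (rule inn_const_derivative[OF openD p _ _ inn_tension_hor])
      (intro smooth_intros openD smooth smooth_tension)+
  also have "\<dots> = - inn c (hor (tension c f p)) (dd f p x)"
    by (simp add: dd_hor diff_f p)
  also have "\<dots> = 0" by (simp only: hor_tension[OF p] inn_tension_df[OF p])
  finally show ?thesis .
qed

text \<open>Only the outer one of the two nested derivatives still needs a projection. In the
  curvature term the tension field pairs to zero with \<open>dd f\<close>, which leaves a multiple
  of the tension field itself.\<close>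

lemma bitension_eq:
  assumes p: "p \<in> D"
  shows "bitension c f p = tproj c (f p) (laplace c f (tension c f) p) + (c * hmass p) *\<^sub>R tension c f p"
proof -
  have pc: "pcov c f (tension c f) q y = dd (tension c f) q y" if "q \<in> D" for q y
    unfolding pcov_def by (rule tproj_tangent[OF inn_dd_tension_hor[OF that]])
  have "rough_laplacian c f (tension c f) p = tproj c (f p) (laplace c f (tension c f) p)"
    unfolding rough_laplacian_def laplace_def linear_metric_trace[OF linear_tproj]
      linear_diff[OF linear_tproj]
    using dd_cong_open[OF openD p pc] by (simp add: pcov_def)
  moreover have curv: "amb_curv c (f p) (dd f p x) (tension c f p) (dd f p y)
      = - ((c * inn c (dd f p x) (hor (dd f p y))) *\<^sub>R tension c f p)" for x y
  proof -
    have "inn c (dd f p y) (tension c f p) = 0"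
      using inn_tension_df[OF p, of y] by (simp only: inn_commute)
    then show ?thesis
      unfolding amb_curv_eq[OF c space_form[OF p] df_tangent[OF p] inn_tension_hor[OF p] df_tangent[OF p]]
        hor_tension[OF p] inn_hor_commute[of c "dd f p x" "dd f p y"]
      by simp
  qed
  have "metric_trace c f p (\<lambda>x y. amb_curv c (f p) (dd f p x) (tension c f p) (dd f p y))
     = - ((c * hmass p) *\<^sub>R tension c f p)"
    unfolding curv metric_trace_minus metric_trace_scaleR metric_trace_cmult hmass_def ..
  ultimately show ?thesis by (simp add: bitension_def)
qed

end

section \<open>The Laplacian in divergence form\<close>

context patch
begin

lemma laplace_bounded_linear:
  assumes L: "bounded_linear L" and \<phi>: "smooth_on D \<phi>" and p: "p \<in> D"
  shows "laplace c f (\<lambda>q. L (\<phi> q)) p = L (laplace c f \<phi> p)"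
proof -
  have 1: "dd (\<lambda>q. L (\<phi> q)) q x = L (dd \<phi> q x)" if "q \<in> D" for q x
    by (rule dd_bounded_linear[OF L smooth_on_imp_differentiable[OF \<phi> that]])
  have 2: "hess (\<lambda>q. L (\<phi> q)) p x y = L (hess \<phi> p x y)" for x y
  proof -
    have "hess (\<lambda>q. L (\<phi> q)) p x y = dd (\<lambda>q. L (dd \<phi> q y)) p x"
      by (rule dd_cong_open[OF openD p]) (rule 1)
    also have "\<dots> = L (hess \<phi> p x y)"
      by (rule dd_bounded_linear[OF L smooth_on_imp_differentiable[OF smooth_on_dd[OF \<phi>] p]])
    finally show ?thesis .
  qed
  show ?thesis
    unfolding laplace_def linear_metric_trace[OF bounded_linear.linear[OF L]]
    by (simp add: 1 2 p linear_diff[OF bounded_linear.linear[OF L]])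
qed

text \<open>In this form harmonicity is the closedness of the Hodge dual of the differential. Both
  sides are cleared of denominators and compared as polynomials in the metric coefficients and the
  derivatives.\<close>

lemma laplace_divergence_form:
  fixes \<phi> :: "plane \<Rightarrow> real"
  assumes \<phi>: "smooth_on D \<phi>" and p: "p \<in> D"
  shows "laplace c f \<phi> p * sqrt (gram p) =
    dd (\<lambda>q. (fff c f q (0, 1) (0, 1) * dd \<phi> q (1, 0) - fff c f q (1, 0) (0, 1) * dd \<phi> q (0, 1)) / sqrt (gram q)) p (1, 0)
    + dd (\<lambda>q. (fff c f q (1, 0) (1, 0) * dd \<phi> q (0, 1) - fff c f q (1, 0) (0, 1) * dd \<phi> q (1, 0)) / sqrt (gram q)) p (0, 1)"
proof -
  define E where "E q = fff c f q (1, 0) (1, 0)" for q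
  define F where "F q = fff c f q (1, 0) (0, 1)" for q
  define G where "G q = fff c f q (0, 1) (0, 1)" for q
  define U where "U q = dd \<phi> q (1, 0)" for q
  define V where "V q = dd \<phi> q (0, 1)" for q
  have gram: "gram = (\<lambda>q. E q * G q - F q * F q)"
    by (rule ext) (simp add: gram_def E_def F_def G_def power2_eq_square)
  have sm: "smooth_on D E" "smooth_on D F" "smooth_on D G" "smooth_on D U" "smooth_on D V"
    unfolding E_def F_def G_def U_def V_def by (intro smooth_fff smooth_on_dd \<phi>)+
  note der = sm[THEN smooth_on_imp_has_derivative, OF p]
  have g: "E p * G p - F p * F p > 0" using gram_pos[OF p] by (simp add: gram)
  \<comment> \<open>One quotient rule serves both fluxes, which differ by exchanging
    \<open>E\<close> with \<open>G\<close> and \<open>U\<close> with \<open>V\<close>.\<close>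
  have quot: "dd (\<lambda>q. (A q * X q - F q * Y q) / sqrt (gram q)) p e =
     ((A p * dd X p e + dd A p e * X p - (F p * dd Y p e + dd F p e * Y p)) * (2 * gram p)
      - (A p * X p - F p * Y p) * (E p * dd G p e + dd E p e * G p - 2 * F p * dd F p e))
     / (2 * gram p * sqrt (gram p))"
    if "(A has_derivative dd A p) (at p)" "(X has_derivative dd X p) (at p)" "(Y has_derivative dd Y p) (at p)"
    for A X Y e
  proof -
    have "((\<lambda>q. (A q * X q - F q * Y q) / sqrt (gram q)) has_derivative (\<lambda>e.
      ((A p * dd X p e + dd A p e * X p - (F p * dd Y p e + dd F p e * Y p)) * sqrt (gram p) -
        (A p * X p - F p * Y p) * ((E p * dd G p e + dd E p e * G p - (F p * dd F p e + dd F p e * F p)) *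
          (inverse (sqrt (gram p)) / 2))) / (sqrt (gram p) * sqrt (gram p)))) (at p)"
      unfolding gram
      using g by (intro has_derivative_divide' has_derivative_diff has_derivative_mult that der
          has_derivative_real_sqrt) auto
    note 1 = dd_eqI[OF this, of e]
    have 2: "(n * s - m * (k * (inverse s / 2))) / (s * s) = (n * (2 * (s * s)) - m * k) / (2 * (s * s) * s)"
      if "s \<noteq> 0" for n m k s :: real
      using that by (simp add: field_simps)
    have nz: "sqrt (gram p) \<noteq> 0" and sq: "sqrt (gram p) * sqrt (gram p) = gram p"
      using g by (simp_all add: gram)
    have FF: "F p * dd F p e + dd F p e * F p = 2 * F p * dd F p e" by simp
    show ?thesis unfolding 1 unfolding 2[OF nz] unfolding sq FF ..
  qed
  have hUV: "dd U p (0, 1) = dd V p (1, 0)"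
    unfolding U_def V_def by (rule second_derivative_symmetric[OF openD \<phi> p])
  define s where "s = sqrt (gram p)"
  have s: "s > 0" "s * s = E p * G p - F p * F p" using g by (auto simp: s_def gram)
  have comm: "(\<lambda>q. fff c f q (0, 1) (1, 0)) = F" by (rule ext) (simp add: F_def fff_commute)
  have E': "(\<lambda>q. fff c f q (1, 0) (1, 0)) = E" "(\<lambda>q. fff c f q (1, 0) (0, 1)) = F"
    "(\<lambda>q. fff c f q (0, 1) (0, 1)) = G" by (auto simp: E_def F_def G_def)
  have mt: "metric_trace c f p b = (1 / gram p) *\<^sub>R (G p *\<^sub>R b (1, 0) (1, 0)
    - F p *\<^sub>R (b (1, 0) (0, 1) + b (0, 1) (1, 0)) + E p *\<^sub>R b (0, 1) (0, 1))" for b :: "plane \<Rightarrow> plane \<Rightarrow> 'w::real_vector"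
    by (simp add: metric_trace_eq E_def F_def G_def)
  define k where "k x y z = (dd (\<lambda>q. fff c f q y z) p x + dd (\<lambda>q. fff c f q x z) p y
      - dd (\<lambda>q. fff c f q x y) p z) / 2" for x y z
  have k: "k (1, 0) (1, 0) (1, 0) = dd E p (1, 0) / 2" "k (1, 0) (1, 0) (0, 1) = dd F p (1, 0) - dd E p (0, 1) / 2"
    "k (1, 0) (0, 1) (1, 0) = dd E p (0, 1) / 2" "k (1, 0) (0, 1) (0, 1) = dd G p (1, 0) / 2"
    "k (0, 1) (1, 0) (1, 0) = dd E p (0, 1) / 2" "k (0, 1) (1, 0) (0, 1) = dd G p (1, 0) / 2"
    "k (0, 1) (0, 1) (1, 0) = dd F p (0, 1) - dd G p (1, 0) / 2" "k (0, 1) (0, 1) (0, 1) = dd G p (0, 1) / 2"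
    unfolding k_def E' comm by (simp_all add: field_simps)
  have chr: "dd \<phi> p (christoffel c f p x y) = (U p * (G p * k x y (1, 0) - F p * k x y (0, 1))
      + V p * (E p * k x y (0, 1) - F p * k x y (1, 0))) / gram p" for x y
    unfolding christoffel_def k_def[symmetric] mt
    by (subst dd_plane[OF smooth_on_imp_differentiable[OF \<phi> p]])
      (simp add: U_def V_def algebra_simps add_divide_distrib diff_divide_distrib)
  have hess: "hess \<phi> p x (1, 0) = dd U p x" "hess \<phi> p x (0, 1) = dd V p x" for x
    by (simp_all add: U_def[abs_def] V_def[abs_def])
  have clear: "(1 / g) *\<^sub>R (x *\<^sub>R (a - A / g) - y *\<^sub>R ((b - B / g) + (b' - B' / g)) + z *\<^sub>R (d - D / g)) * g * g
      = g * (x * a - y * (b + b') + z * d) - (x * A - y * (B + B') + z * D)"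
    if "g \<noteq> 0" for g x y z a A b B b' B' d D :: real
    using that by (simp add: field_simps)
  have R: "laplace c f \<phi> p * gram p * gram p = gram p * (G p * dd U p (1, 0) - F p * (dd V p (1, 0) + dd V p (1, 0)) + E p * dd V p (0, 1))
     - (G p * (U p * (G p * (dd E p (1, 0) / 2) - F p * (dd F p (1, 0) - dd E p (0, 1) / 2))
              + V p * (E p * (dd F p (1, 0) - dd E p (0, 1) / 2) - F p * (dd E p (1, 0) / 2)))
      - F p * (U p * (G p * (dd E p (0, 1) / 2) - F p * (dd G p (1, 0) / 2)) + V p * (E p * (dd G p (1, 0) / 2) - F p * (dd E p (0, 1) / 2))
         + (U p * (G p * (dd E p (0, 1) / 2) - F p * (dd G p (1, 0) / 2)) + V p * (E p * (dd G p (1, 0) / 2) - F p * (dd E p (0, 1) / 2))))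
      + E p * (U p * (G p * (dd F p (0, 1) - dd G p (1, 0) / 2) - F p * (dd G p (0, 1) / 2))
             + V p * (E p * (dd G p (0, 1) / 2) - F p * (dd F p (0, 1) - dd G p (1, 0) / 2))))"
    unfolding laplace_def mt chr k hess hUV
    by (rule clear) (use g in \<open>simp add: gram\<close>)
  have L: "l * s * (2 * gram p * s) = 2 * (l * gram p * gram p)" for l
  proof -
    have "l * s * (2 * gram p * s) = 2 * (l * gram p * (s * s))" by (simp only: mult_ac)
    then show ?thesis using s(2) by (simp only: gram)
  qed
  \<comment> \<open>The whole computation as an identity in independent variables; \<open>vu\<close>
    stands for both mixed second derivatives of \<open>\<phi>\<close>.\<close>
  have poly: "2 * ((e * g - f * f) * (g * uu - f * (vu + vu) + e * vv)
     - (g * (u * (g * (eu / 2) - f * (fu - ev / 2)) + v * (e * (fu - ev / 2) - f * (eu / 2)))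
      - f * (u * (g * (ev / 2) - f * (gu / 2)) + v * (e * (gu / 2) - f * (ev / 2))
          + (u * (g * (ev / 2) - f * (gu / 2)) + v * (e * (gu / 2) - f * (ev / 2))))
      + e * (u * (g * (fv - gu / 2) - f * (gv / 2)) + v * (e * (gv / 2) - f * (fv - gu / 2)))))
    = ((g * uu + gu * u - (f * vu + fu * v)) * (2 * (e * g - f * f))
      - (g * u - f * v) * (e * gu + eu * g - 2 * f * fu))
    + ((e * vv + ev * v - (f * vu + fv * u)) * (2 * (e * g - f * f))
      - (e * v - f * u) * (e * gv + ev * g - 2 * f * fv))"
    for e f g u v uu vu vv eu ev fu fv gu gv :: real
    by (simp add: algebra_simps)
  have "2 * (gram p * (G p * dd U p (1, 0) - F p * (dd V p (1, 0) + dd V p (1, 0)) + E p * dd V p (0, 1))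
     - (G p * (U p * (G p * (dd E p (1, 0) / 2) - F p * (dd F p (1, 0) - dd E p (0, 1) / 2))
              + V p * (E p * (dd F p (1, 0) - dd E p (0, 1) / 2) - F p * (dd E p (1, 0) / 2)))
      - F p * (U p * (G p * (dd E p (0, 1) / 2) - F p * (dd G p (1, 0) / 2)) + V p * (E p * (dd G p (1, 0) / 2) - F p * (dd E p (0, 1) / 2))
         + (U p * (G p * (dd E p (0, 1) / 2) - F p * (dd G p (1, 0) / 2)) + V p * (E p * (dd G p (1, 0) / 2) - F p * (dd E p (0, 1) / 2))))
      + E p * (U p * (G p * (dd F p (0, 1) - dd G p (1, 0) / 2) - F p * (dd G p (0, 1) / 2))
             + V p * (E p * (dd G p (0, 1) / 2) - F p * (dd F p (0, 1) - dd G p (1, 0) / 2)))))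
    = ((G p * dd U p (1, 0) + dd G p (1, 0) * U p - (F p * dd V p (1, 0) + dd F p (1, 0) * V p)) * (2 * gram p)
      - (G p * U p - F p * V p) * (E p * dd G p (1, 0) + dd E p (1, 0) * G p - 2 * F p * dd F p (1, 0)))
    + ((E p * dd V p (0, 1) + dd E p (0, 1) * V p - (F p * dd U p (0, 1) + dd F p (0, 1) * U p)) * (2 * gram p)
      - (E p * V p - F p * U p) * (E p * dd G p (0, 1) + dd E p (0, 1) * G p - 2 * F p * dd F p (0, 1)))"
    unfolding hUV gram by (rule poly)
  then have "laplace c f \<phi> p * s * (2 * gram p * s) =
    ((G p * dd U p (1, 0) + dd G p (1, 0) * U p - (F p * dd V p (1, 0) + dd F p (1, 0) * V p)) * (2 * gram p)
      - (G p * U p - F p * V p) * (E p * dd G p (1, 0) + dd E p (1, 0) * G p - 2 * F p * dd F p (1, 0)))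
    + ((E p * dd V p (0, 1) + dd E p (0, 1) * V p - (F p * dd U p (0, 1) + dd F p (0, 1) * U p)) * (2 * gram p)
      - (E p * V p - F p * U p) * (E p * dd G p (0, 1) + dd E p (0, 1) * G p - 2 * F p * dd F p (0, 1)))"
    unfolding L R .
  moreover have "2 * gram p * s \<noteq> 0" using s(1) g by (simp add: gram)
  ultimately show ?thesis
    unfolding E_def[symmetric] F_def[symmetric] G_def[symmetric] U_def[symmetric] V_def[symmetric]
    unfolding quot[OF der(3,4,5)] quot[OF der(1,5,4)] s_def[symmetric] add_divide_distrib[symmetric]
    by (rule nonzero_eq_divide_eq[THEN iffD2, rotated])
qed

end

section \<open>Isothermal coordinates from the height function\<close>

context patch
begin

definition grad_height :: "plane \<Rightarrow> plane" where
  "grad_height p = metric_trace c f p (\<lambda>x y. snd (dd f p x) *\<^sub>R y)"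

text \<open>This is \<open>|T|^2\<close>, as the derivative of the height along its own
  gradient.\<close>

definition tnorm2 :: "plane \<Rightarrow> real" where
  "tnorm2 p = snd (dd f p (grad_height p))"

lemma T_part_eq: "p \<in> D \<Longrightarrow> T_part c f p = dd f p (grad_height p)"
  by (simp add: T_part_def tang_eq inn_xi grad_height_def)

lemma fff_grad_height: assumes "p \<in> D" shows "fff c f p (grad_height p) v = snd (dd f p v)"
  unfolding grad_height_def
  by (rule fff_metric_dual[OF assms])
    (use linear_compose[OF linear_df[OF assms] linear_snd] in \<open>simp add: o_def\<close>)

lemma inn_T_part: "p \<in> D \<Longrightarrow> inn c (T_part c f p) (T_part c f p) = tnorm2 p"
  by (simp add: T_part_eq tnorm2_def fff_grad_height flip: fff_def)

lemma tnorm2_eq: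
  assumes "p \<in> D"
  shows "tnorm2 p = (fff c f p (0, 1) (0, 1) * (snd (dd f p (1, 0)))\<^sup>2
    - 2 * fff c f p (1, 0) (0, 1) * snd (dd f p (1, 0)) * snd (dd f p (0, 1))
    + fff c f p (1, 0) (1, 0) * (snd (dd f p (0, 1)))\<^sup>2) / gram p"
proof -
  have "tnorm2 p = fst (grad_height p) * snd (dd f p (1, 0)) + snd (grad_height p) * snd (dd f p (0, 1))"
    unfolding tnorm2_def by (subst dd_plane[OF diff_f[OF assms]]) simp
  then show ?thesis
    by (simp add: grad_height_def metric_trace_eq power2_eq_square algebra_simps
        add_divide_distrib diff_divide_distrib)
qed

text \<open>The metric has trace 2 with respect to itself; removing the vertical part subtracts the
  squared norm of the height differential.\<close>

lemma hmass_eq: assumes p: "p \<in> D" shows "hmass p = 2 - tnorm2 p"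
proof -
  have g: "gram p \<noteq> 0" using gram_pos[OF p] by simp
  have "fff c f p (0, 1) (0, 1) *\<^sub>R fff c f p (1, 0) (1, 0)
      - fff c f p (1, 0) (0, 1) *\<^sub>R (fff c f p (1, 0) (0, 1) + fff c f p (1, 0) (0, 1))
      + fff c f p (1, 0) (1, 0) *\<^sub>R fff c f p (0, 1) (0, 1) = 2 * gram p"
    by (simp add: gram_def power2_eq_square algebra_simps)
  then have "metric_trace c f p (fff c f p) = 2 * gram p / gram p"
    unfolding metric_trace_eq fff_commute[of p "(0, 1)" "(1, 0)"] by simp
  then have 1: "metric_trace c f p (\<lambda>x y. fff c f p x y) = 2" using g by simp
  have "metric_trace c f p (\<lambda>x y. snd (dd f p x) * snd (dd f p y)) = tnorm2 p"
    unfolding tnorm2_eq[OF p] metric_trace_eq using g by (simp add: power2_eq_square field_simps)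
  with 1 show ?thesis
    unfolding hmass_def inn_hor_right fff_def[symmetric] metric_trace_diff by simp
qed

end

context horizontal_patch
begin

text \<open>The position term in \<open>laplace_f\<close> is horizontal, so only the vertical
  component of the tension field could contribute.\<close>

lemma laplace_height: assumes p: "p \<in> D" shows "laplace c f (\<lambda>q. snd (f q)) p = 0"
  unfolding laplace_bounded_linear[OF bounded_linear_snd smooth p] laplace_f[OF p]
  by (simp add: snd_tension p)

text \<open>The equations for \<open>z\<close> say that its differential is the Hodge dual of that of the height.\<close>

lemma conjugate_height:
  assumes "p0 \<in> D"
  obtains r z where "r > 0" "ball p0 r \<subseteq> D" "smooth_on (ball p0 r) z"
    "\<And>p. p \<in> ball p0 r \<Longrightarrow> dd z p (1, 0) * sqrt (gram p) =
       fff c f p (1, 0) (0, 1) * snd (dd f p (1, 0)) - fff c f p (1, 0) (1, 0) * snd (dd f p (0, 1))"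
    "\<And>p. p \<in> ball p0 r \<Longrightarrow> dd z p (0, 1) * sqrt (gram p) =
       fff c f p (0, 1) (0, 1) * snd (dd f p (1, 0)) - fff c f p (1, 0) (0, 1) * snd (dd f p (0, 1))"
proof -
  obtain r where r: "r > 0" "ball p0 r \<subseteq> D" using assms openD open_contains_ball by blast
  define w where "w q = snd (f q)" for q
  have dw: "dd w q x = snd (dd f q x)" if "q \<in> D" for q x
    unfolding w_def by (rule dd_bounded_linear[OF bounded_linear_snd diff_f[OF that]])
  have sw: "smooth_on D w" unfolding w_def by (intro smooth_intros openD smooth)
  define P where "P q = - ((fff c f q (1, 0) (1, 0) * dd w q (0, 1) - fff c f q (1, 0) (0, 1) * dd w q (1, 0)) / sqrt (gram q))" for q
  define Q where "Q q = (fff c f q (0, 1) (0, 1) * dd w q (1, 0) - fff c f q (1, 0) (0, 1) * dd w q (0, 1)) / sqrt (gram q)" for q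
  have sq: "sqrt (gram q) \<noteq> 0" if "q \<in> D" for q using gram_pos[OF that] by simp
  have sP: "smooth_on D P" and sQ: "smooth_on D Q"
    unfolding P_def Q_def
    by (intro smooth_intros openD smooth_fff smooth_on_dd sw smooth_gram gram_pos sq; assumption)+
  \<comment> \<open>Closedness of \<open>P du + Q dv\<close> is harmonicity of the height in
    divergence form.\<close>
  have "dd P p (0, 1) = dd Q p (1, 0)" if p: "p \<in> D" for p
  proof -
    have m: "smooth_on D (\<lambda>q. - P q)" by (intro smooth_intros openD sP)
    have "dd P p (0, 1) = - dd (\<lambda>q. - P q) p (0, 1)"
      using dd_bounded_linear[OF bounded_linear_minus[OF bounded_linear_ident]
        smooth_on_imp_differentiable[OF sP p], of "(0, 1)"] by simp
    moreover have "dd Q p (1, 0) + dd (\<lambda>q. - P q) p (0, 1) = 0"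
      using laplace_divergence_form[OF sw p] laplace_height[OF p]
      by (simp add: w_def[symmetric] P_def Q_def[abs_def])
    ultimately show ?thesis by simp
  qed
  then obtain z where z: "\<And>p. p \<in> ball p0 r \<Longrightarrow> (z has_derivative (\<lambda>v. P p * fst v + Q p * snd v)) (at p)"
    and sz: "smooth_on (ball p0 r) z"
    using poincare_plane[OF open_ball convex_ball smooth_on_subset[OF sP r(2)] smooth_on_subset[OF sQ r(2)]] r(2)
    by blast
  show ?thesis
  proof (rule that[OF r sz])
    fix p assume p: "p \<in> ball p0 r"
    then have pD: "p \<in> D" using r by blast
    show "dd z p (1, 0) * sqrt (gram p) =
       fff c f p (1, 0) (0, 1) * snd (dd f p (1, 0)) - fff c f p (1, 0) (1, 0) * snd (dd f p (0, 1))"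
      using dd_eqI[OF z[OF p], of "(1, 0)"] sq[OF pD] by (simp add: P_def dw[OF pD])
    show "dd z p (0, 1) * sqrt (gram p) =
       fff c f p (0, 1) (0, 1) * snd (dd f p (1, 0)) - fff c f p (1, 0) (0, 1) * snd (dd f p (0, 1))"
      using dd_eqI[OF z[OF p], of "(0, 1)"] sq[OF pD] by (simp add: Q_def dw[OF pD])
  qed
qed

text \<open>Conjugacy expresses the fluxes of \<open>\<phi>\<close> through the form
  \<open>A dz - B dw\<close>, so second derivatives of \<open>w\<close> and \<open>z\<close> cancel
  in the divergence. What remains is the flat Laplacian of \<open>\<psi>\<close> times the Jacobian
  of \<open>(w, z)\<close>, and this Jacobian is \<open>|T|^2\<close> times the root of
  \<open>gram\<close>.\<close>

lemma laplace_isothermal_real: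
  fixes \<phi> :: "plane \<Rightarrow> real"
  assumes U: "open U" "U \<subseteq> D" and V: "open V" and sz: "smooth_on U z"
    and zu: "\<And>p. p \<in> U \<Longrightarrow> dd z p (1, 0) * sqrt (gram p) =
       fff c f p (1, 0) (0, 1) * snd (dd f p (1, 0)) - fff c f p (1, 0) (1, 0) * snd (dd f p (0, 1))"
    and zv: "\<And>p. p \<in> U \<Longrightarrow> dd z p (0, 1) * sqrt (gram p) =
       fff c f p (0, 1) (0, 1) * snd (dd f p (1, 0)) - fff c f p (1, 0) (0, 1) * snd (dd f p (0, 1))"
    and \<phi>: "smooth_on D \<phi>" and \<psi>: "smooth_on V \<psi>"
    and UV: "\<And>p. p \<in> U \<Longrightarrow> (snd (f p), z p) \<in> V" and eq: "\<And>p. p \<in> U \<Longrightarrow> \<phi> p = \<psi> (snd (f p), z p)"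
    and p: "p \<in> U"
  shows "laplace c f \<phi> p = tnorm2 p *
    (hess \<psi> (snd (f p), z p) (1, 0) (1, 0) + hess \<psi> (snd (f p), z p) (0, 1) (0, 1))"
proof -
  define w where "w q = snd (f q)" for q
  have pD: "p \<in> D" using p U by blast
  have dw: "dd w q x = snd (dd f q x)" if "q \<in> D" for q x
    unfolding w_def by (rule dd_bounded_linear[OF bounded_linear_snd diff_f[OF that]])
  have sw: "smooth_on U w"
    unfolding w_def by (intro smooth_intros U smooth_on_subset[OF smooth])
  define \<Phi> where "\<Phi> q = (w q, z q)" for q
  have s\<Phi>: "smooth_on U \<Phi>" unfolding \<Phi>_def by (intro smooth_intros U sw sz)
  have \<Phi>V: "\<Phi> ` U \<subseteq> V" using UV by (auto simp: \<Phi>_def w_def)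
  have d\<Phi>: "dd \<Phi> q x = (dd w q x, dd z q x)" if "q \<in> U" for q x
    using has_derivative_Pair[OF smooth_on_imp_has_derivative[OF sw that] smooth_on_imp_has_derivative[OF sz that]]
    unfolding \<Phi>_def by (rule dd_eqI)
  have chain: "dd (\<lambda>q. g (\<Phi> q)) q x = dd w q x * dd g (\<Phi> q) (1, 0) + dd z q x * dd g (\<Phi> q) (0, 1)"
    if g: "smooth_on V g" and q: "q \<in> U" for g :: "plane \<Rightarrow> real" and q x
  proof -
    have gd: "g differentiable at (\<Phi> q)" using smooth_on_imp_differentiable[OF g] \<Phi>V q by blast
    have "dd (\<lambda>q. g (\<Phi> q)) q x = dd g (\<Phi> q) (dd \<Phi> q x)"
      by (rule dd_compose[OF smooth_on_imp_differentiable[OF s\<Phi> q] gd])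
    then show ?thesis unfolding dd_plane[OF gd, of "dd \<Phi> q x"] by (simp add: d\<Phi>[OF q])
  qed
  define A where "A q = dd \<psi> (\<Phi> q) (1, 0)" for q
  define B where "B q = dd \<psi> (\<Phi> q) (0, 1)" for q
  have sA: "smooth_on U A" and sB: "smooth_on U B"
    unfolding A_def B_def by (intro smooth_on_compose[OF U(1) V \<Phi>V s\<Phi>] smooth_on_dd \<psi>)+
  have d\<phi>: "dd \<phi> q x = dd w q x * A q + dd z q x * B q" if "q \<in> U" for q x
  proof -
    have "dd \<phi> q x = dd (\<lambda>q. \<psi> (\<Phi> q)) q x"
      by (rule dd_cong_open[OF U(1) that]) (simp add: eq \<Phi>_def w_def)
    then show ?thesis using chain[OF \<psi> that] by (simp add: A_def B_def)
  qed
  have sq: "sqrt (gram q) > 0" "sqrt (gram q) * sqrt (gram q) = gram q" if "q \<in> U" for q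
    using gram_pos[of q] that U by auto
  have zu': "dd z q (1, 0) = (fff c f q (1, 0) (0, 1) * dd w q (1, 0) - fff c f q (1, 0) (1, 0) * dd w q (0, 1)) / sqrt (gram q)"
    and zv': "dd z q (0, 1) = (fff c f q (0, 1) (0, 1) * dd w q (1, 0) - fff c f q (1, 0) (0, 1) * dd w q (0, 1)) / sqrt (gram q)"
    if "q \<in> U" for q
  proof -
    have "q \<in> D" using that U(2) by blast
    then show "dd z q (1, 0) = (fff c f q (1, 0) (0, 1) * dd w q (1, 0) - fff c f q (1, 0) (1, 0) * dd w q (0, 1)) / sqrt (gram q)"
      "dd z q (0, 1) = (fff c f q (0, 1) (0, 1) * dd w q (1, 0) - fff c f q (1, 0) (0, 1) * dd w q (0, 1)) / sqrt (gram q)"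
      using zu[OF that] zv[OF that] sq(1)[OF that] by (simp_all add: nonzero_eq_divide_eq dw)
  qed
  \<comment> \<open>Cauchy-Riemann equations in the induced metric: the Hodge star exchanges the
    differentials of \<open>w\<close> and \<open>z\<close> up to sign.\<close>
  have c1: "(fff c f q (0, 1) (0, 1) * dd \<phi> q (1, 0) - fff c f q (1, 0) (0, 1) * dd \<phi> q (0, 1)) / sqrt (gram q)
    = A q * dd z q (0, 1) - B q * dd w q (0, 1)"
    and c2: "(fff c f q (1, 0) (1, 0) * dd \<phi> q (0, 1) - fff c f q (1, 0) (0, 1) * dd \<phi> q (1, 0)) / sqrt (gram q)
    = B q * dd w q (1, 0) - A q * dd z q (1, 0)" if q: "q \<in> U" for q
  proof -
    define s where "s = sqrt (gram q)"
    define E where "E = fff c f q (1, 0) (1, 0)"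
    define F where "F = fff c f q (1, 0) (0, 1)"
    define G where "G = fff c f q (0, 1) (0, 1)"
    have s: "s > 0" "s * s = E * G - F * F"
      using sq[OF q] by (simp_all add: s_def gram_def power2_eq_square E_def F_def G_def)
    have 1: "(G * (wu * a + ((F * wu - E * wv) / s) * b) - F * (wv * a + ((G * wu - F * wv) / s) * b)) / s
      = a * ((G * wu - F * wv) / s) - b * wv" for wu wv a b
    proof -
      have "(G * (wu * a + ((F * wu - E * wv) / s) * b) - F * (wv * a + ((G * wu - F * wv) / s) * b)) / s
        = a * ((G * wu - F * wv) / s) - b * wv * (E * G - F * F) / (s * s)"
        using s(1) by (simp add: field_simps)
      then show ?thesis using s(1) unfolding s(2)[symmetric] by simp
    qed
    have 2: "(E * (wv * a + ((G * wu - F * wv) / s) * b) - F * (wu * a + ((F * wu - E * wv) / s) * b)) / s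
      = b * wu - a * ((F * wu - E * wv) / s)" for wu wv a b
    proof -
      have "(E * (wv * a + ((G * wu - F * wv) / s) * b) - F * (wu * a + ((F * wu - E * wv) / s) * b)) / s
        = b * wu * (E * G - F * F) / (s * s) - a * ((F * wu - E * wv) / s)"
        using s(1) by (simp add: field_simps)
      then show ?thesis using s(1) unfolding s(2)[symmetric] by simp
    qed
    show "(fff c f q (0, 1) (0, 1) * dd \<phi> q (1, 0) - fff c f q (1, 0) (0, 1) * dd \<phi> q (0, 1)) / sqrt (gram q)
      = A q * dd z q (0, 1) - B q * dd w q (0, 1)"
      unfolding d\<phi>[OF q] zu'[OF q] zv'[OF q] E_def[symmetric] F_def[symmetric] G_def[symmetric] s_def[symmetric]
      by (rule 1)
    show "(fff c f q (1, 0) (1, 0) * dd \<phi> q (0, 1) - fff c f q (1, 0) (0, 1) * dd \<phi> q (1, 0)) / sqrt (gram q)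
      = B q * dd w q (1, 0) - A q * dd z q (1, 0)"
      unfolding d\<phi>[OF q] zu'[OF q] zv'[OF q] E_def[symmetric] F_def[symmetric] G_def[symmetric] s_def[symmetric]
      by (rule 2)
  qed
  have prod: "dd (\<lambda>q. g q * k q - g' q * k' q) p x =
      g p * dd k p x + dd g p x * k p - (g' p * dd k' p x + dd g' p x * k' p)"
    if "smooth_on U g" "smooth_on U k" "smooth_on U g'" "smooth_on U k'" for g k g' k' :: "plane \<Rightarrow> real" and x
    by (rule dd_eqI) (intro has_derivative_diff has_derivative_mult smooth_on_imp_has_derivative[OF _ p] that)
  have hz: "hess z p (1, 0) (0, 1) = hess z p (0, 1) (1, 0)" and hw: "hess w p (1, 0) (0, 1) = hess w p (0, 1) (1, 0)"
    by (rule second_derivative_symmetric[OF U(1) _ p], rule sz sw)+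
  have dA: "dd A p x = dd w p x * hess \<psi> (\<Phi> p) (1, 0) (1, 0) + dd z p x * hess \<psi> (\<Phi> p) (0, 1) (1, 0)" for x
    unfolding A_def by (rule chain[OF smooth_on_dd[OF \<psi>] p])
  have dB: "dd B p x = dd w p x * hess \<psi> (\<Phi> p) (1, 0) (0, 1) + dd z p x * hess \<psi> (\<Phi> p) (0, 1) (0, 1)" for x
    unfolding B_def by (rule chain[OF smooth_on_dd[OF \<psi>] p])
  have h\<psi>: "hess \<psi> (\<Phi> p) (1, 0) (0, 1) = hess \<psi> (\<Phi> p) (0, 1) (1, 0)"
    by (rule second_derivative_symmetric[OF V \<psi>]) (use \<Phi>V p in blast)
  define s where "s = sqrt (gram p)"
  have s: "s > 0" "s * s = gram p" using sq[OF p] by (simp_all add: s_def)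
  have "laplace c f \<phi> p * s = dd (\<lambda>q. A q * dd z q (0, 1) - B q * dd w q (0, 1)) p (1, 0)
      + dd (\<lambda>q. B q * dd w q (1, 0) - A q * dd z q (1, 0)) p (0, 1)"
    unfolding laplace_divergence_form[OF \<phi> pD] s_def
    using dd_cong_open[OF U(1) p c1] dd_cong_open[OF U(1) p c2] by simp
  also have "\<dots> = (dd w p (1, 0) * dd z p (0, 1) - dd w p (0, 1) * dd z p (1, 0)) *
     (hess \<psi> (\<Phi> p) (1, 0) (1, 0) + hess \<psi> (\<Phi> p) (0, 1) (0, 1))"
    unfolding prod[OF sA smooth_on_dd[OF sz] sB smooth_on_dd[OF sw]]
      prod[OF sB smooth_on_dd[OF sw] sA smooth_on_dd[OF sz]] dA dB hz hw h\<psi>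
    by (simp add: algebra_simps)
  finally have L: "laplace c f \<phi> p * s = (dd w p (1, 0) * dd z p (0, 1) - dd w p (0, 1) * dd z p (1, 0)) *
     (hess \<psi> (\<Phi> p) (1, 0) (1, 0) + hess \<psi> (\<Phi> p) (0, 1) (0, 1))" .
  have "dd w p (1, 0) * dd z p (0, 1) - dd w p (0, 1) * dd z p (1, 0) = tnorm2 p * gram p / s"
    using gram_pos[OF pD]
    unfolding zu'[OF p] zv'[OF p] tnorm2_eq[OF pD] dw[OF pD] s_def[symmetric]
    by (simp add: power2_eq_square algebra_simps diff_divide_distrib add_divide_distrib)
  also have "\<dots> = tnorm2 p * s" using s by (simp add: eq_divide_eq flip: s(2))
  finally have "laplace c f \<phi> p * s = tnorm2 p * (hess \<psi> (\<Phi> p) (1, 0) (1, 0) + hess \<psi> (\<Phi> p) (0, 1) (0, 1)) * s"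
    using L by simp
  then show ?thesis using s(1) by (simp add: \<Phi>_def w_def)
qed

text \<open>The pair of height and conjugate has Jacobian \<open>|T|^2\<close> times the root of
  \<open>gram\<close>, which is positive, so it is a local chart. The Laplacian is recorded for
  vector-valued maps because it is applied to \<open>f\<close> and to the tension field.\<close>

lemma isothermal_chart:
  assumes p0: "p0 \<in> D" and T: "\<And>p. p \<in> D \<Longrightarrow> tnorm2 p > 0"
  obtains U r G \<Phi> where "open U" "p0 \<in> U" "U \<subseteq> D" "r > 0" "homeomorphism U (ball (\<Phi> p0) r) \<Phi> G"
    "smooth_on U \<Phi>" "smooth_on (ball (\<Phi> p0) r) G"
    "\<And>q. q \<in> ball (\<Phi> p0) r \<Longrightarrow> snd (f (G q)) = fst q"
    "\<And>q. q \<in> ball (\<Phi> p0) r \<Longrightarrow> fff c (\<lambda>q. f (G q)) q (1, 0) (1, 0) = 1 / tnorm2 (G q)"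
    "\<And>q. q \<in> ball (\<Phi> p0) r \<Longrightarrow> fff c (\<lambda>q. f (G q)) q (1, 0) (0, 1) = 0"
    "\<And>q. q \<in> ball (\<Phi> p0) r \<Longrightarrow> fff c (\<lambda>q. f (G q)) q (0, 1) (0, 1) = 1 / tnorm2 (G q)"
    "\<And>q (\<phi> :: plane \<Rightarrow> ambient). q \<in> ball (\<Phi> p0) r \<Longrightarrow> smooth_on D \<phi> \<Longrightarrow>
       laplace c f \<phi> (G q) = tnorm2 (G q) *\<^sub>R
         (hess (\<lambda>q. \<phi> (G q)) q (1, 0) (1, 0) + hess (\<lambda>q. \<phi> (G q)) q (0, 1) (0, 1))"
proof -
  obtain s z where s: "s > 0" "ball p0 s \<subseteq> D" and sz: "smooth_on (ball p0 s) z"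
    and zu: "\<And>p. p \<in> ball p0 s \<Longrightarrow> dd z p (1, 0) * sqrt (gram p) =
       fff c f p (1, 0) (0, 1) * snd (dd f p (1, 0)) - fff c f p (1, 0) (1, 0) * snd (dd f p (0, 1))"
    and zv: "\<And>p. p \<in> ball p0 s \<Longrightarrow> dd z p (0, 1) * sqrt (gram p) =
       fff c f p (0, 1) (0, 1) * snd (dd f p (1, 0)) - fff c f p (1, 0) (0, 1) * snd (dd f p (0, 1))"
    using conjugate_height[OF p0] by blast
  let ?B = "ball p0 s"
  define w where "w q = snd (f q)" for q
  have dw: "dd w q x = snd (dd f q x)" if "q \<in> D" for q x
    unfolding w_def by (rule dd_bounded_linear[OF bounded_linear_snd diff_f[OF that]])
  have sw: "smooth_on ?B w"
    unfolding w_def by (intro smooth_intros open_ball smooth_on_subset[OF smooth s(2)])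
  define \<Phi> where "\<Phi> q = (w q, z q)" for q
  have s\<Phi>: "smooth_on ?B \<Phi>" unfolding \<Phi>_def by (intro smooth_intros open_ball sw sz)
  have d\<Phi>: "dd \<Phi> q x = (dd w q x, dd z q x)" if "q \<in> ?B" for q x
    using has_derivative_Pair[OF smooth_on_imp_has_derivative[OF sw that] smooth_on_imp_has_derivative[OF sz that]]
    unfolding \<Phi>_def by (rule dd_eqI)
  define J where "J q = dd w q (1, 0) * dd z q (0, 1) - dd w q (0, 1) * dd z q (1, 0)" for q
  have gp: "gram q > 0" if "q \<in> ?B" for q using gram_pos s(2) that by blast
  have J: "J q * sqrt (gram q) = tnorm2 q * gram q" if "q \<in> ?B" for q
  proof -
    have qD: "q \<in> D" using that s by blast
    have "J q * sqrt (gram q) = dd w q (1, 0) * (dd z q (0, 1) * sqrt (gram q)) - dd w q (0, 1) * (dd z q (1, 0) * sqrt (gram q))"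
      by (simp add: J_def algebra_simps)
    also have "\<dots> = tnorm2 q * gram q"
      unfolding zu[OF that] zv[OF that] dw[OF qD] tnorm2_eq[OF qD]
      using gp[OF that] by (simp add: power2_eq_square) (simp add: algebra_simps)
    finally show ?thesis .
  qed
  have J0: "J q > 0" if "q \<in> ?B" for q
    using J[OF that] gp[OF that] T[of q] s(2) that
    by (metis mult_pos_pos real_sqrt_gt_zero subsetD zero_less_mult_pos2)
  \<comment> \<open>Columns of the inverse Jacobian by Cramer's rule.\<close>
  define e1 where "e1 q = (dd z q (0, 1) / J q, - (dd z q (1, 0) / J q))" for q
  define e2 where "e2 q = (- (dd w q (0, 1) / J q), dd w q (1, 0) / J q)" for q
  have sJ: "smooth_on ?B J" unfolding J_def by (intro smooth_intros open_ball smooth_on_dd sw sz)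
  have Jnz: "J q \<noteq> 0" if "q \<in> ?B" for q using J0[OF that] by simp
  have se1: "smooth_on ?B e1" and se2: "smooth_on ?B e2"
    unfolding e1_def e2_def by (intro smooth_intros open_ball smooth_on_dd sw sz sJ Jnz; assumption)+
  have wz: "dd w q x = fst x * dd w q (1, 0) + snd x * dd w q (0, 1)"
    "dd z q x = fst x * dd z q (1, 0) + snd x * dd z q (0, 1)" if "q \<in> ?B" for q x
    using dd_plane[OF smooth_on_imp_differentiable[OF sw that], of x]
      dd_plane[OF smooth_on_imp_differentiable[OF sz that], of x] by simp_all
  have e1: "dd \<Phi> q (e1 q) = (1, 0)" and e2: "dd \<Phi> q (e2 q) = (0, 1)" if q: "q \<in> ?B" for q
  proof -
    have "dd w q (1, 0) * dd z q (0, 1) / J q - dd w q (0, 1) * dd z q (1, 0) / J q = J q / J q"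
      by (simp only: J_def diff_divide_distrib)
    then have j: "dd w q (1, 0) * dd z q (0, 1) / J q - dd w q (0, 1) * dd z q (1, 0) / J q = 1"
      using Jnz[OF q] by simp
    show "dd \<Phi> q (e1 q) = (1, 0)"
      unfolding d\<Phi>[OF q] wz(1)[OF q, of "e1 q"] wz(2)[OF q, of "e1 q"] using j by (simp add: e1_def algebra_simps)
    show "dd \<Phi> q (e2 q) = (0, 1)"
      unfolding d\<Phi>[OF q] wz(1)[OF q, of "e2 q"] wz(2)[OF q, of "e2 q"] using j by (simp add: e2_def algebra_simps)
  qed
  obtain U r G where U: "open U" "p0 \<in> U" "U \<subseteq> ?B" "r > 0" and hom: "homeomorphism U (ball (\<Phi> p0) r) \<Phi> G"
    and sG: "smooth_on (ball (\<Phi> p0) r) G"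
    and dG: "\<And>q w. q \<in> ball (\<Phi> p0) r \<Longrightarrow> dd G q w = fst w *\<^sub>R e1 (G q) + snd w *\<^sub>R e2 (G q)"
    using smooth_inverse_plane[OF open_ball s\<Phi> _ se1 se2 e1 e2] s(1) by (metis centre_in_ball)
  let ?V = "ball (\<Phi> p0) r"
  have GU: "G q \<in> U" and \<Phi>G: "\<Phi> (G q) = q" if "q \<in> ?V" for q
    using hom that by (auto simp: homeomorphism_def)
  have GB: "G q \<in> ?B" and GD: "G q \<in> D" if "q \<in> ?V" for q using GU[OF that] U(3) s(2) by blast+
  have dfG: "dd (\<lambda>q. f (G q)) q x = dd f (G q) (dd G q x)" if "q \<in> ?V" for q x
    by (rule dd_compose[OF smooth_on_imp_differentiable[OF sG that] diff_f[OF GD[OF that]]])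
  have fffG: "fff c (\<lambda>q. f (G q)) q x y = fff c f (G q) (dd G q x) (dd G q y)" if "q \<in> ?V" for q x y
    by (simp add: fff_def dfG[OF that])
  \<comment> \<open>Conformality of the chart, by inserting the conjugate equations. The factor
    \<open>1 / |T|^2\<close> is the inverse of the squared length of the height
    differential.\<close>
  have met: "fff c f q (e1 q) (e1 q) = 1 / tnorm2 q" "fff c f q (e1 q) (e2 q) = 0" "fff c f q (e2 q) (e2 q) = 1 / tnorm2 q"
    if q: "q \<in> ?B" for q
  proof -
    have qD: "q \<in> D" using q s by blast
    define E where "E = fff c f q (1, 0) (1, 0)"
    define F where "F = fff c f q (1, 0) (0, 1)"
    define H where "H = fff c f q (0, 1) (0, 1)"
    define m where "m = sqrt (gram q)"
    define u where "u = dd w q (1, 0)"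
    define v where "v = dd w q (0, 1)"
    define n where "n = tnorm2 q"
    have m: "m > 0" "m * m = E * H - F * F"
      using gp[OF q] by (simp_all add: m_def gram_def power2_eq_square E_def F_def H_def)
    have n: "n > 0" using T[OF qD] by (simp add: n_def)
    have nm: "n * (m * m) = H * u * u - 2 * F * u * v + E * v * v"
      using tnorm2_eq[OF qD] gp[OF q]
      by (simp add: m_def n_def E_def F_def H_def u_def v_def dw[OF qD] power2_eq_square)
    have Jm: "J q = n * m"
    proof -
      have "J q * m = n * m * m" using J[OF q] gp[OF q] by (simp add: m_def n_def)
      then show ?thesis using m(1) by simp
    qed
    have z1: "dd z q (1, 0) = (F * u - E * v) / m" and z2: "dd z q (0, 1) = (H * u - F * v) / m"
      using zu[OF q] zv[OF q] m(1)
      by (simp_all add: m_def[symmetric] E_def[symmetric] F_def[symmetric] H_def[symmetric] u_def v_def dw[OF qD] eq_divide_eq)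
    have e: "e1 q = ((H * u - F * v) / (n * m * m), (E * v - F * u) / (n * m * m))"
        "e2 q = (- v / (n * m), u / (n * m))"
      unfolding e1_def e2_def z1 z2 Jm u_def[symmetric] v_def[symmetric]
      using m(1) n by (simp_all add: field_simps)
    have 1: "fff c f q (e1 q) (e1 q) * (n * m * m) * (n * m * m) = (H * u - F * v) * (H * u - F * v) * E
         + 2 * (H * u - F * v) * (E * v - F * u) * F + (E * v - F * u) * (E * v - F * u) * H"
      unfolding fff_expand[OF qD, of "e1 q" "e1 q"] unfolding E_def[symmetric] F_def[symmetric] H_def[symmetric] e
      using n m(1) by (simp add: field_simps)
    also have "\<dots> = (E * H - F * F) * (H * u * u - 2 * F * u * v + E * v * v)" by (simp add: algebra_simps)
    also have "\<dots> = n * m * m * m * m" by (simp add: nm[symmetric] m(2)[symmetric])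
    finally show "fff c f q (e1 q) (e1 q) = 1 / tnorm2 q"
      using n m(1) by (simp add: n_def[symmetric] field_simps)
    have "fff c f q (e1 q) (e2 q) * (n * m * m) * (n * m) = (H * u - F * v) * (- v) * E
         + ((H * u - F * v) * u + (E * v - F * u) * (- v)) * F + (E * v - F * u) * u * H"
      unfolding fff_expand[OF qD, of "e1 q" "e2 q"] unfolding E_def[symmetric] F_def[symmetric] H_def[symmetric] e
      using n m(1) by (simp add: field_simps)
    also have "\<dots> = 0" by (simp add: algebra_simps)
    finally show "fff c f q (e1 q) (e2 q) = 0" using n m(1) by simp
    have "fff c f q (e2 q) (e2 q) * (n * m) * (n * m) = H * u * u - 2 * F * u * v + E * v * v"
      unfolding fff_expand[OF qD, of "e2 q" "e2 q"] unfolding E_def[symmetric] F_def[symmetric] H_def[symmetric] e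
      using n m(1) by (simp add: field_simps)
    also have "\<dots> = n * (m * m)" by (rule nm[symmetric])
    finally show "fff c f q (e2 q) (e2 q) = 1 / tnorm2 q"
      using n m(1) by (simp add: n_def[symmetric] field_simps)
  qed
  show ?thesis
  proof (rule that[OF U(1,2) _ U(4) hom smooth_on_subset[OF s\<Phi> U(3)] sG])
    show "U \<subseteq> D" using U s by blast
  next
    fix q assume q: "q \<in> ?V"
    show "snd (f (G q)) = fst q" using \<Phi>G[OF q] by (metis \<Phi>_def fst_conv w_def)
    show "fff c (\<lambda>q. f (G q)) q (1, 0) (1, 0) = 1 / tnorm2 (G q)"
      "fff c (\<lambda>q. f (G q)) q (1, 0) (0, 1) = 0"
      "fff c (\<lambda>q. f (G q)) q (0, 1) (0, 1) = 1 / tnorm2 (G q)"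
      using met[OF GB[OF q]] by (simp_all add: fffG[OF q] dG[OF q])
  next
    fix q and \<phi> :: "plane \<Rightarrow> ambient" assume q: "q \<in> ?V" and \<phi>: "smooth_on D \<phi>"
    have s\<phi>G: "smooth_on ?V (\<lambda>q. \<phi> (G q))"
      by (rule smooth_on_compose[OF open_ball openD _ sG \<phi>]) (use GD in blast)
    \<comment> \<open>The scalar formula is applied to the pairing with an arbitrary vector
      \<open>v\<close>.\<close>
    have "laplace c f \<phi> (G q) \<bullet> v = (tnorm2 (G q) *\<^sub>R
         (hess (\<lambda>q. \<phi> (G q)) q (1, 0) (1, 0) + hess (\<lambda>q. \<phi> (G q)) q (0, 1) (0, 1))) \<bullet> v" for v
    proof -
      have s1: "smooth_on D (\<lambda>q. \<phi> q \<bullet> v)" and s2: "smooth_on ?V (\<lambda>q. \<phi> (G q) \<bullet> v)"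
        by (rule smooth_on_bounded_linear[OF _ bounded_linear_inner_left], rule openD open_ball, rule \<phi> s\<phi>G)+
      have hh: "hess (\<lambda>q. \<phi> (G q) \<bullet> v) q x x = hess (\<lambda>q. \<phi> (G q)) q x x \<bullet> v" for x
      proof -
        have "hess (\<lambda>q. \<phi> (G q) \<bullet> v) q x x = dd (\<lambda>q. dd (\<lambda>q. \<phi> (G q)) q x \<bullet> v) q x"
          by (rule dd_cong_open[OF open_ball q])
            (rule dd_bounded_linear[OF bounded_linear_inner_left smooth_on_imp_differentiable[OF s\<phi>G]])
        also have "\<dots> = hess (\<lambda>q. \<phi> (G q)) q x x \<bullet> v"
          by (rule dd_bounded_linear[OF bounded_linear_inner_left
              smooth_on_imp_differentiable[OF smooth_on_dd[OF s\<phi>G] q]])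
        finally show ?thesis .
      qed
      have "laplace c f \<phi> (G q) \<bullet> v = laplace c f (\<lambda>q. \<phi> q \<bullet> v) (G q)"
        by (rule laplace_bounded_linear[OF bounded_linear_inner_left \<phi> GD[OF q], symmetric])
      also have "\<dots> = tnorm2 (G q) *
        (hess (\<lambda>q. \<phi> (G q) \<bullet> v) (snd (f (G q)), z (G q)) (1, 0) (1, 0)
         + hess (\<lambda>q. \<phi> (G q) \<bullet> v) (snd (f (G q)), z (G q)) (0, 1) (0, 1))"
      proof (rule laplace_isothermal_real[OF U(1) _ open_ball smooth_on_subset[OF sz U(3)] _ _ s1 s2])
        show "G q \<in> U" by (rule GU[OF q])
        fix p assume p: "p \<in> U"
        then show "(snd (f p), z p) \<in> ?V" "\<phi> p \<bullet> v = \<phi> (G (snd (f p), z p)) \<bullet> v"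
          using hom unfolding homeomorphism_def by (auto simp: \<Phi>_def w_def)
      qed (use U s zu zv in auto)
      also have "(snd (f (G q)), z (G q)) = q" using \<Phi>G[OF q] by (simp add: \<Phi>_def w_def)
      finally show ?thesis by (simp add: hh inner_add_left)
    qed
    then show "laplace c f \<phi> (G q) = tnorm2 (G q) *\<^sub>R
         (hess (\<lambda>q. \<phi> (G q)) q (1, 0) (1, 0) + hess (\<lambda>q. \<phi> (G q)) q (0, 1) (0, 1))"
      using vector_eq_rdot by blast
  qed
qed

end

section \<open>Biharmonic surfaces in isothermal coordinates\<close>

lemma inn_const_second_derivative:
  fixes A B :: "'a::real_normed_vector \<Rightarrow> ambient"
  assumes S: "open S" "p \<in> S" and A: "smooth_on S A" and B: "smooth_on S B"
    and k: "\<And>q. q \<in> S \<Longrightarrow> inn c (A q) (B q) = k"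
  shows "inn c (hess A p x x) (B p) + 2 * inn c (dd A p x) (dd B p x) + inn c (A p) (hess B p x x) = 0"
proof -
  have z: "inn c (dd A q x) (B q) + inn c (A q) (dd B q x) = 0" if "q \<in> S" for q
    using inn_const_derivative[OF S(1) that A B k, of x] by simp
  have "((\<lambda>q. inn c (dd A q x) (B q) + inn c (A q) (dd B q x)) has_derivative
     (\<lambda>y. inn c (dd A p x) (dd B p y) + inn c (hess A p y x) (B p)
        + (inn c (A p) (hess B p y x) + inn c (dd A p y) (dd B p x)))) (at p)"
    by (intro has_derivative_add has_derivative_inn smooth_on_imp_has_derivative[OF _ S(2)] smooth_on_dd A B)
  from dd_eqI[OF this, of x] dd_eq_0[OF S z, where x = x] show ?thesis by simp
qed

text \<open>Here \<open>\<tau> = 2H\<close>, \<open>\<rho> = 1 / |T|\<^sup>2\<close>, and the first coordinate is the height.\<close>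

locale isothermal_surface =
  fixes c h :: real and V :: "plane set" and f \<tau> :: "plane \<Rightarrow> ambient" and \<rho> :: "plane \<Rightarrow> real"
  assumes c: "c \<noteq> 0" and h: "h > 0" and V: "open V" "convex V"
    and sf: "smooth_on V f" and s\<tau>: "smooth_on V \<tau>"
    and space: "q \<in> V \<Longrightarrow> fst (f q) \<in> space_form c"
    and g11: "q \<in> V \<Longrightarrow> inn c (dd f q (1, 0)) (dd f q (1, 0)) = \<rho> q"
    and g12: "q \<in> V \<Longrightarrow> inn c (dd f q (1, 0)) (dd f q (0, 1)) = 0"
    and g22: "q \<in> V \<Longrightarrow> inn c (dd f q (0, 1)) (dd f q (0, 1)) = \<rho> q"
    and s1: "q \<in> V \<Longrightarrow> snd (dd f q (1, 0)) = 1" and s2: "q \<in> V \<Longrightarrow> snd (dd f q (0, 1)) = 0"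
    and \<tau>f: "q \<in> V \<Longrightarrow> inn c (\<tau> q) (dd f q x) = 0" and \<tau>P: "q \<in> V \<Longrightarrow> inn c (\<tau> q) (hor (f q)) = 0"
    and \<tau>s: "q \<in> V \<Longrightarrow> snd (\<tau> q) = 0" and \<tau>\<tau>: "q \<in> V \<Longrightarrow> inn c (\<tau> q) (\<tau> q) = 4 * h\<^sup>2"
    and lap_f: "q \<in> V \<Longrightarrow> hess f q (1, 0) (1, 0) + hess f q (0, 1) (0, 1)
      = \<rho> q *\<^sub>R \<tau> q - (c * (2 * \<rho> q - 1)) *\<^sub>R hor (f q)"
    and lap_\<tau>: "q \<in> V \<Longrightarrow> \<exists>l. hess \<tau> q (1, 0) (1, 0) + hess \<tau> q (0, 1) (0, 1)
      = - (c * (2 * \<rho> q - 1)) *\<^sub>R \<tau> q + l *\<^sub>R hor (f q)"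
    and \<rho>1: "q \<in> V \<Longrightarrow> \<rho> q > 1"
begin

section \<open>The frame of the isothermal chart and its derivatives\<close>

text \<open>Normal part of \<open>xi\<close>: the first coordinate is the height and the metric is
  \<open>\<rho>\<close> times the flat one, so \<open>T\<close> is \<open>1 / \<rho>\<close> times
  the first coordinate field.\<close>

definition nor :: "plane \<Rightarrow> ambient" where
  "nor q = xi - (1 / \<rho> q) *\<^sub>R dd f q (1, 0)"

text \<open>Second fundamental form in direction \<open>\<tau>\<close>. Projecting the second
  derivative would not change the pairing, as \<open>\<tau>\<close> is orthogonal to the surface and
  to the position vector.\<close>

definition b :: "plane \<Rightarrow> plane \<Rightarrow> plane \<Rightarrow> real" where
  "b q x y = inn c (hess f q x y) (\<tau> q)"

lemma smooth_df: "smooth_on V (\<lambda>q. dd f q x)" by (rule smooth_on_dd[OF sf])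

lemma smooth_hor_f: "smooth_on V (\<lambda>q. hor (f q))" by (rule smooth_on_hor[OF V(1) sf])

lemma smooth_\<rho>: "smooth_on V \<rho>"
proof -
  have "smooth_on V (\<lambda>q. inn c (dd f q (1, 0)) (dd f q (1, 0)))" by (intro smooth_on_inn V smooth_df)
  then show ?thesis using smooth_on_cong[OF V(1), of \<rho> "\<lambda>q. inn c (dd f q (1, 0)) (dd f q (1, 0))"] g11 by simp
qed

lemmas diff_f = smooth_on_imp_differentiable[OF sf]

lemma hess_commute: "q \<in> V \<Longrightarrow> hess f q x y = hess f q y x"
  by (rule second_derivative_symmetric[OF V(1) sf])

lemma inn_position: "q \<in> V \<Longrightarrow> inn c (f q) (hor (f q)) = 1 / c"
  by (rule inn_hor_self[OF c space])

lemma dd_hor_f: "q \<in> V \<Longrightarrow> dd (\<lambda>q. hor (f q)) q x = hor (dd f q x)"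
  by (rule dd_hor[OF diff_f])

lemma inn_df_position: assumes "q \<in> V" shows "inn c (dd f q x) (hor (f q)) = 0"
  using inn_const_derivative[OF V(1) assms sf smooth_hor_f inn_position, of x]
  by (simp add: dd_hor_f[OF assms] inn_hor_commute[of c "f q"])

lemma hess_hor: assumes "q \<in> V"
  shows "inn c (hess f q x y) (hor (f q)) = - inn c (dd f q y) (hor (dd f q x))"
  using inn_const_derivative[OF V(1) assms smooth_df smooth_hor_f inn_df_position, of y x] by (simp add: dd_hor_f[OF assms])

lemma hess_hor_basis:
  assumes q: "q \<in> V"
  shows "inn c (hess f q (1, 0) (1, 0)) (hor (f q)) = 1 - \<rho> q"
    "inn c (hess f q (1, 0) (0, 1)) (hor (f q)) = 0"
    "inn c (hess f q (0, 1) (0, 1)) (hor (f q)) = - \<rho> q"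
  using g12[OF q] unfolding hess_hor[OF q]
  by (simp_all add: inn_hor_right g11[OF q] g22[OF q] s1[OF q] s2[OF q]
      inn_commute[of c "dd f q (0, 1)" "dd f q (1, 0)"])

lemma nor_inn:
  assumes q: "q \<in> V"
  shows "inn c v (nor q) = snd v - inn c v (dd f q (1, 0)) / \<rho> q"
  by (simp add: nor_def inn_simps inn_xi)

lemma nor_orth:
  assumes q: "q \<in> V"
  shows "inn c (dd f q (1, 0)) (nor q) = 0" "inn c (dd f q (0, 1)) (nor q) = 0"
    "inn c (\<tau> q) (nor q) = 0" "inn c (nor q) (hor (f q)) = 0" "inn c (nor q) (nor q) = 1 - 1 / \<rho> q"
proof -
  show 1: "inn c (dd f q (1, 0)) (nor q) = 0"
    using \<rho>1[OF q] by (simp add: nor_inn[OF q] g11[OF q] s1[OF q])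
  show "inn c (dd f q (0, 1)) (nor q) = 0"
    using g12[OF q] by (simp add: nor_inn[OF q] s2[OF q] inn_commute[of c "dd f q (0, 1)"])
  show "inn c (\<tau> q) (nor q) = 0" by (simp add: nor_inn[OF q] \<tau>s[OF q] \<tau>f[OF q])
  show "inn c (nor q) (hor (f q)) = 0" by (simp add: nor_def inn_simps inn_xi inn_df_position[OF q])
  have "snd (nor q) = 1 - 1 / \<rho> q" by (simp add: nor_def xi_def s1[OF q])
  moreover have "inn c (nor q) (dd f q (1, 0)) = 0" using 1 by (simp only: inn_commute)
  ultimately show "inn c (nor q) (nor q) = 1 - 1 / \<rho> q" by (simp add: nor_inn[OF q, of "nor q"])
qed

lemma orthobasis: assumes q: "q \<in> V"
  shows "orthobasis c (dd f q (1, 0)) (dd f q (0, 1)) (\<tau> q) (nor q) (hor (f q))"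
proof -
  have "inn c (dd f q x) (\<tau> q) = 0" for x using \<tau>f[OF q, of x] by (simp only: inn_commute)
  moreover have "1 - 1 / \<rho> q \<noteq> 0" using \<rho>1[OF q] by simp
  ultimately show ?thesis
    unfolding orthobasis_def using \<rho>1[OF q] h c
    by (simp add: g11[OF q] g12[OF q] g22[OF q] nor_orth[OF q] \<tau>\<tau>[OF q] inn_df_position[OF q] \<tau>P[OF q] inn_position[OF q])
qed

lemma hess_metric:
  assumes q: "q \<in> V"
  shows "inn c (hess f q x (1, 0)) (dd f q (1, 0)) = dd \<rho> q x / 2"
    "inn c (hess f q x (1, 0)) (dd f q (0, 1)) = - inn c (hess f q x (0, 1)) (dd f q (1, 0))"
    "inn c (hess f q x (0, 1)) (dd f q (0, 1)) = dd \<rho> q x / 2"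
proof -
  note d = smooth_on_imp_differentiable[OF smooth_df q]
  have "dd \<rho> q x = dd (\<lambda>q. inn c (dd f q (1, 0)) (dd f q (1, 0))) q x"
    by (rule dd_cong_open[OF V(1) q]) (simp add: g11)
  then show "inn c (hess f q x (1, 0)) (dd f q (1, 0)) = dd \<rho> q x / 2"
    by (simp add: dd_inn[OF d d] inn_commute)
  have "dd \<rho> q x = dd (\<lambda>q. inn c (dd f q (0, 1)) (dd f q (0, 1))) q x"
    by (rule dd_cong_open[OF V(1) q]) (simp add: g22)
  then show "inn c (hess f q x (0, 1)) (dd f q (0, 1)) = dd \<rho> q x / 2"
    by (simp add: dd_inn[OF d d] inn_commute)
  show "inn c (hess f q x (1, 0)) (dd f q (0, 1)) = - inn c (hess f q x (0, 1)) (dd f q (1, 0))"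
    using inn_const_derivative[OF V(1) q smooth_df smooth_df g12, of x] by (simp add: inn_commute)
qed

lemma hess_metric_basis:
  assumes q: "q \<in> V"
  shows "inn c (hess f q (1, 0) (1, 0)) (dd f q (1, 0)) = dd \<rho> q (1, 0) / 2"
    "inn c (hess f q (1, 0) (1, 0)) (dd f q (0, 1)) = - dd \<rho> q (0, 1) / 2"
    "inn c (hess f q (1, 0) (0, 1)) (dd f q (1, 0)) = dd \<rho> q (0, 1) / 2"
    "inn c (hess f q (1, 0) (0, 1)) (dd f q (0, 1)) = dd \<rho> q (1, 0) / 2"
    "inn c (hess f q (0, 1) (0, 1)) (dd f q (1, 0)) = - dd \<rho> q (1, 0) / 2"
    "inn c (hess f q (0, 1) (0, 1)) (dd f q (0, 1)) = dd \<rho> q (0, 1) / 2"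
  using hess_metric[OF q, of "(1, 0)"] hess_metric[OF q, of "(0, 1)"]
  by (simp_all add: hess_commute[OF q, of "(0, 1)" "(1, 0)"])

lemma snd_hess: assumes q: "q \<in> V"
  shows "snd (hess f q x (1, 0)) = 0" "snd (hess f q x (0, 1)) = 0"
  using dd_bounded_linear[OF bounded_linear_snd smooth_on_imp_differentiable[OF smooth_df q, of "(1, 0)"], of x]
    dd_bounded_linear[OF bounded_linear_snd smooth_on_imp_differentiable[OF smooth_df q, of "(0, 1)"], of x]
    dd_eq_0[OF V(1) q s1, where x = x] dd_eq_0[OF V(1) q s2, where x = x] by simp_all

text \<open>The vertical part of the differential is constant in these coordinates, so second
  derivatives have no vertical component. Their pairing with \<open>nor\<close> then reduces to a
  tangential one, a derivative of the metric.\<close>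

lemma hess_nor:
  assumes q: "q \<in> V"
  shows "inn c (hess f q (1, 0) (1, 0)) (nor q) = - dd \<rho> q (1, 0) / (2 * \<rho> q)"
    "inn c (hess f q (1, 0) (0, 1)) (nor q) = - dd \<rho> q (0, 1) / (2 * \<rho> q)"
    "inn c (hess f q (0, 1) (0, 1)) (nor q) = dd \<rho> q (1, 0) / (2 * \<rho> q)"
  by (simp_all add: nor_inn[OF q] snd_hess[OF q] hess_metric_basis[OF q])

lemma b_commute: "q \<in> V \<Longrightarrow> b q x y = b q y x"
  by (simp only: b_def hess_commute)

lemma b_trace: assumes q: "q \<in> V"
  shows "b q (1, 0) (1, 0) + b q (0, 1) (0, 1) = 4 * h\<^sup>2 * \<rho> q"
proof -
  have "b q (1, 0) (1, 0) + b q (0, 1) (0, 1)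
    = inn c (hess f q (1, 0) (1, 0) + hess f q (0, 1) (0, 1)) (\<tau> q)" by (simp add: b_def inn_simps)
  also have "\<dots> = \<rho> q * (4 * h\<^sup>2)"
    unfolding lap_f[OF q] using \<tau>P[OF q] \<tau>\<tau>[OF q]
    by (simp add: inn_simps inn_hor_commute[of c "f q"] inn_commute[of c "f q"] inn_hor_right \<tau>s[OF q])
  finally show ?thesis by simp
qed

text \<open>\<open>\<tau>\<close> is normal, horizontal and of constant length, so \<open>b\<close>
  determines its derivative. The pairing with \<open>nor\<close> becomes a tangential one because
  the vertical component of the derivative vanishes.\<close>

lemma d\<tau>:
  assumes q: "q \<in> V"
  shows "inn c (dd \<tau> q x) (dd f q y) = - b q x y"
    "inn c (dd \<tau> q x) (\<tau> q) = 0" "inn c (dd \<tau> q x) (hor (f q)) = 0" "snd (dd \<tau> q x) = 0"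
    "inn c (dd \<tau> q x) (nor q) = b q x (1, 0) / \<rho> q"
proof -
  show 1: "inn c (dd \<tau> q x) (dd f q y) = - b q x y" for y
    using inn_const_derivative[OF V(1) q s\<tau> smooth_df \<tau>f, of x y] by (simp add: b_def inn_commute)
  show "inn c (dd \<tau> q x) (\<tau> q) = 0"
    using inn_const_derivative[OF V(1) q s\<tau> s\<tau> \<tau>\<tau>, of x] by (simp add: inn_commute[of c "\<tau> q"])
  have "inn c (\<tau> q) (hor (dd f q x)) = 0" by (simp add: inn_hor_right \<tau>s[OF q] \<tau>f[OF q])
  then show "inn c (dd \<tau> q x) (hor (f q)) = 0"
    using inn_const_derivative[OF V(1) q s\<tau> smooth_hor_f \<tau>P, of x] by (simp add: dd_hor_f[OF q])
  show s: "snd (dd \<tau> q x) = 0"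
    using dd_bounded_linear[OF bounded_linear_snd smooth_on_imp_differentiable[OF s\<tau> q], of x]
      dd_eq_0[OF V(1) q \<tau>s, where x = x] by simp
  show "inn c (dd \<tau> q x) (nor q) = b q x (1, 0) / \<rho> q"
    by (simp add: nor_inn[OF q] s 1)
qed

text \<open>Parseval in the frame. The factor \<open>1 / (\<rho> q - 1)\<close> arises from
  \<open>1 / \<rho> q\<close> divided by the square \<open>1 - 1 / \<rho> q\<close> of
  \<open>nor\<close>.\<close>

lemma inn_d\<tau>:
  assumes q: "q \<in> V"
  shows "inn c (dd \<tau> q x) v = - b q x (1, 0) * inn c v (dd f q (1, 0)) / \<rho> q
    - b q x (0, 1) * inn c v (dd f q (0, 1)) / \<rho> q + b q x (1, 0) / (\<rho> q - 1) * inn c v (nor q)"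
proof -
  have "b q x (1, 0) / \<rho> q * inn c v (nor q) / (1 - 1 / \<rho> q) = b q x (1, 0) / (\<rho> q - 1) * inn c v (nor q)"
    using \<rho>1[OF q] by (simp add: field_simps)
  then show ?thesis
    by (subst orthobasis_parseval[OF c orthobasis[OF q]])
      (simp add: d\<tau>[OF q] g11[OF q] g22[OF q] nor_orth[OF q])
qed

text \<open>The Laplacian of the vanishing function \<open>\<langle>\<tau>, \<partial>\<^sub>zf\<rangle>\<close>; third derivatives of \<open>f\<close> enter only through
  the derivative of its Laplacian.\<close>

lemma trace_d\<tau>_hess:
  assumes q: "q \<in> V" and z: "z = (1, 0) \<or> z = (0, 1)"
  shows "inn c (dd \<tau> q (1, 0)) (hess f q (1, 0) z) + inn c (dd \<tau> q (0, 1)) (hess f q (0, 1) z)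
    = - 2 * h\<^sup>2 * dd \<rho> q z"
proof -
  have third: "hess (\<lambda>p. dd f p z) q i i = dd (\<lambda>p. hess f p i i) q z" for i
  proof -
    have "hess (\<lambda>p. dd f p z) q i i = dd (\<lambda>p. dd (\<lambda>p. dd f p i) p z) q i"
      by (rule dd_cong_open[OF V(1) q]) (rule hess_commute)
    also have "\<dots> = dd (\<lambda>p. hess f p i i) q z"
      by (rule second_derivative_symmetric[OF V(1) smooth_df q])
    finally show ?thesis .
  qed
  have "hess (\<lambda>p. dd f p z) q (1, 0) (1, 0) + hess (\<lambda>p. dd f p z) q (0, 1) (0, 1)
      = dd (\<lambda>p. hess f p (1, 0) (1, 0) + hess f p (0, 1) (0, 1)) q z"
    unfolding third
    by (rule dd_eqI[symmetric])
      (intro has_derivative_add smooth_on_imp_has_derivative[OF _ q] smooth_on_dd sf)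
  also have "\<dots> = dd (\<lambda>p. \<rho> p *\<^sub>R \<tau> p - (c * (2 * \<rho> p - 1)) *\<^sub>R hor (f p)) q z"
    by (rule dd_cong_open[OF V(1) q]) (rule lap_f)
  also have "\<dots> = \<rho> q *\<^sub>R dd \<tau> q z + dd \<rho> q z *\<^sub>R \<tau> q
      - ((c * (2 * \<rho> q - 1)) *\<^sub>R hor (dd f q z) + (c * (2 * dd \<rho> q z - 0)) *\<^sub>R hor (f q))"
    by (rule dd_eqI) (intro has_derivative_diff has_derivative_scaleR has_derivative_hor
        has_derivative_mult_right has_derivative_const smooth_on_imp_has_derivative[OF _ q] sf s\<tau> smooth_\<rho>)
  \<comment> \<open>Pairing with \<open>\<tau>\<close> removes the position terms and the derivative
    of \<open>\<tau>\<close>, so third derivatives contribute only through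
    \<open>dd \<rho> q z\<close>.\<close>
  finally have third': "inn c (\<tau> q) (hess (\<lambda>p. dd f p z) q (1, 0) (1, 0))
     + inn c (\<tau> q) (hess (\<lambda>p. dd f p z) q (0, 1) (0, 1)) = 4 * h\<^sup>2 * dd \<rho> q z"
    unfolding bounded_bilinear.add_right[OF bounded_bilinear_inn, symmetric]
    using d\<tau>(2)[OF q, of z]
    by (simp add: inn_simps \<tau>\<tau>[OF q] \<tau>P[OF q] inn_hor_right[of c "\<tau> q" "dd f q z"] \<tau>s[OF q] \<tau>f[OF q]
        inn_commute[of c "\<tau> q" "dd \<tau> q z"])
  \<comment> \<open>The unknown coefficient \<open>l\<close> drops out because the position vector
    is orthogonal to the surface.\<close>
  obtain l where l: "hess \<tau> q (1, 0) (1, 0) + hess \<tau> q (0, 1) (0, 1)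
      = - (c * (2 * \<rho> q - 1)) *\<^sub>R \<tau> q + l *\<^sub>R hor (f q)" using lap_\<tau>[OF q] by blast
  have "inn c (hor (f q)) (dd f q z) = 0"
    using inn_df_position[OF q, of z] by (simp only: inn_commute)
  then have "inn c (hess \<tau> q (1, 0) (1, 0)) (dd f q z) + inn c (hess \<tau> q (0, 1) (0, 1)) (dd f q z) = 0"
    unfolding bounded_bilinear.add_left[OF bounded_bilinear_inn, symmetric] l
    by (simp add: inn_simps \<tau>f[OF q] del: inn_hor_left)
  moreover have "inn c (hess \<tau> q i i) (dd f q z) + 2 * inn c (dd \<tau> q i) (hess f q i z)
      + inn c (\<tau> q) (hess (\<lambda>p. dd f p z) q i i) = 0" for i
    by (rule inn_const_second_derivative[OF V(1) q s\<tau> smooth_df]) (rule \<tau>f)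
  from this[of "(1, 0)"] this[of "(0, 1)"]
  have "inn c (hess \<tau> q (1, 0) (1, 0)) (dd f q z) + 2 * inn c (dd \<tau> q (1, 0)) (hess f q (1, 0) z)
      + inn c (\<tau> q) (hess (\<lambda>p. dd f p z) q (1, 0) (1, 0)) = 0"
    "inn c (hess \<tau> q (0, 1) (0, 1)) (dd f q z) + 2 * inn c (dd \<tau> q (0, 1)) (hess f q (0, 1) z)
      + inn c (\<tau> q) (hess (\<lambda>p. dd f p z) q (0, 1) (0, 1)) = 0" .
  ultimately show ?thesis using third' by linarith
qed

section \<open>Tangent part, normal part and Gauss equation\<close>

text \<open>By the trace of \<open>b\<close>, the tangential terms of
  \<open>trace_d\<tau>_hess\<close> already add up to its right-hand side, so the contribution of
  \<open>nor\<close> must vanish. Together the two equations say (b11 - i b12)(\<rho>_u + i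
  \<rho>_v) = 0.\<close>

lemma b_grad:
  assumes q: "q \<in> V"
  shows "b q (1, 0) (1, 0) * dd \<rho> q (1, 0) + b q (1, 0) (0, 1) * dd \<rho> q (0, 1) = 0"
    "b q (1, 0) (1, 0) * dd \<rho> q (0, 1) - b q (1, 0) (0, 1) * dd \<rho> q (1, 0) = 0"
proof -
  have r: "\<rho> q > 1" by (rule \<rho>1[OF q])
  have h21: "hess f q (0, 1) (1, 0) = hess f q (1, 0) (0, 1)" and b21: "b q (0, 1) (1, 0) = b q (1, 0) (0, 1)"
    by (rule hess_commute[OF q], rule b_commute[OF q])
  have b22: "b q (0, 1) (0, 1) = 4 * h\<^sup>2 * \<rho> q - b q (1, 0) (1, 0)" using b_trace[OF q] by simp
  have c1: "\<alpha> * x + \<beta> * y = 0" if "r > 1"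
    "- \<alpha> * (x / 2) / r - \<beta> * (- y / 2) / r + \<alpha> / (r - 1) * (- x / (2 * r))
     + (- \<beta> * (y / 2) / r - (k * r - \<alpha>) * (x / 2) / r + \<beta> / (r - 1) * (- y / (2 * r))) = - (k * x) / 2"
    for \<alpha> \<beta> x y r k :: real
  proof -
    have "- (\<alpha> * x + \<beta> * y) / (2 * r * (r - 1)) = 0"
      using that by (simp add: divide_simps) (simp add: algebra_simps)
    then show ?thesis using that(1) by simp
  qed
  have c2: "\<alpha> * y - \<beta> * x = 0" if "r > 1"
    "- \<alpha> * (y / 2) / r - \<beta> * (x / 2) / r + \<alpha> / (r - 1) * (- y / (2 * r))
     + (- \<beta> * (- x / 2) / r - (k * r - \<alpha>) * (y / 2) / r + \<beta> / (r - 1) * (x / (2 * r))) = - (k * y) / 2"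
    for \<alpha> \<beta> x y r k :: real
  proof -
    have "- (\<alpha> * y - \<beta> * x) / (2 * r * (r - 1)) = 0"
      using that by (simp add: divide_simps) (simp add: algebra_simps)
    then show ?thesis using that(1) by simp
  qed
  show "b q (1, 0) (1, 0) * dd \<rho> q (1, 0) + b q (1, 0) (0, 1) * dd \<rho> q (0, 1) = 0"
    using trace_d\<tau>_hess[OF q, of "(1, 0)"]
    unfolding inn_d\<tau>[OF q] h21 b21 b22 hess_metric_basis[OF q] hess_nor[OF q]
    by (intro c1[OF r, of _ _ _ _ "4 * h\<^sup>2"]) simp
  show "b q (1, 0) (1, 0) * dd \<rho> q (0, 1) - b q (1, 0) (0, 1) * dd \<rho> q (1, 0) = 0"
    using trace_d\<tau>_hess[OF q, of "(0, 1)"]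
    unfolding inn_d\<tau>[OF q] h21 b21 b22 hess_metric_basis[OF q] hess_nor[OF q]
    by (intro c2[OF r, of _ _ _ _ "4 * h\<^sup>2"]) simp
qed

text \<open>The square of \<open>\<tau>\<close> is constant, so the squared length of the derivative
  of \<open>\<tau>\<close> is minus the pairing of its Laplacian with \<open>\<tau>\<close>, which
  the biharmonic equation provides. The left-hand side is this length expanded in the frame.\<close>

lemma b_norm:
  assumes q: "q \<in> V"
  shows "((b q (1, 0) (1, 0))\<^sup>2 + 2 * (b q (1, 0) (0, 1))\<^sup>2 + (b q (0, 1) (0, 1))\<^sup>2) * (\<rho> q - 1)
    + ((b q (1, 0) (1, 0))\<^sup>2 + (b q (1, 0) (0, 1))\<^sup>2) = 4 * h\<^sup>2 * c * (2 * \<rho> q - 1) * \<rho> q * (\<rho> q - 1)"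
proof -
  have r: "\<rho> q > 1" by (rule \<rho>1[OF q])
  obtain l where l: "hess \<tau> q (1, 0) (1, 0) + hess \<tau> q (0, 1) (0, 1)
      = - (c * (2 * \<rho> q - 1)) *\<^sub>R \<tau> q + l *\<^sub>R hor (f q)" using lap_\<tau>[OF q] by blast
  have "inn c (hor (f q)) (\<tau> q) = 0" using \<tau>P[OF q] by (simp only: inn_commute)
  then have "inn c (hess \<tau> q (1, 0) (1, 0)) (\<tau> q) + inn c (hess \<tau> q (0, 1) (0, 1)) (\<tau> q)
      = - (c * (2 * \<rho> q - 1)) * (4 * h\<^sup>2)"
    unfolding bounded_bilinear.add_left[OF bounded_bilinear_inn, symmetric] l
    by (simp add: inn_simps \<tau>\<tau>[OF q] del: inn_hor_left)
  moreover have "2 * (inn c (hess \<tau> q x x) (\<tau> q) + inn c (dd \<tau> q x) (dd \<tau> q x)) = 0" for x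
    using inn_const_second_derivative[OF V(1) q s\<tau> s\<tau> \<tau>\<tau>, of x]
    by (simp add: inn_commute[of c "\<tau> q"])
  from this[of "(1, 0)"] this[of "(0, 1)"]
  have "inn c (hess \<tau> q (1, 0) (1, 0)) (\<tau> q) + inn c (dd \<tau> q (1, 0)) (dd \<tau> q (1, 0)) = 0"
    "inn c (hess \<tau> q (0, 1) (0, 1)) (\<tau> q) + inn c (dd \<tau> q (0, 1)) (dd \<tau> q (0, 1)) = 0" by auto
  ultimately have sum: "inn c (dd \<tau> q (1, 0)) (dd \<tau> q (1, 0)) + inn c (dd \<tau> q (0, 1)) (dd \<tau> q (0, 1))
     = 4 * h\<^sup>2 * c * (2 * \<rho> q - 1)" by (simp add: algebra_simps)
  have "inn c (dd \<tau> q x) (dd \<tau> q x) * (\<rho> q * (\<rho> q - 1))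
     = ((b q x (1, 0))\<^sup>2 + (b q x (0, 1))\<^sup>2) * (\<rho> q - 1) + (b q x (1, 0))\<^sup>2" for x
  proof -
    have "(u * u / r + v * v / r + u / (r - 1) * (u / r)) * (r * (r - 1)) = (u\<^sup>2 + v\<^sup>2) * (r - 1) + u\<^sup>2"
      if "r > 1" for u v r :: real
      using that by (simp add: power2_eq_square divide_simps)
    from this[OF r, of "b q x (1, 0)" "b q x (0, 1)"] show ?thesis
      unfolding inn_d\<tau>[OF q, of x "dd \<tau> q x"] d\<tau>[OF q] by simp
  qed
  from this[of "(1, 0)"] this[of "(0, 1)"]
  have "(inn c (dd \<tau> q (1, 0)) (dd \<tau> q (1, 0)) + inn c (dd \<tau> q (0, 1)) (dd \<tau> q (0, 1))) * (\<rho> q * (\<rho> q - 1))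
   = ((b q (1, 0) (1, 0))\<^sup>2 + 2 * (b q (1, 0) (0, 1))\<^sup>2 + (b q (0, 1) (0, 1))\<^sup>2) * (\<rho> q - 1)
    + ((b q (1, 0) (1, 0))\<^sup>2 + (b q (1, 0) (0, 1))\<^sup>2)"
    unfolding b_commute[OF q, of "(0, 1)" "(1, 0)"] by (simp add: algebra_simps)
  then show ?thesis unfolding sum by (simp add: mult.assoc)
qed

text \<open>In \<open>b_norm\<close> the left-hand side is nonnegative and the right-hand side has
  the sign of \<open>c\<close>.\<close>

lemma c_pos: assumes q: "q \<in> V" shows "c > 0"
proof (rule ccontr)
  assume "\<not> c > 0"
  then have "c < 0" using c by simp
  have r: "\<rho> q > 1" by (rule \<rho>1[OF q])
  have "4 * h\<^sup>2 * c * (2 * \<rho> q - 1) * \<rho> q * (\<rho> q - 1) = c * (4 * h\<^sup>2 * (2 * \<rho> q - 1) * \<rho> q * (\<rho> q - 1))"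
    by simp
  also have "\<dots> < 0" using \<open>c < 0\<close> h r by (simp add: mult_neg_pos)
  finally have "4 * h\<^sup>2 * c * (2 * \<rho> q - 1) * \<rho> q * (\<rho> q - 1) < 0" .
  moreover have "((b q (1, 0) (1, 0))\<^sup>2 + 2 * (b q (1, 0) (0, 1))\<^sup>2 + (b q (0, 1) (0, 1))\<^sup>2) * (\<rho> q - 1)
    + ((b q (1, 0) (1, 0))\<^sup>2 + (b q (1, 0) (0, 1))\<^sup>2) \<ge> 0"
    using r by (intro add_nonneg_nonneg mult_nonneg_nonneg) auto
  ultimately show False using b_norm[OF q] by linarith
qed

lemma grad_\<rho>_basis:
  assumes q: "q \<in> V"
  shows "dd \<rho> q (1, 0) = 0 \<and> dd \<rho> q (0, 1) = 0"
proof (rule ccontr)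
  define g where "g p = (dd \<rho> p (1, 0))\<^sup>2 + (dd \<rho> p (0, 1))\<^sup>2" for p
  assume "\<not> ?thesis"
  then have gq: "g q \<noteq> 0" by (simp add: g_def sum_power2_eq_zero_iff)
  define W where "W = {p \<in> V. g p \<noteq> 0}"
  have "continuous_on V g"
    unfolding g_def by (intro smooth_on_imp_continuous_on smooth_intros V smooth_on_dd smooth_\<rho>)
  then have "open (V \<inter> g -` (- {0}))" using V(1) by (intro continuous_open_preimage) auto
  moreover have "V \<inter> g -` (- {0}) = W" by (auto simp: W_def)
  ultimately have W: "open W" by simp
  have qW: "q \<in> W" using q gq by (simp add: W_def)
  \<comment> \<open>With the first row of \<open>b\<close> equal to zero, the trace gives the last
    entry, and \<open>b_norm\<close> becomes
    \<open>4 * h\<^sup>2 * \<rho> p = c * (2 * \<rho> p - 1)\<close>.\<close>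
  have k: "\<rho> p = c / (2 * c - 4 * h\<^sup>2)" if "p \<in> W" for p
  proof -
    have p: "p \<in> V" "g p \<noteq> 0" using that by (auto simp: W_def)
    have r: "\<rho> p > 1" by (rule \<rho>1[OF p(1)])
    have "((b p (1, 0) (1, 0))\<^sup>2 + (b p (1, 0) (0, 1))\<^sup>2) * g p
      = (b p (1, 0) (1, 0) * dd \<rho> p (1, 0) + b p (1, 0) (0, 1) * dd \<rho> p (0, 1))\<^sup>2
        + (b p (1, 0) (1, 0) * dd \<rho> p (0, 1) - b p (1, 0) (0, 1) * dd \<rho> p (1, 0))\<^sup>2"
      by (simp add: g_def power2_eq_square algebra_simps)
    then have "(b p (1, 0) (1, 0))\<^sup>2 + (b p (1, 0) (0, 1))\<^sup>2 = 0" using p(2) by (simp add: b_grad[OF p(1)])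
    then have b0: "b p (1, 0) (1, 0) = 0" "b p (1, 0) (0, 1) = 0" by (simp_all add: sum_power2_eq_zero_iff)
    then have "b p (0, 1) (0, 1) = 4 * h\<^sup>2 * \<rho> p" using b_trace[OF p(1)] by simp
    then have "(4 * h\<^sup>2 * \<rho> p)\<^sup>2 * (\<rho> p - 1) = 4 * h\<^sup>2 * c * (2 * \<rho> p - 1) * \<rho> p * (\<rho> p - 1)"
      using b_norm[OF p(1)] by (simp add: b0)
    then have "4 * h\<^sup>2 * \<rho> p = c * (2 * \<rho> p - 1)" using r h by (simp add: power2_eq_square)
    then have e: "\<rho> p * (2 * c - 4 * h\<^sup>2) = c" by (simp add: algebra_simps)
    then have "2 * c - 4 * h\<^sup>2 \<noteq> 0" using c by auto
    then show ?thesis using e by (simp add: nonzero_eq_divide_eq)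
  qed
  have "dd \<rho> q x = 0" for x by (rule dd_eq_0[OF W qW k])
  then show False using gq by (simp add: g_def)
qed

lemma grad_\<rho>: "q \<in> V \<Longrightarrow> dd \<rho> q x = 0"
  using dd_plane[OF smooth_on_imp_differentiable[OF smooth_\<rho>], of q x] grad_\<rho>_basis by simp

text \<open>Gauss equation. With \<open>\<rho>\<close> constant the tangential and
  \<open>nor\<close> components of second derivatives vanish. Differentiating two of these vanishing
  pairings and equating third derivatives shows that the pairing of f_uu with f_vv is the square of
  f_uv; the components along the position vector supply the curvature term.\<close>

lemma b_det:
  assumes q: "q \<in> V"
  shows "b q (1, 0) (1, 0) * b q (0, 1) (0, 1) - (b q (1, 0) (0, 1))\<^sup>2 = - 4 * h\<^sup>2 * c * \<rho> q * (\<rho> q - 1)"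
proof -
  have z: "inn c (hess f p (1, 0) (1, 0)) (dd f p (0, 1)) = 0" "inn c (hess f p (1, 0) (0, 1)) (dd f p (0, 1)) = 0"
    if "p \<in> V" for p
    by (simp_all add: hess_metric_basis[OF that] grad_\<rho>[OF that])
  have sh: "smooth_on V (\<lambda>p. hess f p x y)" for x y by (intro smooth_on_dd sf)
  have "dd (\<lambda>p. hess f p (1, 0) (1, 0)) q (0, 1) = dd (\<lambda>p. dd (\<lambda>p. dd f p (1, 0)) p (0, 1)) q (1, 0)"
    by (rule second_derivative_symmetric[OF V(1) smooth_df q])
  also have "\<dots> = dd (\<lambda>p. hess f p (1, 0) (0, 1)) q (1, 0)"
    by (rule dd_cong_open[OF V(1) q]) (rule hess_commute)
  finally have third: "dd (\<lambda>p. hess f p (1, 0) (1, 0)) q (0, 1) = dd (\<lambda>p. hess f p (1, 0) (0, 1)) q (1, 0)" .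
  have "inn c (hess f q (1, 0) (1, 0)) (hess f q (0, 1) (0, 1)) = inn c (hess f q (1, 0) (0, 1)) (hess f q (1, 0) (0, 1))"
    using inn_const_derivative[OF V(1) q sh smooth_df z(1), of "(0, 1)"]
      inn_const_derivative[OF V(1) q sh smooth_df z(2), of "(1, 0)"] by (simp add: third)
  then have "b q (1, 0) (1, 0) * b q (0, 1) (0, 1) / (4 * h\<^sup>2) + (1 - \<rho> q) * (- \<rho> q) * c = (b q (1, 0) (0, 1))\<^sup>2 / (4 * h\<^sup>2)"
    unfolding orthobasis_parseval[OF c orthobasis[OF q], of "hess f q (1, 0) (1, 0)" "hess f q (0, 1) (0, 1)"]
      orthobasis_parseval[OF c orthobasis[OF q], of "hess f q (1, 0) (0, 1)" "hess f q (1, 0) (0, 1)"]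
      hess_metric_basis[OF q] hess_nor[OF q] hess_hor_basis[OF q] grad_\<rho>[OF q] b_def[symmetric]
    using inn_position[OF q] by (simp add: \<tau>\<tau>[OF q] power2_eq_square)
  then show ?thesis using h by (simp add: field_simps)
qed

text \<open>After eliminating \<open>y\<^sup>2\<close> by the determinant and \<open>z\<close> by
  the trace, the quadratic terms of the norm equation combine to \<open>x * (k * r)\<close>. The
  system is thus linear in \<open>x\<close> and leaves only the sign of \<open>y\<close>
  open.\<close>

lemma b_values:
  assumes q: "q \<in> V"
  shows "b q (1, 0) (1, 0) = - 4 * h\<^sup>2 * \<rho> q * (\<rho> q - 1)" "b q (0, 1) (0, 1) = 4 * h\<^sup>2 * (\<rho> q)\<^sup>2"
    "(b q (1, 0) (0, 1))\<^sup>2 = 4 * h\<^sup>2 * \<rho> q * (\<rho> q - 1) * (c - 4 * h\<^sup>2 * (\<rho> q)\<^sup>2)"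
proof -
  have alg: "x = - k * r * (r - 1) \<and> z = k * r\<^sup>2 \<and> y\<^sup>2 = k * r * (r - 1) * (c - k * r\<^sup>2)"
    if k: "k > 0" "r > 1" and tr: "x + z = k * r" and det: "x * z - y\<^sup>2 = - k * c * r * (r - 1)"
      and norm: "(x\<^sup>2 + 2 * y\<^sup>2 + z\<^sup>2) * (r - 1) + (x\<^sup>2 + y\<^sup>2) = k * c * (2 * r - 1) * r * (r - 1)"
    for x y z k r :: real
  proof -
    have y2: "y\<^sup>2 = x * z + k * c * r * (r - 1)" using det by simp
    have z: "z = k * r - x" using tr by simp
    have "(k * r) * x = (k * r) * (- k * r * (r - 1))"
      using norm unfolding y2 z by (simp add: power2_eq_square algebra_simps)
    moreover have "k * r \<noteq> 0" using k by simp
    ultimately have x: "x = - k * r * (r - 1)" by (rule mult_left_cancel[THEN iffD1, rotated])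
    then have z': "z = k * r\<^sup>2" using z by (simp add: power2_eq_square algebra_simps)
    have "y\<^sup>2 = (- k * r * (r - 1)) * (k * r\<^sup>2) + k * c * r * (r - 1)"
      unfolding y2 x[symmetric] z'[symmetric] ..
    also have "\<dots> = k * r * (r - 1) * (c - k * r\<^sup>2)" by (simp add: algebra_simps)
    finally show ?thesis using x z' by blast
  qed
  have "4 * h\<^sup>2 > 0" using h by simp
  moreover have "b q (1, 0) (1, 0) * b q (0, 1) (0, 1) - (b q (1, 0) (0, 1))\<^sup>2
      = - (4 * h\<^sup>2) * c * \<rho> q * (\<rho> q - 1)" using b_det[OF q] by simp
  ultimately have v: "b q (1, 0) (1, 0) = - (4 * h\<^sup>2) * \<rho> q * (\<rho> q - 1) \<and> b q (0, 1) (0, 1) = 4 * h\<^sup>2 * (\<rho> q)\<^sup>2 \<and>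
    (b q (1, 0) (0, 1))\<^sup>2 = 4 * h\<^sup>2 * \<rho> q * (\<rho> q - 1) * (c - 4 * h\<^sup>2 * (\<rho> q)\<^sup>2)"
    by (rule alg[OF _ \<rho>1[OF q] b_trace[OF q] _ b_norm[OF q]])
  from v show "b q (1, 0) (1, 0) = - 4 * h\<^sup>2 * \<rho> q * (\<rho> q - 1)" by simp
  from v show "b q (0, 1) (0, 1) = 4 * h\<^sup>2 * (\<rho> q)\<^sup>2" by blast
  from v show "(b q (1, 0) (0, 1))\<^sup>2 = 4 * h\<^sup>2 * \<rho> q * (\<rho> q - 1) * (c - 4 * h\<^sup>2 * (\<rho> q)\<^sup>2)" by blast
qed

lemma constant_if_dd_0:
  fixes g :: "plane \<Rightarrow> real"
  assumes "smooth_on V g" "\<And>p x. p \<in> V \<Longrightarrow> dd g p x = 0" "p \<in> V" "q \<in> V"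
  shows "g p = g q"
proof -
  have "(g has_derivative (\<lambda>h. 0)) (at p within V)" if "p \<in> V" for p
  proof -
    have "dd g p = (\<lambda>h. 0)" by (rule ext) (rule assms(2)[OF that])
    then show ?thesis
      using has_derivative_at_withinI[OF smooth_on_imp_has_derivative[OF assms(1) that], of V] by simp
  qed
  then obtain k where "\<forall>x\<in>V. g x = k" using has_derivative_zero_constant[OF V(2), of g] by blast
  then show ?thesis using assms(3,4) by simp
qed

lemma \<rho>_constant: "p \<in> V \<Longrightarrow> q \<in> V \<Longrightarrow> \<rho> p = \<rho> q"
  by (rule constant_if_dd_0[OF smooth_\<rho> grad_\<rho>])

text \<open>\<open>b_values\<close> determines only the square. Differentiating a constant square
  shows that a nonzero entry has zero derivative, so its sign cannot change and one rotation serves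
  the whole patch.\<close>

lemma b12_constant: assumes p: "p \<in> V" and q: "q \<in> V" shows "b p (1, 0) (0, 1) = b q (1, 0) (0, 1)"
proof -
  define g where "g p = b p (1, 0) (0, 1)" for p
  have sg: "smooth_on V g" unfolding g_def b_def by (intro smooth_on_inn V smooth_on_dd sf s\<tau>)
  have g2: "(g p')\<^sup>2 = (g q)\<^sup>2" if "p' \<in> V" for p'
    unfolding g_def b_values(3)[OF that] b_values(3)[OF q] \<rho>_constant[OF that q] ..
  have "dd g p' x = 0" if p': "p' \<in> V" for p' x
  proof (cases "g q = 0")
    case True
    then have "g p'' = 0" if "p'' \<in> V" for p'' using g2[OF that] by simp
    then show ?thesis by (rule dd_eq_0[OF V(1) p'])
  next
    case False
    have "dd (\<lambda>p. g p * g p) p' x = g p' * dd g p' x + dd g p' x * g p'"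
      by (rule dd_eqI) (intro has_derivative_mult smooth_on_imp_has_derivative[OF sg p'])
    moreover have "dd (\<lambda>p. g p * g p) p' x = 0"
      by (rule dd_eq_0[OF V(1) p', of _ "(g q)\<^sup>2"]) (use g2 in \<open>simp add: power2_eq_square\<close>)
    moreover have "g p' \<noteq> 0" using g2[OF p'] False by auto
    ultimately show ?thesis by simp
  qed
  then have "g p = g q" by (rule constant_if_dd_0[OF sg _ p q])
  then show ?thesis by (simp add: g_def)
qed

end

section \<open>Helices\<close>

text \<open>Flat coordinates whose coordinate fields are principal for \<open>\<tau>\<close>;
  \<open>\<kappa>1\<close> and \<open>\<kappa>2\<close> are the signed curvatures with respect to
  the unit normal \<open>\<tau> / (2 h)\<close>.\<close>

locale flat_chart =
  fixes c h a b \<kappa>1 \<kappa>2 :: real and D :: "plane set" and F \<tau> :: "plane \<Rightarrow> ambient"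
  assumes c: "c \<noteq> 0" and h: "h > 0" and D: "open D" and sF: "smooth_on D F" and s\<tau>: "smooth_on D \<tau>"
    and space: "p \<in> D \<Longrightarrow> fst (F p) \<in> space_form c"
    and iso: "p \<in> D \<Longrightarrow> inn c (dd F p x) (dd F p y) = x \<bullet> y"
    and su: "p \<in> D \<Longrightarrow> snd (dd F p (1, 0)) = a" and sv: "p \<in> D \<Longrightarrow> snd (dd F p (0, 1)) = b"
    and ab: "a\<^sup>2 + b\<^sup>2 < 1"
    and \<tau>F: "p \<in> D \<Longrightarrow> inn c (\<tau> p) (dd F p x) = 0" and \<tau>P: "p \<in> D \<Longrightarrow> inn c (\<tau> p) (hor (F p)) = 0"
    and \<tau>s: "p \<in> D \<Longrightarrow> snd (\<tau> p) = 0" and \<tau>\<tau>: "p \<in> D \<Longrightarrow> inn c (\<tau> p) (\<tau> p) = 4 * h\<^sup>2"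
    and Buu: "p \<in> D \<Longrightarrow> inn c (hess F p (1, 0) (1, 0)) (\<tau> p) = 2 * h * \<kappa>1"
    and Buv: "p \<in> D \<Longrightarrow> inn c (hess F p (1, 0) (0, 1)) (\<tau> p) = 0"
    and Bvv: "p \<in> D \<Longrightarrow> inn c (hess F p (0, 1) (0, 1)) (\<tau> p) = 2 * h * \<kappa>2"
begin

text \<open>Squared length of the normal part of \<open>xi\<close>.\<close>

definition N :: real where "N = 1 - a\<^sup>2 - b\<^sup>2"

definition nor :: "plane \<Rightarrow> ambient" where
  "nor p = xi - a *\<^sub>R dd F p (1, 0) - b *\<^sub>R dd F p (0, 1)"

lemma N_pos: "N > 0"
  using ab by (simp add: N_def)

lemma smooth_dF: "smooth_on D (\<lambda>q. dd F q x)" by (rule smooth_on_dd[OF sF])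

lemma smooth_hor_F: "smooth_on D (\<lambda>q. hor (F q))" by (rule smooth_on_hor[OF D sF])

lemma smooth_nor: "smooth_on D nor"
  unfolding nor_def by (intro smooth_intros D smooth_dF)

lemmas diff_F = smooth_on_imp_differentiable[OF sF]

lemma hess_commute: "q \<in> D \<Longrightarrow> hess F q x y = hess F q y x"
  by (rule second_derivative_symmetric[OF D sF])

lemma inn_position: "q \<in> D \<Longrightarrow> inn c (F q) (hor (F q)) = 1 / c"
  by (rule inn_hor_self[OF c space])

lemma dd_hor_F: "q \<in> D \<Longrightarrow> dd (\<lambda>q. hor (F q)) q x = hor (dd F q x)"
  by (rule dd_hor[OF diff_F])

lemma inn_dF_position: assumes "q \<in> D" shows "inn c (dd F q x) (hor (F q)) = 0"
  using inn_const_derivative[OF D assms sF smooth_hor_F inn_position, of x]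
  by (simp add: dd_hor_F[OF assms] inn_hor_commute[of c "F q"])

text \<open>The pairing is symmetric in \<open>x\<close>, \<open>y\<close> and, the metric being
  constant, skew in \<open>y\<close>, \<open>z\<close>. Both symmetries together force it to vanish,
  as for the Christoffel symbols of a constant metric.\<close>

lemma hess_tangential: assumes q: "q \<in> D" shows "inn c (hess F q x y) (dd F q z) = 0"
proof -
  have skew: "inn c (hess F q x y) (dd F q z) = - inn c (hess F q x z) (dd F q y)" for x y z
  proof -
    have "inn c (hess F q x y) (dd F q z) = - inn c (dd F q y) (hess F q x z)"
      by (rule inn_const_derivative[OF D q smooth_dF smooth_dF]) (rule iso)
    then show ?thesis by (simp only: inn_commute)
  qed
  have "inn c (hess F q x y) (dd F q z) = - inn c (hess F q z x) (dd F q y)"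
    by (simp only: skew[where x = x and y = y and z = z] hess_commute[OF q, where x = x and y = z])
  also have "\<dots> = inn c (hess F q y z) (dd F q x)"
    by (simp only: skew[where x = z and y = x and z = y] hess_commute[OF q, where x = z and y = y] minus_minus)
  also have "\<dots> = - inn c (hess F q x y) (dd F q z)"
    by (simp only: skew[where x = y and y = z and z = x] hess_commute[OF q, where x = y and y = x])
  finally show ?thesis by simp
qed

lemma snd_hess: assumes q: "q \<in> D" shows "snd (hess F q x y) = 0"
proof -
  have "snd (dd F p y) = fst y * a + snd y * b" if "p \<in> D" for p
    unfolding dd_plane[OF diff_F[OF that], of y] by (simp add: su sv that)
  then have "dd (\<lambda>p. snd (dd F p y)) q x = 0" by (rule dd_eq_0[OF D q])
  then show ?thesis
    using dd_bounded_linear[OF bounded_linear_snd smooth_on_imp_differentiable[OF smooth_dF q], of y x] by simp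
qed

lemma inn_nor: "inn c v (nor p) = snd v - a * inn c v (dd F p (1, 0)) - b * inn c v (dd F p (0, 1))"
  by (simp add: nor_def inn_simps inn_xi)

lemma nor_orth:
  assumes q: "q \<in> D"
  shows "inn c (dd F q (1, 0)) (nor q) = 0" "inn c (dd F q (0, 1)) (nor q) = 0"
    "inn c (\<tau> q) (nor q) = 0" "inn c (nor q) (hor (F q)) = 0" "inn c (nor q) (nor q) = N"
proof -
  show 1: "inn c (dd F q (1, 0)) (nor q) = 0" and 2: "inn c (dd F q (0, 1)) (nor q) = 0"
    by (simp_all add: inn_nor iso[OF q] su[OF q] sv[OF q])
  show "inn c (\<tau> q) (nor q) = 0" by (simp add: inn_nor \<tau>s[OF q] \<tau>F[OF q])
  show "inn c (nor q) (hor (F q)) = 0" by (simp add: nor_def inn_simps inn_xi inn_dF_position[OF q])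
  have "inn c (nor q) (dd F q (1, 0)) = 0" "inn c (nor q) (dd F q (0, 1)) = 0"
    using 1 2 by (simp_all only: inn_commute)
  moreover have "snd (nor q) = N"
    by (simp add: nor_def xi_def su[OF q] sv[OF q] N_def power2_eq_square)
  ultimately show "inn c (nor q) (nor q) = N" by (simp add: inn_nor[of "nor q"])
qed

lemma orthobasis: assumes q: "q \<in> D"
  shows "orthobasis c (dd F q (1, 0)) (dd F q (0, 1)) (\<tau> q) (nor q) (hor (F q))"
proof -
  have "inn c (dd F q x) (\<tau> q) = 0" for x using \<tau>F[OF q, of x] by (simp only: inn_commute)
  then show ?thesis
    unfolding orthobasis_def using N_pos h c
    by (simp add: iso[OF q] nor_orth[OF q] \<tau>\<tau>[OF q] inn_dF_position[OF q] \<tau>P[OF q] inn_position[OF q])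
qed

lemma tangent_eqI:
  assumes q: "q \<in> D"
    and "inn c v (dd F q (1, 0)) = inn c w (dd F q (1, 0))" "inn c v (dd F q (0, 1)) = inn c w (dd F q (0, 1))"
      "inn c v (\<tau> q) = inn c w (\<tau> q)" "inn c v (nor q) = inn c w (nor q)" "inn c w (hor (F q)) = 0"
  shows "tproj c (F q) v = w"
proof (rule orthobasis_eqI[OF c orthobasis[OF q]])
  show "inn c (tproj c (F q) v) (hor (F q)) = inn c w (hor (F q))"
    using assms(6) by (simp add: inn_tproj_hor[OF c space[OF q]])
qed (use assms in \<open>simp_all add: inn_tproj_tangent inn_dF_position[OF q] \<tau>P[OF q] nor_orth[OF q]\<close>)

lemma frame_commuted:
  assumes q: "q \<in> D"
  shows "inn c (dd F q x) (\<tau> q) = 0" "inn c (nor q) (\<tau> q) = 0"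
    "inn c (nor q) (dd F q (1, 0)) = 0" "inn c (nor q) (dd F q (0, 1)) = 0"
  using \<tau>F[OF q, of x] nor_orth[OF q] by (simp_all only: inn_commute)

lemma cov_hess:
  assumes q: "q \<in> D"
  shows "tproj c (F q) (hess F q x y) = (inn c (hess F q x y) (\<tau> q) / (4 * h\<^sup>2)) *\<^sub>R \<tau> q"
  by (rule tangent_eqI[OF q])
    (use h in \<open>simp_all add: hess_tangential[OF q] inn_nor snd_hess[OF q] inn_simps \<tau>F[OF q] \<tau>\<tau>[OF q] \<tau>P[OF q] \<tau>s[OF q]\<close>)

lemma d\<tau>:
  assumes q: "q \<in> D"
  shows "inn c (dd \<tau> q x) (dd F q y) = - inn c (hess F q x y) (\<tau> q)"
    "inn c (dd \<tau> q x) (\<tau> q) = 0" "snd (dd \<tau> q x) = 0"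
proof -
  show "inn c (dd \<tau> q x) (dd F q y) = - inn c (hess F q x y) (\<tau> q)"
    using inn_const_derivative[OF D q s\<tau> smooth_dF \<tau>F, of x y] by (simp add: inn_commute)
  show "inn c (dd \<tau> q x) (\<tau> q) = 0"
    using inn_const_derivative[OF D q s\<tau> s\<tau> \<tau>\<tau>, of x] by (simp add: inn_commute[of c "\<tau> q"])
  show "snd (dd \<tau> q x) = 0"
    using dd_bounded_linear[OF bounded_linear_snd smooth_on_imp_differentiable[OF s\<tau> q], of x]
      dd_eq_0[OF D q \<tau>s, where x = x] by simp
qed

text \<open>A coordinate line is a geodesic of the flat surface, so its acceleration points along
  \<open>\<tau>\<close>. In a principal direction the derivative of \<open>\<tau>\<close> stays in
  the span of the tangent and \<open>nor\<close>, and its \<open>nor\<close> component is the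
  torsion. If \<open>t = 0\<close>, the second curvature is zero.\<close>

lemma frenet:
  assumes e: "(e = (1, 0) \<and> \<kappa> = \<kappa>1 \<and> t = a) \<or> (e = (0, 1) \<and> \<kappa> = \<kappa>2 \<and> t = b)"
    and t: "t \<ge> 0" and \<alpha>: "integral_curve D e I \<alpha>" and \<kappa>: "\<kappa> \<noteq> 0"
  shows "frenet_curve c I (F \<circ> \<alpha>) \<bar>\<kappa>\<bar> (\<bar>t\<bar> / sqrt N * \<bar>\<kappa>\<bar>)"
proof -
  have I: "open I" and \<alpha>D: "\<And>s. s \<in> I \<Longrightarrow> \<alpha> s \<in> D"
    and d\<alpha>: "\<And>s. s \<in> I \<Longrightarrow> (\<alpha> has_derivative (\<lambda>v. v *\<^sub>R e)) (at s)"
    using \<alpha> by (auto simp: integral_curve_def has_vector_derivative_def)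
  have s\<alpha>: "smooth_on I \<alpha>"
    by (rule smooth_onI[OF I d\<alpha>]) (auto intro: smooth_on_const)
  have s\<alpha>': "smooth_on I (\<lambda>s. W (\<alpha> s))" if "smooth_on D W" for W :: "plane \<Rightarrow> ambient"
    by (rule smooth_on_compose[OF I D _ s\<alpha> that]) (use \<alpha>D in blast)
  have vd: "vector_derivative (\<lambda>s. W (\<alpha> s)) (at s) = dd W (\<alpha> s) e"
    if W: "smooth_on D W" and s: "s \<in> I" for W :: "plane \<Rightarrow> ambient" and s
  proof -
    have "((\<lambda>s. W (\<alpha> s)) has_derivative (\<lambda>v. dd W (\<alpha> s) (v *\<^sub>R e))) (at s)"
      by (rule has_derivative_compose[OF d\<alpha>[OF s] smooth_on_imp_has_derivative[OF W \<alpha>D[OF s]]])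
    then have "((\<lambda>s. W (\<alpha> s)) has_vector_derivative dd W (\<alpha> s) e) (at s)"
      by (simp add: has_vector_derivative_def linear_scale[OF linear_dd[OF W \<alpha>D[OF s]]])
    then show ?thesis by (rule vector_derivative_at)
  qed
  \<comment> \<open>The sign of \<open>\<kappa>\<close> goes into the principal normal, which makes
    the first curvature positive; because \<open>t \<ge> 0\<close>, the normalised
    \<open>nor\<close> then serves as the third frame vector without a further sign.\<close>
  define \<sigma> where "\<sigma> = sgn \<kappa>"
  have \<sigma>: "\<sigma> * \<sigma> = 1" "\<sigma> * \<kappa> = \<bar>\<kappa>\<bar>" "\<bar>\<kappa>\<bar> * \<sigma> = \<kappa>" using \<kappa> by (auto simp: \<sigma>_def sgn_real_def)
  define X2 where "X2 p = (\<sigma> / (2 * h)) *\<^sub>R \<tau> p" for p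
  define X3 where "X3 p = (1 / sqrt N) *\<^sub>R nor p" for p
  have sX: "smooth_on D X2" "smooth_on D X3"
    unfolding X2_def X3_def by (intro smooth_intros D s\<tau> smooth_nor)+
  have sqN: "sqrt N > 0" "sqrt N * sqrt N = N" using N_pos by auto
  have frame: "inn c (dd F p e) (dd F p e) = 1" "inn c (X2 p) (X2 p) = 1" "inn c (X3 p) (X3 p) = 1"
    "inn c (dd F p e) (X2 p) = 0" "inn c (dd F p e) (X3 p) = 0" "inn c (X2 p) (X3 p) = 0"
    "inn c (X2 p) (hor (F p)) = 0" "inn c (X3 p) (hor (F p)) = 0"
    if p: "p \<in> D" for p
  proof -
    show "inn c (dd F p e) (dd F p e) = 1" using e by (auto simp: iso[OF p])
    have "inn c (X2 p) (X2 p) = (\<sigma> * \<sigma>) * (4 * h\<^sup>2) / ((2 * h) * (2 * h))"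
      by (simp add: X2_def inn_simps \<tau>\<tau>[OF p])
    then show "inn c (X2 p) (X2 p) = 1" using h by (simp add: \<sigma> power2_eq_square)
    have "inn c (X3 p) (X3 p) = N / (sqrt N * sqrt N)"
      by (simp add: X3_def inn_simps nor_orth[OF p])
    then show "inn c (X3 p) (X3 p) = 1" using N_pos by (simp add: sqN)
    show "inn c (dd F p e) (X2 p) = 0" by (simp add: X2_def inn_simps frame_commuted[OF p])
    show "inn c (dd F p e) (X3 p) = 0" using e by (auto simp: X3_def inn_simps nor_orth[OF p])
    show "inn c (X2 p) (X3 p) = 0" by (simp add: X2_def X3_def inn_simps nor_orth[OF p])
    show "inn c (X2 p) (hor (F p)) = 0" by (simp add: X2_def inn_simps \<tau>P[OF p])
    show "inn c (X3 p) (hor (F p)) = 0" by (simp add: X3_def inn_simps nor_orth[OF p])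
  qed
  have B: "inn c (hess F p e (1, 0)) (\<tau> p) = 2 * h * \<kappa> * fst e" "inn c (hess F p e (0, 1)) (\<tau> p) = 2 * h * \<kappa> * snd e"
    "inn c (hess F p e e) (\<tau> p) = 2 * h * \<kappa>" "a * fst e + b * snd e = t"
    if p: "p \<in> D" for p
    using e by (auto simp: Buu[OF p] Buv[OF p] Bvv[OF p] hess_commute[OF p, where x = "(0, 1)" and y = "(1, 0)"])
  have eD: "inn c (dd F p e) (dd F p (1, 0)) = fst e" "inn c (dd F p e) (dd F p (0, 1)) = snd e" if "p \<in> D" for p
    by (cases e; simp add: iso[OF that])+
  have C1: "tproj c (F p) (dd (\<lambda>q. dd F q e) p e) = \<bar>\<kappa>\<bar> *\<^sub>R X2 p" if p: "p \<in> D" for p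
    unfolding cov_hess[OF p] B(3)[OF p] X2_def using h \<sigma>(3) by (simp add: power2_eq_square)
  have C2: "tproj c (F p) (dd X2 p e) = - \<bar>\<kappa>\<bar> *\<^sub>R dd F p e + (\<bar>t\<bar> / sqrt N * \<bar>\<kappa>\<bar>) *\<^sub>R X3 p" if p: "p \<in> D" for p
  proof -
    have d: "dd X2 p e = (\<sigma> / (2 * h)) *\<^sub>R dd \<tau> p e"
      unfolding X2_def
      by (rule dd_bounded_linear[OF bounded_linear_scaleR_right smooth_on_imp_differentiable[OF s\<tau> p]])
    have "inn c (dd X2 p e) (dd F p (1, 0)) = - (\<sigma> * \<kappa>) * fst e" "inn c (dd X2 p e) (dd F p (0, 1)) = - (\<sigma> * \<kappa>) * snd e"
      using h by (simp_all add: d inn_simps d\<tau>[OF p] B[OF p])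
    then have 1: "inn c (dd X2 p e) (dd F p (1, 0)) = - \<bar>\<kappa>\<bar> * fst e" "inn c (dd X2 p e) (dd F p (0, 1)) = - \<bar>\<kappa>\<bar> * snd e"
      by (simp_all only: \<sigma>)
    have 2: "inn c (dd X2 p e) (\<tau> p) = 0" "snd (dd X2 p e) = 0" by (simp_all add: d inn_simps d\<tau>[OF p])
    have "inn c (dd X2 p e) (nor p) = \<bar>\<kappa>\<bar> * (a * fst e + b * snd e)"
      by (simp add: inn_nor 1 2 algebra_simps)
    then have 3: "inn c (dd X2 p e) (nor p) = \<bar>\<kappa>\<bar> * t" by (simp only: B(4)[OF p])
    have X3: "inn c (X3 p) (nor p) = sqrt N"
      using sqN by (simp add: X3_def inn_simps nor_orth[OF p] divide_eq_eq)
    have en: "inn c (dd F p e) (nor p) = 0" using e by (auto simp: nor_orth[OF p])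
    have x3: "inn c (X3 p) (dd F p (1, 0)) = 0" "inn c (X3 p) (dd F p (0, 1)) = 0" "inn c (X3 p) (\<tau> p) = 0"
      by (simp_all add: X3_def inn_simps frame_commuted[OF p])
    show ?thesis
      by (rule tangent_eqI[OF p])
        (use sqN t in \<open>simp_all add: inn_simps 1 2 3 eD[OF p] x3 X3 en frame_commuted[OF p] frame[OF p] inn_dF_position[OF p]\<close>)
  qed
  have C3: "tproj c (F p) (dd X3 p e) = - (\<bar>t\<bar> / sqrt N * \<bar>\<kappa>\<bar>) *\<^sub>R X2 p" if p: "p \<in> D" for p
  proof -
    have "dd nor p e = 0 - a *\<^sub>R hess F p e (1, 0) - b *\<^sub>R hess F p e (0, 1)"
      unfolding nor_def
      by (rule dd_eqI) (intro has_derivative_diff has_derivative_const has_derivative_scaleR_right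
          smooth_on_imp_has_derivative[OF smooth_dF p])
    moreover have "dd X3 p e = (1 / sqrt N) *\<^sub>R dd nor p e"
      unfolding X3_def
      by (rule dd_bounded_linear[OF bounded_linear_scaleR_right smooth_on_imp_differentiable[OF smooth_nor p]])
    ultimately have d: "dd X3 p e = (1 / sqrt N) *\<^sub>R (0 - a *\<^sub>R hess F p e (1, 0) - b *\<^sub>R hess F p e (0, 1))"
      by simp
    have "tproj c (F p) (dd X3 p e) = (1 / sqrt N) *\<^sub>R
        (0 - (a *\<^sub>R (2 * h * \<kappa> * fst e / (4 * h\<^sup>2)) *\<^sub>R \<tau> p) - b *\<^sub>R (2 * h * \<kappa> * snd e / (4 * h\<^sup>2)) *\<^sub>R \<tau> p)"
      unfolding d
      by (simp only: linear_scale[OF linear_tproj] linear_diff[OF linear_tproj] linear_0[OF linear_tproj]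
          cov_hess[OF p] B[OF p])
    also have "\<dots> = - ((a * fst e + b * snd e) * \<kappa> * (2 * h) / (sqrt N * (4 * h\<^sup>2))) *\<^sub>R \<tau> p"
      by (simp add: algebra_simps add_divide_distrib)
    also have "(a * fst e + b * snd e) * \<kappa> * (2 * h) / (sqrt N * (4 * h\<^sup>2)) = t / sqrt N * \<kappa> / (2 * h)"
      unfolding B(4)[OF p] using h by (simp add: power2_eq_square field_simps)
    finally have 1: "tproj c (F p) (dd X3 p e) = - (t / sqrt N * \<kappa> / (2 * h)) *\<^sub>R \<tau> p" .
    have "t / sqrt N * \<kappa> / (2 * h) = \<bar>t\<bar> / sqrt N * (\<bar>\<kappa>\<bar> * \<sigma>) / (2 * h)" using t by (simp add: \<sigma>(3))
    then show ?thesis unfolding 1 X2_def by (simp add: mult.assoc)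
  qed
  have cc: "curve_cov c (F \<circ> \<alpha>) (\<lambda>s. W (\<alpha> s)) s = tproj c (F (\<alpha> s)) (dd W (\<alpha> s) e)"
    if "smooth_on D W" "s \<in> I" for W s
    by (simp add: curve_cov_def vd[OF that])
  show ?thesis
    unfolding frenet_curve_def
  proof (intro conjI exI ballI)
    show "smooth_on I (F \<circ> \<alpha>)" using s\<alpha>'[OF sF] by (simp add: o_def)
    show "(F \<circ> \<alpha>) ` I \<subseteq> space_form c \<times> UNIV" by (rule image_subsetI) (simp add: mem_Times_iff space \<alpha>D)
    show "smooth_on I (\<lambda>s. dd F (\<alpha> s) e)" "smooth_on I (\<lambda>s. X2 (\<alpha> s))" "smooth_on I (\<lambda>s. X3 (\<alpha> s))"
      by (rule s\<alpha>'[OF smooth_dF], rule s\<alpha>'[OF sX(1)], rule s\<alpha>'[OF sX(2)])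
    fix s assume s: "s \<in> I"
    note p = \<alpha>D[OF s]
    show "dd F (\<alpha> s) e = vector_derivative (F \<circ> \<alpha>) (at s)" using vd[OF sF s] by (simp add: o_def)
    show "tangent_at c ((F \<circ> \<alpha>) s) (X2 (\<alpha> s))" "tangent_at c ((F \<circ> \<alpha>) s) (X3 (\<alpha> s))"
      using frame(7,8)[OF p] by (simp_all add: tangent_at_def hor_def)
    show "inn c (dd F (\<alpha> s) e) (dd F (\<alpha> s) e) = 1" "inn c (X2 (\<alpha> s)) (X2 (\<alpha> s)) = 1"
      "inn c (X3 (\<alpha> s)) (X3 (\<alpha> s)) = 1" "inn c (dd F (\<alpha> s) e) (X2 (\<alpha> s)) = 0"
      "inn c (dd F (\<alpha> s) e) (X3 (\<alpha> s)) = 0" "inn c (X2 (\<alpha> s)) (X3 (\<alpha> s)) = 0"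
      by (fact frame[OF p])+
    show "curve_cov c (F \<circ> \<alpha>) (\<lambda>s. dd F (\<alpha> s) e) s = \<bar>\<kappa>\<bar> *\<^sub>R X2 (\<alpha> s)"
      unfolding cc[OF smooth_dF s] by (rule C1[OF p])
    show "curve_cov c (F \<circ> \<alpha>) (\<lambda>s. X2 (\<alpha> s)) s
      = - \<bar>\<kappa>\<bar> *\<^sub>R dd F (\<alpha> s) e + (\<bar>t\<bar> / sqrt N * \<bar>\<kappa>\<bar>) *\<^sub>R X3 (\<alpha> s)"
      unfolding cc[OF sX(1) s] by (rule C2[OF p])
    show "curve_cov c (F \<circ> \<alpha>) (\<lambda>s. X3 (\<alpha> s)) s = - (\<bar>t\<bar> / sqrt N * \<bar>\<kappa>\<bar>) *\<^sub>R X2 (\<alpha> s)"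
      unfolding cc[OF sX(2) s] by (rule C3[OF p])
  qed
qed

end

section \<open>Passing to flat coordinates\<close>

text \<open>With \<open>h = |H|\<close> and \<open>r = 1 / |T|\<^sup>2\<close>, the principal curvatures in direction \<open>H\<close> are
  \<open>h + sdisc c h r\<close> and \<open>h - sdisc c h r\<close>; the corresponding components of \<open>T\<close> are \<open>acoef c h r\<close> and
  \<open>bcoef c h r\<close>.\<close>

definition sdisc :: "real \<Rightarrow> real \<Rightarrow> real \<Rightarrow> real" where
  "sdisc c h r = sqrt (h\<^sup>2 + c * (1 - 1 / r))"

definition acoef :: "real \<Rightarrow> real \<Rightarrow> real \<Rightarrow> real" where
  "acoef c h r = sqrt ((sdisc c h r - h * (2 * r - 1)) / (2 * r * sdisc c h r))"

definition bcoef :: "real \<Rightarrow> real \<Rightarrow> real \<Rightarrow> real" where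
  "bcoef c h r = sqrt ((sdisc c h r + h * (2 * r - 1)) / (2 * r * sdisc c h r))"

text \<open>The squares solve \<open>a^2 + b^2 = 1 / r\<close> and
  \<open>b^2 - a^2 = h (2 r - 1) / (r s)\<close>. The second equation expresses the first entry
  \<open>- 4 h^2 r (r - 1)\<close> of the second fundamental form through the principal curvatures
  \<open>h + s\<close> and \<open>h - s\<close>.\<close>

lemma coef_facts:
  assumes c: "c > 0" and h: "h > 0" and r: "r > 1" and cr: "4 * h\<^sup>2 * r\<^sup>2 \<le> c"
  defines "s \<equiv> sdisc c h r" and "a \<equiv> acoef c h r" and "b \<equiv> bcoef c h r"
  shows "s > h" "s\<^sup>2 = h\<^sup>2 + c * (1 - 1 / r)" "a \<ge> 0" "b > 0" "a\<^sup>2 + b\<^sup>2 = 1 / r"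
    "b\<^sup>2 - a\<^sup>2 = h * (2 * r - 1) / (r * s)" "(4 * h * r\<^sup>2 * s * (a * b))\<^sup>2 = 4 * h\<^sup>2 * r * (r - 1) * (c - 4 * h\<^sup>2 * r\<^sup>2)"
    "a\<^sup>2 = (s - h * (2 * r - 1)) / (2 * r * s)" "b\<^sup>2 = (s + h * (2 * r - 1)) / (2 * r * s)"
proof -
  have pos: "c * (1 - 1 / r) > 0" using c r by simp
  then have nn: "h\<^sup>2 + c * (1 - 1 / r) \<ge> 0" by (simp add: add_nonneg_nonneg less_imp_le)
  show s2: "s\<^sup>2 = h\<^sup>2 + c * (1 - 1 / r)" unfolding s_def sdisc_def using nn by simp
  show sh: "s > h" unfolding s_def sdisc_def by (rule real_less_rsqrt) (use pos in simp)
  have s: "s > 0" using sh h by simp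
  \<comment> \<open>This factorisation turns \<open>cr\<close> into nonnegativity of the radicand of
    \<open>acoef\<close>.\<close>
  have diff: "s\<^sup>2 - (h * (2 * r - 1))\<^sup>2 = (r - 1) / r * (c - 4 * h\<^sup>2 * r\<^sup>2)"
    unfolding s2 using r by (simp add: field_simps power2_eq_square)
  also have "\<dots> \<ge> 0" using r cr by simp
  finally have "(h * (2 * r - 1))\<^sup>2 \<le> s\<^sup>2" by simp
  then have "h * (2 * r - 1) \<le> s" by (rule power2_le_imp_le) (use s in simp)
  then show a2: "a\<^sup>2 = (s - h * (2 * r - 1)) / (2 * r * s)"
    unfolding a_def acoef_def s_def[symmetric] using s r by simp
  have hr: "h * (2 * r - 1) > 0" using h r by simp
  then show b2: "b\<^sup>2 = (s + h * (2 * r - 1)) / (2 * r * s)"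
    unfolding b_def bcoef_def s_def[symmetric] using s r by simp
  show "a \<ge> 0" unfolding a_def acoef_def s_def[symmetric] using \<open>h * (2 * r - 1) \<le> s\<close> s r by simp
  show "b > 0" unfolding b_def bcoef_def s_def[symmetric] using hr s r by simp
  show "a\<^sup>2 + b\<^sup>2 = 1 / r" unfolding a2 b2 using s r by (simp add: field_simps)
  show "b\<^sup>2 - a\<^sup>2 = h * (2 * r - 1) / (r * s)" unfolding a2 b2 using s r by (simp add: field_simps)
  have "(4 * h * r\<^sup>2 * s * (a * b))\<^sup>2 = (4 * h * r\<^sup>2 * s)\<^sup>2 * (a\<^sup>2 * b\<^sup>2)" by (simp add: power_mult_distrib)
  also have "\<dots> = 4 * h\<^sup>2 * r\<^sup>2 * (s\<^sup>2 - (h * (2 * r - 1))\<^sup>2)"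
  proof -
    have e: "(4 * h * r\<^sup>2 * s)\<^sup>2 * (x / (2 * r * s) * (y / (2 * r * s))) = 4 * h\<^sup>2 * r\<^sup>2 * (x * y)" for x y
      using r s by (simp add: power2_eq_square)
    show ?thesis unfolding a2 b2 e by (simp add: power2_eq_square algebra_simps)
  qed
  also have "\<dots> = 4 * h\<^sup>2 * r * (r - 1) * (c - 4 * h\<^sup>2 * r\<^sup>2)"
    unfolding diff using r by (simp add: power2_eq_square)
  finally show "(4 * h * r\<^sup>2 * s * (a * b))\<^sup>2 = 4 * h\<^sup>2 * r * (r - 1) * (c - 4 * h\<^sup>2 * r\<^sup>2)" .
qed

text \<open>The fractions are \<open>a^2\<close> and \<open>b^2\<close>, and the sums are the
  entries from \<open>b_values\<close> evaluated on the two coordinate fields; the middle terms come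
  from the mixed entry.\<close>

lemma coef_principal_curvature:
  fixes h r s :: real
  assumes r: "r > 1" and s: "s > 0"
  defines "m \<equiv> h * (2 * r - 1)"
  shows "- 4 * h\<^sup>2 * r * (r - 1) * ((s - m) / (2 * r * s)) + 8 * h * r\<^sup>2 * s * ((s - m) / (2 * r * s) * ((s + m) / (2 * r * s)))
      + 4 * h\<^sup>2 * r\<^sup>2 * ((s + m) / (2 * r * s)) = 2 * h * (h + s)" (is "?A1 + ?A2 + ?A3 = _")
    and "- 4 * h\<^sup>2 * r * (r - 1) * ((s + m) / (2 * r * s)) - 8 * h * r\<^sup>2 * s * ((s - m) / (2 * r * s) * ((s + m) / (2 * r * s)))
      + 4 * h\<^sup>2 * r\<^sup>2 * ((s - m) / (2 * r * s)) = 2 * h * (h - s)" (is "?B1 - ?A2 + ?B3 = _")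
proof -
  have 1: "- 4 * h\<^sup>2 * r * (r - 1) * (x / (2 * r * s)) = - 2 * h\<^sup>2 * (r - 1) * x / s"
    "4 * h\<^sup>2 * r\<^sup>2 * (x / (2 * r * s)) = 2 * h\<^sup>2 * r * x / s" for x
    using r s by (simp_all add: power2_eq_square)
  have 2: "8 * h * r\<^sup>2 * s * (x / (2 * r * s) * (y / (2 * r * s))) = 2 * h * (x * y) / s" for x y
    using r s by (simp add: power2_eq_square)
  have "?A1 + ?A2 + ?A3 = (- 2 * h\<^sup>2 * (r - 1) * (s - m) + 2 * h * ((s - m) * (s + m)) + 2 * h\<^sup>2 * r * (s + m)) / s"
    unfolding 1 2 by (simp only: add_divide_distrib)
  also have "- 2 * h\<^sup>2 * (r - 1) * (s - m) + 2 * h * ((s - m) * (s + m)) + 2 * h\<^sup>2 * r * (s + m) = 2 * h * (h + s) * s"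
    by (simp add: m_def power2_eq_square algebra_simps)
  finally show "?A1 + ?A2 + ?A3 = 2 * h * (h + s)" using s by simp
  have "?B1 - ?A2 + ?B3 = (- 2 * h\<^sup>2 * (r - 1) * (s + m) - 2 * h * ((s - m) * (s + m)) + 2 * h\<^sup>2 * r * (s - m)) / s"
    unfolding 1 2 by (simp only: add_divide_distrib diff_divide_distrib)
  also have "- 2 * h\<^sup>2 * (r - 1) * (s + m) - 2 * h * ((s - m) * (s + m)) + 2 * h\<^sup>2 * r * (s - m) = 2 * h * (h - s) * s"
    by (simp add: m_def power2_eq_square algebra_simps)
  finally show "?B1 - ?A2 + ?B3 = 2 * h * (h - s)" using s by simp
qed

text \<open>The denominator is the difference of squares
  \<open>(2 - a^2 - b^2)^2 - (b^2 - a^2)^2\<close>. With \<open>k = (2 r - 1) / r\<close> the two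
  bases are \<open>k\<close> and \<open>k h / s\<close>, so the denominator is
  \<open>k^2 (s^2 - h^2) / s^2\<close> and the numerator is \<open>h^2\<close> times the same
  number.\<close>

lemma coef_mean_curvature:
  assumes c: "c > 0" and h: "h > 0" and r: "r > 1" and cr: "4 * h\<^sup>2 * r\<^sup>2 \<le> c"
  defines "a \<equiv> acoef c h r" and "b \<equiv> bcoef c h r"
  shows "h\<^sup>2 = c * (1 - a\<^sup>2 - b\<^sup>2) * (b\<^sup>2 - a\<^sup>2)\<^sup>2 / (4 * (1 - a\<^sup>2) * (1 - b\<^sup>2))"
proof -
  define s where "s = sdisc c h r"
  note F = coef_facts[OF c h r cr, folded s_def a_def b_def]
  have s: "s > 0" using F(1) h by simp
  define n where "n = c * (1 - 1 / r)"
  have n: "n > 0" using c r by (simp add: n_def)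
  have k: "(2 * r - 1) / r > 0" using r by simp
  have ba: "b\<^sup>2 - a\<^sup>2 = (2 * r - 1) / r * (h / s)" unfolding F(6) by simp
  have e: "k\<^sup>2 - (k * (h / s))\<^sup>2 = k\<^sup>2 * ((s\<^sup>2 - h\<^sup>2) / s\<^sup>2)" for k
    using s by (simp add: power_mult_distrib power_divide diff_divide_distrib right_diff_distrib)
  have "4 * (1 - a\<^sup>2) * (1 - b\<^sup>2) = (2 - (a\<^sup>2 + b\<^sup>2))\<^sup>2 - (b\<^sup>2 - a\<^sup>2)\<^sup>2" by (simp add: power2_eq_square algebra_simps)
  also have "2 - (a\<^sup>2 + b\<^sup>2) = (2 * r - 1) / r" unfolding F(5) using r by (simp add: field_simps)
  finally have den: "4 * (1 - a\<^sup>2) * (1 - b\<^sup>2) = ((2 * r - 1) / r)\<^sup>2 * (n / s\<^sup>2)"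
    unfolding ba e F(2) n_def by simp
  have "1 - a\<^sup>2 - b\<^sup>2 = 1 - 1 / r" using F(5) by simp
  then have n': "c * (1 - a\<^sup>2 - b\<^sup>2) = n" by (simp add: n_def)
  have num: "c * (1 - a\<^sup>2 - b\<^sup>2) * (b\<^sup>2 - a\<^sup>2)\<^sup>2 = h\<^sup>2 * (((2 * r - 1) / r)\<^sup>2 * (n / s\<^sup>2))"
    unfolding n' ba by (simp add: power_mult_distrib power_divide)
  have "((2 * r - 1) / r)\<^sup>2 * (n / s\<^sup>2) > 0"
    using k n s r by (intro mult_pos_pos divide_pos_pos zero_less_power) auto
  then have "((2 * r - 1) / r)\<^sup>2 * (n / s\<^sup>2) \<noteq> 0" by (rule less_imp_neq[symmetric])
  then show ?thesis unfolding num den by (rule nonzero_mult_div_cancel_right[symmetric])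
qed

text \<open>The change from flat coordinates to isothermal ones, whose first one is the height
  \<open>a u + b v\<close>. The sign \<open>\<epsilon>\<close> selects the orientation for which \<open>X\<^sub>u\<close> and \<open>X\<^sub>v\<close> are principal directions.\<close>

definition rot :: "real \<Rightarrow> real \<Rightarrow> real \<Rightarrow> plane \<Rightarrow> plane" where
  "rot \<epsilon> a b p = (a * fst p + b * snd p, \<epsilon> * (a * snd p - b * fst p))"

lemma bounded_linear_rot: "bounded_linear (rot \<epsilon> a b)"
  unfolding linear_conv_bounded_linear[symmetric]
  by (rule linearI) (auto simp: rot_def algebra_simps)

context isothermal_surface
begin

text \<open>Since \<open>\<rho>\<close> and \<open>b\<close> are constant, a linear map can
  diagonalise \<open>b\<close> and normalise the metric on the whole patch. The inequality is the
  nonnegativity of the square of the mixed entry.\<close>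

lemma flat_chart_rot:
  assumes o': "o' \<in> V" and r: "r = \<rho> o'" and \<epsilon>: "\<epsilon> = (if b o' (1, 0) (0, 1) > 0 then - 1 else 1)"
  defines "\<alpha> \<equiv> acoef c h r" and "\<beta> \<equiv> bcoef c h r" and "s \<equiv> sdisc c h r"
  defines "\<L> \<equiv> rot \<epsilon> \<alpha> \<beta>"
  shows "flat_chart c h \<alpha> \<beta> (h + s) (h - s) (\<L> -` V) (\<lambda>p. f (\<L> p)) (\<lambda>p. \<tau> (\<L> p))"
    and "4 * h\<^sup>2 * r\<^sup>2 \<le> c"
proof -
  have c0: "c > 0" by (rule c_pos[OF o'])
  have r1: "r > 1" using \<rho>1[OF o'] r by simp
  have \<rho>r: "\<rho> q = r" if "q \<in> V" for q using \<rho>_constant[OF that o'] r by simp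
  have "4 * h\<^sup>2 * r * (r - 1) * (c - 4 * h\<^sup>2 * r\<^sup>2) \<ge> 0" using b_values(3)[OF o'] r by (metis zero_le_power2)
  moreover have "4 * h\<^sup>2 * r * (r - 1) > 0" using h r1 by simp
  ultimately show cr: "4 * h\<^sup>2 * r\<^sup>2 \<le> c" by (simp add: zero_le_mult_iff)
  note C = coef_facts[OF c0 h r1 cr, folded \<alpha>_def \<beta>_def s_def]
  have s: "s > 0" using C(1) h by simp
  have \<epsilon>2: "\<epsilon> * \<epsilon> = 1" using \<epsilon> by simp
  \<comment> \<open>The mixed entry is known only up to sign. Multiplied by
    \<open>\<epsilon>\<close> it is nonpositive, which matches
    \<open>\<alpha> * \<beta> \<ge> 0\<close>; its constancy carries the sign from \<open>o'\<close>
    to all of \<open>V\<close>.\<close>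
  have b12: "\<epsilon> * b q (1, 0) (0, 1) = - (4 * h * r\<^sup>2 * s * (\<alpha> * \<beta>))" if "q \<in> V" for q
  proof -
    have "(b q (1, 0) (0, 1))\<^sup>2 = (4 * h * r\<^sup>2 * s * (\<alpha> * \<beta>))\<^sup>2"
      using b_values(3)[OF that] C(7) by (simp add: \<rho>r[OF that])
    then have "\<bar>b q (1, 0) (0, 1)\<bar> = \<bar>4 * h * r\<^sup>2 * s * (\<alpha> * \<beta>)\<bar>" by (simp only: power2_eq_iff abs_eq_iff)
    moreover have "4 * h * r\<^sup>2 * s * (\<alpha> * \<beta>) \<ge> 0" using h s C(3,4) by simp
    moreover have "\<epsilon> * b q (1, 0) (0, 1) = - \<bar>b q (1, 0) (0, 1)\<bar>"
      unfolding \<epsilon> b12_constant[OF that o'] by simp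
    ultimately show ?thesis by simp
  qed
  have b11: "b q (1, 0) (1, 0) = - 4 * h\<^sup>2 * r * (r - 1)" and b22: "b q (0, 1) (0, 1) = 4 * h\<^sup>2 * r\<^sup>2" if "q \<in> V" for q
    using b_values(1,2)[OF that] by (simp_all add: \<rho>r[OF that])
  have bl: "bounded_linear \<L>" unfolding \<L>_def by (rule bounded_linear_rot)
  let ?D = "\<L> -` V"
  have D: "open ?D"
    using V(1) linear_continuous_on[OF bl] by (intro open_vimage) auto
  have s\<L>: "smooth_on ?D \<L>" by (rule smooth_on_bounded_linear[OF D bl smooth_on_id[OF D]])
  have hd: "(\<L> has_derivative \<L>) (at p)" for p
    by (rule bounded_linear.has_derivative[OF bl has_derivative_ident])
  have d\<L>: "\<L> differentiable (at p)" "dd \<L> p x = \<L> x" for p x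
    by (rule differentiableI[OF hd], rule dd_eqI[OF hd])
  have sm: "smooth_on ?D (\<lambda>p. W (\<L> p))" if "smooth_on V W" for W :: "plane \<Rightarrow> ambient"
    by (rule smooth_on_compose[OF D V(1) _ s\<L> that]) auto
  have dW: "dd (\<lambda>p. W (\<L> p)) p x = dd W (\<L> p) (\<L> x)" if "smooth_on V W" "\<L> p \<in> V" for W :: "plane \<Rightarrow> ambient" and p x
    using dd_compose[OF d\<L>(1) smooth_on_imp_differentiable[OF that]] d\<L>(2) by simp
  have hessF: "hess (\<lambda>p. f (\<L> p)) p x y = hess f (\<L> p) (\<L> x) (\<L> y)" if p: "\<L> p \<in> V" for p x y
  proof -
    have "hess (\<lambda>p. f (\<L> p)) p x y = dd (\<lambda>p. dd f (\<L> p) (\<L> y)) p x"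
      by (rule dd_cong_open[OF D]) (use p dW[OF sf] in auto)
    also have "\<dots> = hess f (\<L> p) (\<L> x) (\<L> y)" by (rule dW[OF smooth_df p])
    finally show ?thesis .
  qed
  have \<L>1: "\<L> (1, 0) = (\<alpha>, - (\<epsilon> * \<beta>))" and \<L>2: "\<L> (0, 1) = (\<beta>, \<epsilon> * \<alpha>)" by (simp_all add: \<L>_def rot_def)
  have df2: "dd f q x = fst x *\<^sub>R dd f q (1, 0) + snd x *\<^sub>R dd f q (0, 1)" if "q \<in> V" for q x
    by (rule dd_plane[OF diff_f[OF that]])
  have bb: "b q x y = fst x * fst y * b q (1, 0) (1, 0) + (fst x * snd y + snd x * fst y) * b q (1, 0) (0, 1)
      + snd x * snd y * b q (0, 1) (0, 1)" if q: "q \<in> V" for q x y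
  proof -
    have 1: "b q x y = fst x * b q (1, 0) y + snd x * b q (0, 1) y" for x y
    proof -
      have "hess f q x y = fst x *\<^sub>R hess f q (1, 0) y + snd x *\<^sub>R hess f q (0, 1) y"
        by (rule dd_plane[OF smooth_on_imp_differentiable[OF smooth_df q]])
      then show ?thesis by (simp add: b_def inn_simps)
    qed
    have 2: "b q (1, 0) y = fst y * b q (1, 0) (1, 0) + snd y * b q (1, 0) (0, 1)"
      "b q (0, 1) y = fst y * b q (1, 0) (0, 1) + snd y * b q (0, 1) (0, 1)"
      using 1[of y "(1, 0)"] 1[of y "(0, 1)"] b_commute[OF q, of y "(1, 0)"] b_commute[OF q, of y "(0, 1)"]
        b_commute[OF q, of "(1, 0)" "(0, 1)"] by simp_all
    show ?thesis unfolding 1[of x y] 2 by (simp add: algebra_simps)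
  qed
  show "flat_chart c h \<alpha> \<beta> (h + s) (h - s) ?D (\<lambda>p. f (\<L> p)) (\<lambda>p. \<tau> (\<L> p))"
  proof (unfold_locales)
    show "c \<noteq> 0" "h > 0" "open ?D" by (fact c h D)+
    show "smooth_on ?D (\<lambda>p. f (\<L> p))" "smooth_on ?D (\<lambda>p. \<tau> (\<L> p))" by (fact sm[OF sf] sm[OF s\<tau>])+
    show "\<alpha>\<^sup>2 + \<beta>\<^sup>2 < 1" unfolding C(5) using r1 by simp
    fix p assume "p \<in> ?D"
    then have p: "\<L> p \<in> V" by simp
    show "fst (f (\<L> p)) \<in> space_form c" by (rule space[OF p])
    have "inn c (dd f (\<L> p) (\<L> x)) (dd f (\<L> p) (\<L> y)) = r * (fst (\<L> x) * fst (\<L> y) + snd (\<L> x) * snd (\<L> y))" for x y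
      unfolding df2[OF p, of "\<L> x"] df2[OF p, of "\<L> y"] using g12[OF p]
      by (simp add: inn_simps g11[OF p] g22[OF p] \<rho>r[OF p] inn_commute[of c "dd f (\<L> p) (0, 1)" "dd f (\<L> p) (1, 0)"]
          algebra_simps)
    \<comment> \<open>The factor \<open>r\<close> of the metric is absorbed by the scaling
      \<open>\<alpha>\<^sup>2 + \<beta>\<^sup>2 = 1 / r\<close> of the rotation.\<close>
    moreover have "r * (fst (\<L> x) * fst (\<L> y) + snd (\<L> x) * snd (\<L> y)) = x \<bullet> y" for x y
    proof -
      have "r * (fst (\<L> x) * fst (\<L> y) + snd (\<L> x) * snd (\<L> y)) = r * ((\<alpha> * fst x + \<beta> * snd x) * (\<alpha> * fst y + \<beta> * snd y)
         + (\<epsilon> * \<epsilon>) * (\<alpha> * snd x - \<beta> * fst x) * (\<alpha> * snd y - \<beta> * fst y))"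
        by (simp add: \<L>_def rot_def algebra_simps)
      also have "\<dots> = (\<alpha>\<^sup>2 + \<beta>\<^sup>2) * r * (fst x * fst y + snd x * snd y)"
        unfolding \<epsilon>2 by (simp add: power2_eq_square algebra_simps)
      also have "\<dots> = x \<bullet> y" unfolding C(5) using r1 by (simp add: inner_prod_def)
      finally show ?thesis .
    qed
    ultimately show "inn c (dd (\<lambda>p. f (\<L> p)) p x) (dd (\<lambda>p. f (\<L> p)) p y) = x \<bullet> y" for x y
      by (simp add: dW[OF sf p])
    show "snd (dd (\<lambda>p. f (\<L> p)) p (1, 0)) = \<alpha>" "snd (dd (\<lambda>p. f (\<L> p)) p (0, 1)) = \<beta>"
      unfolding dW[OF sf p] \<L>1 \<L>2 df2[OF p, of "(\<alpha>, - (\<epsilon> * \<beta>))"] df2[OF p, of "(\<beta>, \<epsilon> * \<alpha>)"]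
      by (simp_all add: s1[OF p] s2[OF p])
    show "inn c (\<tau> (\<L> p)) (dd (\<lambda>p. f (\<L> p)) p x) = 0" for x by (simp add: dW[OF sf p] \<tau>f[OF p])
    show "inn c (\<tau> (\<L> p)) (hor (f (\<L> p))) = 0" "snd (\<tau> (\<L> p)) = 0" "inn c (\<tau> (\<L> p)) (\<tau> (\<L> p)) = 4 * h\<^sup>2"
      by (rule \<tau>P[OF p] \<tau>s[OF p] \<tau>\<tau>[OF p])+
    have e12: "b (\<L> p) (1, 0) (0, 1) * \<epsilon> = - (4 * h * r\<^sup>2 * s * (\<alpha> * \<beta>))" using b12[OF p] by (simp add: mult.commute)
    have "inn c (hess (\<lambda>p. f (\<L> p)) p (1, 0) (1, 0)) (\<tau> (\<L> p)) = b (\<L> p) (\<alpha>, - (\<epsilon> * \<beta>)) (\<alpha>, - (\<epsilon> * \<beta>))"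
      unfolding hessF[OF p] \<L>1 b_def ..
    also have "\<dots> = \<alpha>\<^sup>2 * b (\<L> p) (1, 0) (1, 0) - 2 * (\<alpha> * \<beta>) * (b (\<L> p) (1, 0) (0, 1) * \<epsilon>)
        + (\<epsilon> * \<epsilon>) * \<beta>\<^sup>2 * b (\<L> p) (0, 1) (0, 1)"
      unfolding bb[OF p, of "(\<alpha>, - (\<epsilon> * \<beta>))"] by (simp add: power2_eq_square algebra_simps)
    also have "\<dots> = - 4 * h\<^sup>2 * r * (r - 1) * \<alpha>\<^sup>2 + 8 * h * r\<^sup>2 * s * (\<alpha>\<^sup>2 * \<beta>\<^sup>2) + 4 * h\<^sup>2 * r\<^sup>2 * \<beta>\<^sup>2"
      unfolding e12 \<epsilon>2 b11[OF p] b22[OF p] by (simp add: power2_eq_square algebra_simps)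
    also have "\<dots> = 2 * h * (h + s)"
      unfolding C(8,9) by (rule coef_principal_curvature[OF r1 s])
    finally show uu: "inn c (hess (\<lambda>p. f (\<L> p)) p (1, 0) (1, 0)) (\<tau> (\<L> p)) = 2 * h * (h + s)" .
    have "inn c (hess (\<lambda>p. f (\<L> p)) p (1, 0) (0, 1)) (\<tau> (\<L> p)) = b (\<L> p) (\<alpha>, - (\<epsilon> * \<beta>)) (\<beta>, \<epsilon> * \<alpha>)"
      unfolding hessF[OF p] \<L>1 \<L>2 b_def ..
    also have "\<dots> = \<alpha> * \<beta> * b (\<L> p) (1, 0) (1, 0) - (\<beta>\<^sup>2 - \<alpha>\<^sup>2) * (b (\<L> p) (1, 0) (0, 1) * \<epsilon>)
        - (\<epsilon> * \<epsilon>) * \<alpha> * \<beta> * b (\<L> p) (0, 1) (0, 1)"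
      unfolding bb[OF p, of "(\<alpha>, - (\<epsilon> * \<beta>))"] by (simp add: power2_eq_square algebra_simps)
    \<comment> \<open>The value of \<open>\<beta>\<^sup>2 - \<alpha>\<^sup>2\<close> is exactly the
      one that cancels the off-diagonal entry.\<close>
    also have "\<dots> = 0"
      unfolding e12 \<epsilon>2 b11[OF p] b22[OF p] C(6) using s r1 by (simp add: power2_eq_square field_simps)
    finally show "inn c (hess (\<lambda>p. f (\<L> p)) p (1, 0) (0, 1)) (\<tau> (\<L> p)) = 0" .
    have "inn c (hess (\<lambda>p. f (\<L> p)) p (0, 1) (0, 1)) (\<tau> (\<L> p)) = b (\<L> p) (\<beta>, \<epsilon> * \<alpha>) (\<beta>, \<epsilon> * \<alpha>)"
      unfolding hessF[OF p] \<L>2 b_def ..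
    also have "\<dots> = \<beta>\<^sup>2 * b (\<L> p) (1, 0) (1, 0) + 2 * (\<alpha> * \<beta>) * (b (\<L> p) (1, 0) (0, 1) * \<epsilon>)
        + (\<epsilon> * \<epsilon>) * \<alpha>\<^sup>2 * b (\<L> p) (0, 1) (0, 1)"
      unfolding bb[OF p, of "(\<beta>, \<epsilon> * \<alpha>)"] by (simp add: power2_eq_square algebra_simps)
    also have "\<dots> = - 4 * h\<^sup>2 * r * (r - 1) * \<beta>\<^sup>2 - 8 * h * r\<^sup>2 * s * (\<alpha>\<^sup>2 * \<beta>\<^sup>2) + 4 * h\<^sup>2 * r\<^sup>2 * \<alpha>\<^sup>2"
      unfolding e12 \<epsilon>2 b11[OF p] b22[OF p] by (simp add: power2_eq_square algebra_simps)
    also have "\<dots> = 2 * h * (h - s)"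
      unfolding C(8,9) by (rule coef_principal_curvature[OF r1 s])
    finally show "inn c (hess (\<lambda>p. f (\<L> p)) p (0, 1) (0, 1)) (\<tau> (\<L> p)) = 2 * h * (h - s)" .
  qed
qed

end

section \<open>Charts of a biharmonic surface\<close>

text \<open>An isometry into the Euclidean plane carries the induced connection to the ordinary
  derivative: \<open>dd \<Phi>\<close> maps Christoffel vectors to second derivatives of
  \<open>\<Phi>\<close>. Curvature then becomes a commutator of derivatives and vanishes.\<close>

lemma (in patch) flat_at_of_isometry:
  assumes U: "open U" "U \<subseteq> D" and s\<Phi>: "smooth_on U \<Phi>" and p: "p \<in> U"
    and iso: "\<And>q x y. q \<in> U \<Longrightarrow> fff c f q x y = dd \<Phi> q x \<bullet> dd (\<Phi> :: plane \<Rightarrow> plane) q y"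
  shows "flat_at c f p"
proof -
  have qD: "q \<in> D" if "q \<in> U" for q using U(2) that by blast
  have lin: "linear (dd \<Phi> q)" if "q \<in> U" for q by (rule linear_dd[OF s\<Phi> that])
  have inj\<Phi>: "v = w" if q: "q \<in> U" and eq: "dd \<Phi> q v = dd \<Phi> q w" for q v w
  proof (rule ccontr)
    assume "v \<noteq> w"
    then have "fff c f q (v - w) (v - w) > 0" by (intro fff_pos qD[OF q]) simp
    then show False using eq by (simp add: iso[OF q] linear_diff[OF lin[OF q]])
  qed
  have surj\<Phi>: "surj (dd \<Phi> q)" if "q \<in> U" for q
    by (rule linear_injective_imp_surjective[OF lin[OF that]])
      (use inj\<Phi>[OF that] in \<open>auto intro: injI\<close>)
  have s: "smooth_on U (\<lambda>q. dd \<Phi> q x)" for x by (rule smooth_on_dd[OF s\<Phi>])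
  note sdiff = smooth_on_imp_differentiable[OF s]
  have \<Phi>chr: "dd \<Phi> q (christoffel c f q x y) = hess \<Phi> q x y" if q: "q \<in> U" for q x y
  proof -
    have d: "dd (\<lambda>q. fff c f q u v) q w = hess \<Phi> q w u \<bullet> dd \<Phi> q v + hess \<Phi> q w v \<bullet> dd \<Phi> q u" for u v w
    proof -
      have "dd (\<lambda>q. fff c f q u v) q w = dd (\<lambda>q. dd \<Phi> q u \<bullet> dd \<Phi> q v) q w"
        by (rule dd_cong_open[OF U(1) q]) (rule iso)
      also have "\<dots> = dd \<Phi> q u \<bullet> hess \<Phi> q w v + hess \<Phi> q w u \<bullet> dd \<Phi> q v"
        by (rule dd_eqI) (intro has_derivative_inner smooth_on_imp_has_derivative[OF s q])
      finally show ?thesis by (simp add: inner_commute)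
    qed
    have comm: "hess \<Phi> q u v = hess \<Phi> q v u" for u v
      by (rule second_derivative_symmetric[OF U(1) s\<Phi> q])
    have k: "(dd (\<lambda>q. fff c f q y z) q x + dd (\<lambda>q. fff c f q x z) q y - dd (\<lambda>q. fff c f q x y) q z) / 2
      = hess \<Phi> q x y \<bullet> dd \<Phi> q z" for z
      unfolding d comm[of y x] comm[of z x] comm[of z y] by simp
    have lk: "linear (\<lambda>z. hess \<Phi> q x y \<bullet> dd \<Phi> q z)"
      using linear_compose[OF lin[OF q] bounded_linear.linear[OF bounded_linear_inner_right]] by (simp add: o_def)
    have orth: "(hess \<Phi> q x y - dd \<Phi> q (christoffel c f q x y)) \<bullet> dd \<Phi> q z = 0" for z
      using fff_metric_dual[OF qD[OF q] lk, of z] unfolding christoffel_def k iso[OF q]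
      by (simp add: inner_diff_left)
    obtain z where "hess \<Phi> q x y - dd \<Phi> q (christoffel c f q x y) = dd \<Phi> q z"
      using surj\<Phi>[OF q] by (metis surjD)
    then have "hess \<Phi> q x y - dd \<Phi> q (christoffel c f q x y) = 0" using orth[of z] by simp
    then show ?thesis by simp
  qed
  have pD: "p \<in> D" by (rule qD[OF p])
  \<comment> \<open>Second covariant derivatives go to third ordinary ones. \<open>S\<close> is
    expanded in the coordinate basis because \<open>dd \<Phi> q (S q)\<close> depends on
    \<open>q\<close> in both places.\<close>
  have cov: "dd \<Phi> p (surf_cov c f (\<lambda>_. x) (surf_cov c f (\<lambda>_. y) (\<lambda>_. z)) p) = hess (\<lambda>r. dd \<Phi> r z) p x y" for x y z
  proof -
    define S where "S q = surf_cov c f (\<lambda>_. y) (\<lambda>_. z) q" for q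
    have S: "S q = christoffel c f q y z" for q by (simp add: S_def surf_cov_def)
    have sS: "smooth_on U S" unfolding S by (rule smooth_on_subset[OF smooth_christoffel U(2)])
    have "hess (\<lambda>r. dd \<Phi> r z) p x y = dd (\<lambda>q. dd \<Phi> q (S q)) p x"
      by (rule dd_cong_open[OF U(1) p]) (simp add: S \<Phi>chr)
    also have "\<dots> = dd (\<lambda>q. fst (S q) *\<^sub>R dd \<Phi> q (1, 0) + snd (S q) *\<^sub>R dd \<Phi> q (0, 1)) p x"
      by (rule dd_cong_open[OF U(1) p]) (rule dd_plane[OF smooth_on_imp_differentiable[OF s\<Phi>]])
    also have "\<dots> = fst (S p) *\<^sub>R hess \<Phi> p x (1, 0) + fst (dd S p x) *\<^sub>R dd \<Phi> p (1, 0)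
        + (snd (S p) *\<^sub>R hess \<Phi> p x (0, 1) + snd (dd S p x) *\<^sub>R dd \<Phi> p (0, 1))"
      by (rule dd_eqI) (intro has_derivative_add has_derivative_scaleR has_derivative_fst has_derivative_snd
          smooth_on_imp_has_derivative[OF _ p] s sS)
    also have "\<dots> = (fst (S p) *\<^sub>R hess \<Phi> p (1, 0) x + snd (S p) *\<^sub>R hess \<Phi> p (0, 1) x)
        + (fst (dd S p x) *\<^sub>R dd \<Phi> p (1, 0) + snd (dd S p x) *\<^sub>R dd \<Phi> p (0, 1))"
      using second_derivative_symmetric[OF U(1) s\<Phi> p, where x = x and y = "(1, 0)"]
        second_derivative_symmetric[OF U(1) s\<Phi> p, where x = x and y = "(0, 1)"] by simp
    also have "\<dots> = hess \<Phi> p (S p) x + dd \<Phi> p (dd S p x)"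
      using dd_plane[OF sdiff[OF p], of x "S p"]
        dd_plane[OF smooth_on_imp_differentiable[OF s\<Phi> p], of "dd S p x"] by (simp only:)
    also have "\<dots> = dd \<Phi> p (christoffel c f p x (S p)) + dd \<Phi> p (dd S p x)"
      using second_derivative_symmetric[OF U(1) s\<Phi> p, where x = x and y = "S p"] \<Phi>chr[OF p] by simp
    also have "\<dots> = dd \<Phi> p (surf_cov c f (\<lambda>_. x) S p)"
      by (simp add: surf_cov_def linear_add[OF lin[OF p]])
    finally show ?thesis by (simp add: S_def[abs_def])
  qed
  have chr0: "christoffel c f p 0 z = 0" for z
  proof (rule inj\<Phi>[OF p])
    have "hess \<Phi> p 0 z = 0" by (rule linear_0[OF linear_dd[OF s p]])
    then show "dd \<Phi> p (christoffel c f p 0 z) = dd \<Phi> p 0"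
      using \<Phi>chr[OF p, of 0 z] linear_0[OF lin[OF p]] by simp
  qed
  have "surf_curv_field c f (\<lambda>_. x) (\<lambda>_. y) (\<lambda>_. z) p = 0" for x y z
  proof -
    have br: "surf_cov c f (bracket (\<lambda>_. x) (\<lambda>_. y)) (\<lambda>_. z) p = 0"
      by (simp add: surf_cov_def bracket_def chr0)
    have "dd \<Phi> p (surf_curv_field c f (\<lambda>_. x) (\<lambda>_. y) (\<lambda>_. z) p) = hess (\<lambda>r. dd \<Phi> r z) p x y - hess (\<lambda>r. dd \<Phi> r z) p y x"
      by (simp add: surf_curv_field_def br linear_diff[OF lin[OF p]] cov)
    also have "\<dots> = dd \<Phi> p 0"
      using second_derivative_symmetric[OF U(1) s p, where x = x and y = y] linear_0[OF lin[OF p]] by simp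
    finally show ?thesis by (rule inj\<Phi>[OF p])
  qed
  then show ?thesis by (simp add: flat_at_def)
qed

section \<open>Local conclusions for a biharmonic patch\<close>

locale biharmonic_patch = patch +
  fixes h :: real
  assumes bih: "p \<in> D \<Longrightarrow> bitension c f p = 0"
    and cmc: "p \<in> D \<Longrightarrow> len c (mean_curv c f p) = h"
    and Hnz: "p \<in> D \<Longrightarrow> mean_curv c f p \<noteq> 0"
    and Hxi: "p \<in> D \<Longrightarrow> inn c (mean_curv c f p) xi = 0"
    and T: "p \<in> D \<Longrightarrow> len c (T_part c f p) \<in> {0<..<1}"

sublocale biharmonic_patch \<subseteq> horizontal_patch
  by unfold_locales (use Hxi in \<open>simp add: inn_xi mean_curv_eq\<close>)

context biharmonic_patch
begin

lemma h_pos: assumes p: "p \<in> D" shows "h > 0" "inn c (tension c f p) (tension c f p) = 4 * h\<^sup>2"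
proof -
  have "inn c (mean_curv c f p) (hor (f p)) = 0" by (simp add: mean_curv_eq p inn_simps inn_tension_hor)
  then have pos: "inn c (mean_curv c f p) (mean_curv c f p) > 0" by (rule inn_pos[OF space_form[OF p] _ Hnz[OF p] c])
  then show "h > 0" unfolding cmc[OF p, symmetric] len_def by (rule real_sqrt_gt_zero)
  have "h\<^sup>2 = inn c (mean_curv c f p) (mean_curv c f p)" using cmc[OF p] pos by (auto simp: len_def)
  then show "inn c (tension c f p) (tension c f p) = 4 * h\<^sup>2" by (simp add: mean_curv_eq p inn_simps)
qed

lemma tnorm2: assumes p: "p \<in> D"
  shows "0 < tnorm2 p" "tnorm2 p < 1" "(len c (T_part c f p))\<^sup>2 = tnorm2 p"
proof -
  have "sqrt (tnorm2 p) \<in> {0<..<1}" using T[OF p] by (simp add: len_def inn_T_part p)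
  then show "0 < tnorm2 p" "tnorm2 p < 1" by auto
  then show "(len c (T_part c f p))\<^sup>2 = tnorm2 p" by (simp add: len_def inn_T_part p)
qed

text \<open>The vanishing bitension field controls only the projected Laplacian, hence the free
  component \<open>l\<close> along the position vector.\<close>

lemma laplace_tension:
  assumes p: "p \<in> D"
  shows "\<exists>l. laplace c f (tension c f) p = - (c * (2 - tnorm2 p)) *\<^sub>R tension c f p + l *\<^sub>R hor (f p)"
proof -
  have "tproj c (f p) (laplace c f (tension c f) p) = - (c * (2 - tnorm2 p)) *\<^sub>R tension c f p"
    using bih[OF p] unfolding bitension_eq[OF p] hmass_eq[OF p] by (simp add: eq_neg_iff_add_eq_0)
  then show ?thesis unfolding tproj_eq by (metis diff_eq_eq)
qed

text \<open>The isothermal chart followed by the inverse of the rotation. The coefficients use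
  \<open>|T|\<close> at \<open>p0\<close>, which is legitimate because \<open>|T|\<close> is
  constant on the neighbourhood.\<close>

lemma flat_coordinates:
  assumes p0: "p0 \<in> D"
  defines "r \<equiv> 1 / tnorm2 p0"
  obtains U E \<Phi> \<Psi> where "open U" "p0 \<in> U" "U \<subseteq> D" "open E" "homeomorphism U E \<Phi> \<Psi>"
    "smooth_on U \<Phi>" "smooth_on E \<Psi>" "\<And>p. p \<in> U \<Longrightarrow> tnorm2 p = tnorm2 p0" "c > 0" "4 * h\<^sup>2 * r\<^sup>2 \<le> c"
    "flat_chart c h (acoef c h r) (bcoef c h r) (h + sdisc c h r) (h - sdisc c h r) E
       (\<lambda>q. f (\<Psi> q)) (\<lambda>q. tension c f (\<Psi> q))"
proof -
  obtain U \<epsilon> G \<Phi> where U: "open U" "p0 \<in> U" "U \<subseteq> D" and \<epsilon>0: "\<epsilon> > 0"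
    and hom: "homeomorphism U (ball (\<Phi> p0) \<epsilon>) \<Phi> G"
    and s\<Phi>: "smooth_on U \<Phi>" and sG: "smooth_on (ball (\<Phi> p0) \<epsilon>) G"
    and ht: "\<And>q. q \<in> ball (\<Phi> p0) \<epsilon> \<Longrightarrow> snd (f (G q)) = fst q"
    and E: "\<And>q. q \<in> ball (\<Phi> p0) \<epsilon> \<Longrightarrow> fff c (\<lambda>q. f (G q)) q (1, 0) (1, 0) = 1 / tnorm2 (G q)"
    and F: "\<And>q. q \<in> ball (\<Phi> p0) \<epsilon> \<Longrightarrow> fff c (\<lambda>q. f (G q)) q (1, 0) (0, 1) = 0"
    and H: "\<And>q. q \<in> ball (\<Phi> p0) \<epsilon> \<Longrightarrow> fff c (\<lambda>q. f (G q)) q (0, 1) (0, 1) = 1 / tnorm2 (G q)"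
    and L: "\<And>q (\<phi> :: plane \<Rightarrow> ambient). q \<in> ball (\<Phi> p0) \<epsilon> \<Longrightarrow> smooth_on D \<phi> \<Longrightarrow>
       laplace c f \<phi> (G q) = tnorm2 (G q) *\<^sub>R
         (hess (\<lambda>q. \<phi> (G q)) q (1, 0) (1, 0) + hess (\<lambda>q. \<phi> (G q)) q (0, 1) (0, 1))"
    by (rule isothermal_chart[OF p0 tnorm2(1)]; (rule that; assumption)?)
  let ?V = "ball (\<Phi> p0) \<epsilon>"
  define \<tau> where "\<tau> = tension c f"
  have s\<tau>: "smooth_on D \<tau>" unfolding \<tau>_def by (rule smooth_tension)
  have GD: "G q \<in> D" if "q \<in> ?V" for q using hom that U(3) by (auto simp: homeomorphism_def)
  have GV: "G ` ?V \<subseteq> D" using GD by blast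
  have comp: "smooth_on ?V (\<lambda>q. W (G q))" if "smooth_on D W" for W :: "plane \<Rightarrow> ambient"
    by (rule smooth_on_compose[OF open_ball openD GV sG that])
  have dG: "dd (\<lambda>q. W (G q)) q x = dd W (G q) (dd G q x)" if "smooth_on D W" "q \<in> ?V" for W :: "plane \<Rightarrow> ambient" and q x
    by (rule dd_compose[OF smooth_on_imp_differentiable[OF sG that(2)] smooth_on_imp_differentiable[OF that(1) GD[OF that(2)]]])
  have lap: "hess (\<lambda>q. W (G q)) q (1, 0) (1, 0) + hess (\<lambda>q. W (G q)) q (0, 1) (0, 1)
      = (1 / tnorm2 (G q)) *\<^sub>R laplace c f W (G q)" if "smooth_on D W" "q \<in> ?V" for W :: "plane \<Rightarrow> ambient" and q
    using L[OF that(2,1)] tnorm2(1)[OF GD[OF that(2)]] by simp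
  interpret I: isothermal_surface c h ?V "\<lambda>q. f (G q)" "\<lambda>q. \<tau> (G q)" "\<lambda>q. 1 / tnorm2 (G q)"
  proof
    show "c \<noteq> 0" "h > 0" "open ?V" "convex ?V" by (fact c h_pos(1)[OF p0] open_ball convex_ball)+
    show "smooth_on ?V (\<lambda>q. f (G q))" "smooth_on ?V (\<lambda>q. \<tau> (G q))" by (fact comp[OF smooth] comp[OF s\<tau>])+
    fix q assume q: "q \<in> ?V"
    note qD = GD[OF q]
    show "fst (f (G q)) \<in> space_form c" by (rule space_form[OF qD])
    show "inn c (dd (\<lambda>q. f (G q)) q (1, 0)) (dd (\<lambda>q. f (G q)) q (1, 0)) = 1 / tnorm2 (G q)"
      "inn c (dd (\<lambda>q. f (G q)) q (1, 0)) (dd (\<lambda>q. f (G q)) q (0, 1)) = 0"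
      "inn c (dd (\<lambda>q. f (G q)) q (0, 1)) (dd (\<lambda>q. f (G q)) q (0, 1)) = 1 / tnorm2 (G q)"
      using E[OF q] F[OF q] H[OF q] by (simp_all add: fff_def)
    have "snd (dd (\<lambda>q. f (G q)) q x) = fst x" for x
    proof -
      have "snd (dd (\<lambda>q. f (G q)) q x) = dd (\<lambda>q. snd (f (G q))) q x"
        by (rule dd_bounded_linear[OF bounded_linear_snd smooth_on_imp_differentiable[OF comp[OF smooth] q], symmetric])
      also have "\<dots> = dd fst q x" by (rule dd_cong_open[OF open_ball q]) (rule ht)
      also have "\<dots> = fst x" by (rule dd_eqI) (rule bounded_linear_imp_has_derivative[OF bounded_linear_fst])
      finally show ?thesis .
    qed
    then show "snd (dd (\<lambda>q. f (G q)) q (1, 0)) = 1" "snd (dd (\<lambda>q. f (G q)) q (0, 1)) = 0" by simp_all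
    show "inn c (\<tau> (G q)) (dd (\<lambda>q. f (G q)) q x) = 0" for x
      unfolding dG[OF smooth q] \<tau>_def by (rule inn_tension_df[OF qD])
    show "inn c (\<tau> (G q)) (hor (f (G q))) = 0" "snd (\<tau> (G q)) = 0" "inn c (\<tau> (G q)) (\<tau> (G q)) = 4 * h\<^sup>2"
      unfolding \<tau>_def by (fact inn_tension_hor[OF qD] snd_tension[OF qD] h_pos(2)[OF qD])+
    have t: "tnorm2 (G q) > 0" "tnorm2 (G q) < 1" by (fact tnorm2[OF qD])+
    then show "1 / tnorm2 (G q) > 1" by simp
    \<comment> \<open>Dividing by \<open>|T|^2\<close> passes from the Laplacian of the surface to
      the flat one, and \<open>(2 - |T|^2) / |T|^2\<close> is \<open>2 \<rho> - 1\<close>.\<close>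
    have m: "1 / tnorm2 (G q) * (c * (2 - tnorm2 (G q))) = c * (2 * (1 / tnorm2 (G q)) - 1)"
      using t by (simp add: field_simps)
    show "hess (\<lambda>q. f (G q)) q (1, 0) (1, 0) + hess (\<lambda>q. f (G q)) q (0, 1) (0, 1) =
      (1 / tnorm2 (G q)) *\<^sub>R \<tau> (G q) - (c * (2 * (1 / tnorm2 (G q)) - 1)) *\<^sub>R hor (f (G q))"
      unfolding lap[OF smooth q] laplace_f[OF qD] hmass_eq[OF qD] m[symmetric] \<tau>_def
      by (simp only: scaleR_diff_right scaleR_scaleR)
    obtain l where l: "laplace c f (tension c f) (G q)
        = - (c * (2 - tnorm2 (G q))) *\<^sub>R tension c f (G q) + l *\<^sub>R hor (f (G q))"
      using laplace_tension[OF qD] by blast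
    show "\<exists>l. hess (\<lambda>q. \<tau> (G q)) q (1, 0) (1, 0) + hess (\<lambda>q. \<tau> (G q)) q (0, 1) (0, 1) =
      - (c * (2 * (1 / tnorm2 (G q)) - 1)) *\<^sub>R \<tau> (G q) + l *\<^sub>R hor (f (G q))"
      unfolding lap[OF s\<tau> q] m[symmetric]
      unfolding \<tau>_def l
      by (rule exI[of _ "1 / tnorm2 (G q) * l"]) (simp add: scaleR_add_right scaleR_diff_right)
  qed
  have o': "\<Phi> p0 \<in> ?V" using \<epsilon>0 by simp
  have Gp0: "G (\<Phi> p0) = p0" using hom U(2) by (auto simp: homeomorphism_def)
  have r: "r = 1 / tnorm2 (G (\<Phi> p0))" by (simp add: r_def Gp0)
  define \<delta> where "\<delta> = (if I.b (\<Phi> p0) (1, 0) (0, 1) > 0 then - 1 else 1 :: real)"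
  define a where "a = acoef c h r"
  define b where "b = bcoef c h r"
  note fc = I.flat_chart_rot[OF o' r \<delta>_def]
  have c0: "c > 0" by (rule I.c_pos[OF o'])
  have r1: "r > 1" unfolding r using I.\<rho>1[OF o'] .
  note C = coef_facts[OF c0 h_pos(1)[OF p0] r1 fc(2), folded a_def b_def]
  define R where "R = rot \<delta> a b"
  \<comment> \<open>The inverse of \<open>R\<close> is \<open>r\<close> times its transpose, since
    its columns are orthogonal with squared length \<open>1 / r\<close>.\<close>
  define R' where "R' q = (r * (a * fst q - \<delta> * b * snd q), r * (b * fst q + \<delta> * a * snd q))" for q
  have \<delta>2: "\<delta> * \<delta> = 1" by (simp add: \<delta>_def)
  have ab: "r * (a * a + b * b) = 1" using C(5) r1 by (simp add: power2_eq_square)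
  have RR': "R (R' q) = q" for q
  proof -
    have "R (R' q) = (r * (a * a + b * b) * fst q, (\<delta> * \<delta>) * (r * (a * a + b * b)) * snd q)"
      by (simp add: R_def R'_def rot_def algebra_simps)
    then show ?thesis unfolding ab \<delta>2 by simp
  qed
  have R'R: "R' (R q) = q" for q
  proof -
    have "R' (R q) = (r * (a * (a * fst q + b * snd q) - (\<delta> * \<delta>) * b * (a * snd q - b * fst q)),
       r * (b * (a * fst q + b * snd q) + (\<delta> * \<delta>) * a * (a * snd q - b * fst q)))"
      by (simp add: R_def R'_def rot_def algebra_simps)
    also have "\<dots> = (r * (a * a + b * b) * fst q, r * (a * a + b * b) * snd q)"
      unfolding \<delta>2 by (simp add: algebra_simps)
    finally show ?thesis unfolding ab by simp
  qed
  let ?E = "R -` ?V"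
  have blR: "bounded_linear R" unfolding R_def by (rule bounded_linear_rot)
  have contR: "continuous_on A R" for A by (rule linear_continuous_on[OF blR])
  have contR': "continuous_on A R'" for A unfolding R'_def by (intro continuous_intros)
  have oE: "open ?E" by (rule open_vimage[OF open_ball contR])
  have sR: "smooth_on ?E R" by (rule smooth_on_bounded_linear[OF oE blR smooth_on_id[OF oE]])
  have RV: "R ` ?E = ?V" using RR' by (metis surjI surj_image_vimage_eq)
  have R'V: "R' ` ?V = ?E"
  proof (intro equalityI subsetI)
    fix q assume "q \<in> ?E"
    then have "R' (R q) \<in> R' ` ?V" by (intro imageI) simp
    then show "q \<in> R' ` ?V" by (simp only: R'R)
  qed (auto simp only: RR' vimage_eq)
  have homR: "homeomorphism ?V ?E R' R"
    unfolding homeomorphism_def RV R'V using contR contR' by (intro conjI ballI RR' R'R refl)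
  have hom': "homeomorphism U ?E (R' \<circ> \<Phi>) (G \<circ> R)" by (rule homeomorphism_compose[OF hom homR])
  show ?thesis
  proof (rule that[OF U oE hom'])
    show "smooth_on U (R' \<circ> \<Phi>)"
      unfolding R'_def o_def by (intro smooth_intros U s\<Phi>)
    show "smooth_on ?E (G \<circ> R)"
      unfolding o_def by (rule smooth_on_compose[OF oE open_ball _ sR sG]) auto
    show "tnorm2 p = tnorm2 p0" if p: "p \<in> U" for p
    proof -
      have "\<Phi> p \<in> ?V" "G (\<Phi> p) = p" using hom p by (auto simp: homeomorphism_def)
      then show ?thesis using I.\<rho>_constant[OF \<open>\<Phi> p \<in> ?V\<close> o'] by (simp add: Gp0)
    qed
    show "c > 0" "4 * h\<^sup>2 * r\<^sup>2 \<le> c" by (fact c0 fc(2))+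
    show "flat_chart c h (acoef c h r) (bcoef c h r) (h + sdisc c h r) (h - sdisc c h r) ?E
       (\<lambda>q. f ((G \<circ> R) q)) (\<lambda>q. tension c f ((G \<circ> R) q))"
      using fc(1) unfolding R_def a_def b_def \<tau>_def o_def .
  qed
qed

lemma flat: assumes p: "p \<in> D" shows "flat_at c f p"
proof -
  define r where "r = 1 / tnorm2 p"
  obtain U E \<Phi> \<Psi> where U: "open U" "p \<in> U" "U \<subseteq> D" "open E" and hom: "homeomorphism U E \<Phi> \<Psi>"
    and s: "smooth_on U \<Phi>" "smooth_on E \<Psi>"
    and fc: "flat_chart c h (acoef c h r) (bcoef c h r) (h + sdisc c h r) (h - sdisc c h r) E
       (\<lambda>q. f (\<Psi> q)) (\<lambda>q. tension c f (\<Psi> q))"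
    by (rule flat_coordinates[OF p, folded r_def])
  interpret F: flat_chart c h "acoef c h r" "bcoef c h r" "h + sdisc c h r" "h - sdisc c h r" E
    "\<lambda>q. f (\<Psi> q)" "\<lambda>q. tension c f (\<Psi> q)" by (rule fc)
  show ?thesis
  proof (rule flat_at_of_isometry[OF U(1,3) s(1) U(2)])
    fix q x y assume q: "q \<in> U"
    have qE: "\<Phi> q \<in> E" using hom q by (auto simp: homeomorphism_def)
    have "dd f q x = dd (\<lambda>p. f (\<Psi> p)) (\<Phi> q) (dd \<Phi> q x)" for x
    proof -
      have "dd f q x = dd (\<lambda>p. f (\<Psi> (\<Phi> p))) q x"
        by (rule dd_cong_open[OF U(1) q]) (use hom in \<open>auto simp: homeomorphism_def\<close>)
      also have "\<dots> = dd (\<lambda>p. f (\<Psi> p)) (\<Phi> q) (dd \<Phi> q x)"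
        by (rule dd_compose[OF smooth_on_imp_differentiable[OF s(1) q] F.diff_F[OF qE]])
      finally show ?thesis .
    qed
    then show "fff c f q x y = dd \<Phi> q x \<bullet> dd \<Phi> q y" by (simp add: fff_def F.iso[OF qE])
  qed
qed

text \<open>Umbilicity would make the second fundamental form in direction of the tension field
  \<open>2 h^2\<close> times the metric, whereas its value on a unit principal vector is
  \<open>2 h (h + s)\<close> with \<open>s > h > 0\<close>.\<close>

lemma not_umbilical:
  assumes p: "p \<in> D"
  shows "\<exists>q\<in>D. \<exists>x. shape_op c f q (mean_curv c f q) x \<noteq> (len c (mean_curv c f q))\<^sup>2 *\<^sub>R x"
proof (rule ccontr)
  assume "\<not> ?thesis"
  then have "shape_op c f q (mean_curv c f q) x = (len c (mean_curv c f q))\<^sup>2 *\<^sub>R x" if "q \<in> D" for q x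
    using that by blast
  then have umb: "shape_op c f q (mean_curv c f q) x = h\<^sup>2 *\<^sub>R x" if "q \<in> D" for q x
    unfolding cmc[OF that, symmetric] using that .
  define r where "r = 1 / tnorm2 p"
  obtain U E \<Phi> \<Psi> where U: "open U" "p \<in> U" "U \<subseteq> D" "open E" and hom: "homeomorphism U E \<Phi> \<Psi>"
    and s: "smooth_on U \<Phi>" "smooth_on E \<Psi>" and c0: "c > 0" and cr: "4 * h\<^sup>2 * r\<^sup>2 \<le> c"
    and fc: "flat_chart c h (acoef c h r) (bcoef c h r) (h + sdisc c h r) (h - sdisc c h r) E
       (\<lambda>q. f (\<Psi> q)) (\<lambda>q. tension c f (\<Psi> q))"
    by (rule flat_coordinates[OF p, folded r_def])
  interpret F: flat_chart c h "acoef c h r" "bcoef c h r" "h + sdisc c h r" "h - sdisc c h r" E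
    "\<lambda>q. f (\<Psi> q)" "\<lambda>q. tension c f (\<Psi> q)" by (rule fc)
  have h0: "h > 0" by (rule h_pos(1)[OF p])
  have r1: "r > 1" unfolding r_def using tnorm2[OF p] by simp
  have b: "inn c (hess f q x y) (tension c f q) = 2 * h\<^sup>2 * fff c f q x y" if q: "q \<in> D" for q x y
  proof -
    have 1: "inn c (second_ff c f q x y) (mean_curv c f q) = inn c (hess f q x y) (tension c f q) / 2" for y
    proof -
      have "inn c (dd f q z) (tension c f q) = 0" for z using inn_tension_df[OF q, of z] by (simp only: inn_commute)
      then show ?thesis
        by (simp add: second_ff_eq[OF q] mean_curv_eq[OF q] inn_simps inn_tproj_tangent[OF inn_tension_hor[OF q]])
    qed
    \<comment> \<open>\<open>hess\<close> is visibly linear in the outer direction; its symmetry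
      transfers this to the other argument.\<close>
    have l: "linear (\<lambda>y. inn c (hess f q x y) (tension c f q) / 2)"
    proof -
      have "linear (\<lambda>y. inn c (hess f q y x) (tension c f q) / 2)"
        using linear_compose[OF linear_compose[OF linear_dd[OF smooth_df q] linear_inn_left]
          bounded_linear.linear[OF bounded_linear_divide]] by (simp add: o_def)
      moreover have "(\<lambda>y. inn c (hess f q x y) (tension c f q) / 2) = (\<lambda>y. inn c (hess f q y x) (tension c f q) / 2)"
        by (rule ext, subst hess_commute[OF q]) simp
      ultimately show ?thesis by simp
    qed
    have "fff c f q (shape_op c f q (mean_curv c f q) x) y = inn c (hess f q x y) (tension c f q) / 2"
      unfolding shape_op_def 1 by (rule fff_metric_dual[OF q l])
    moreover have "fff c f q (h\<^sup>2 *\<^sub>R x) y = h\<^sup>2 * fff c f q x y"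
      using linear_scale[OF linear_fff[OF q, of y], of "h\<^sup>2" x] by (simp add: fff_commute)
    ultimately show ?thesis unfolding umb[OF q] by simp
  qed
  define q where "q = \<Phi> p"
  have q: "q \<in> E" and \<Psi>q: "\<Psi> q \<in> D" using hom U(2,3) by (auto simp: homeomorphism_def q_def)
  have dE: "dd (\<lambda>q. W (\<Psi> q)) q x = dd W (\<Psi> q) (dd \<Psi> q x)" if "smooth_on D W" for W :: "plane \<Rightarrow> ambient" and x
    by (rule dd_compose[OF smooth_on_imp_differentiable[OF s(2) q] smooth_on_imp_differentiable[OF that \<Psi>q]])
  have "inn c (dd (\<lambda>q. tension c f (\<Psi> q)) q (1, 0)) (dd (\<lambda>q. f (\<Psi> q)) q (1, 0))
     = - (2 * h\<^sup>2) * inn c (dd (\<lambda>q. f (\<Psi> q)) q (1, 0)) (dd (\<lambda>q. f (\<Psi> q)) q (1, 0))"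
  proof -
    have "inn c (dd (tension c f) (\<Psi> q) x) (dd f (\<Psi> q) x) = - inn c (tension c f (\<Psi> q)) (hess f (\<Psi> q) x x)" for x
      by (rule inn_const_derivative[OF openD \<Psi>q smooth_tension smooth_df inn_tension_df])
    then have "inn c (dd (tension c f) (\<Psi> q) x) (dd f (\<Psi> q) x) = - (2 * h\<^sup>2) * fff c f (\<Psi> q) x x" for x
      by (simp add: b[OF \<Psi>q] inn_commute[of c "tension c f (\<Psi> q)"])
    then show ?thesis unfolding dE[OF smooth_tension] dE[OF smooth] fff_def .
  qed
  then have "- (2 * h * (h + sdisc c h r)) = - (2 * h\<^sup>2)"
    unfolding F.d\<tau>(1)[OF q] F.Buu[OF q] F.iso[OF q] by simp
  then have "sdisc c h r = 0" using h0 by (simp add: power2_eq_square algebra_simps)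
  then show False using coef_facts(1)[OF c0 h0 r1 cr] h0 by simp
qed

end

section \<open>The surface\<close>

lemma local_param_preimage_open:
  assumes "local_param S D x" "openin S W"
  shows "open {p \<in> D. x p \<in> W}"
proof -
  have D: "open D" and hom: "homeomorphic_map (top_of_set D) (subtopology S (x ` D)) x"
    using assms(1) by (auto simp: local_param_def)
  have "continuous_map (top_of_set D) S x"
    using homeomorphic_imp_continuous_map[OF hom] continuous_map_in_subtopology by blast
  from openin_continuous_map_preimage[OF this assms(2)] have "openin (top_of_set D) {p \<in> D. x p \<in> W}" by simp
  then show ?thesis using D openin_open_trans by blast
qed

lemma local_param_inj: "local_param S D x \<Longrightarrow> inj_on x D"
  unfolding local_param_def by (metis homeomorphic_imp_injective_map topspace_euclidean_subtopology)

lemma local_param_open_image: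
  assumes "local_param S D x" "open U" "U \<subseteq> D"
  shows "openin S (x ` U)"
proof -
  have o: "openin S (x ` D)" and hom: "homeomorphic_map (top_of_set D) (subtopology S (x ` D)) x"
    using assms(1) by (auto simp: local_param_def)
  have "open D" using assms(1) by (simp add: local_param_def)
  then have "openin (top_of_set D) U" using assms(2,3) by (simp add: openin_open_eq)
  then have "openin (subtopology S (x ` D)) (x ` U)"
    using homeomorphic_map_openness[OF hom, of U] assms(3) by simp
  then show ?thesis using openin_trans_full o by blast
qed

lemma local_param_reparam:
  assumes lp: "local_param S D x" and U: "open U" "U \<subseteq> D" and E: "open E" and hom: "homeomorphism U E \<Phi> \<Psi>"
  shows "local_param S E (x \<circ> \<Psi>)"
proof -
  have hx: "homeomorphic_map (top_of_set D) (subtopology S (x ` D)) x" and o: "openin S (x ` D)"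
    using lp by (auto simp: local_param_def)
  have \<Psi>E: "\<Psi> ` E = U" using hom by (simp add: homeomorphism_def)
  have img: "(x \<circ> \<Psi>) ` E = x ` U" unfolding image_comp[symmetric] \<Psi>E ..
  have "homeomorphic_maps (top_of_set E) (top_of_set U) \<Psi> \<Phi>"
    using hom unfolding homeomorphic_maps_def homeomorphism_def by auto
  then have 1: "homeomorphic_map (top_of_set E) (top_of_set U) \<Psi>"
    unfolding homeomorphic_map_maps by blast
  have sub: "x ` U \<subseteq> x ` D" using U by blast
  have xD: "topspace (subtopology S (x ` D)) = x ` D"
    using o openin_subset by (simp add: inf.absorb2 openin_subset)
  have "homeomorphic_map (subtopology (top_of_set D) U) (subtopology (subtopology S (x ` D)) (x ` U)) x"
  proof (rule homeomorphic_map_subtopologies[OF hx])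
    have "topspace (top_of_set D) \<inter> U = U" using U(2) by auto
    moreover have "topspace (subtopology S (x ` D)) \<inter> x ` U = x ` U" unfolding xD using sub by blast
    ultimately show "x ` (topspace (top_of_set D) \<inter> U) = topspace (subtopology S (x ` D)) \<inter> x ` U" by simp
  qed
  moreover have "subtopology (top_of_set D) U = top_of_set U"
    using U(2) by (simp add: subtopology_subtopology inf.absorb2)
  moreover have "subtopology (subtopology S (x ` D)) (x ` U) = subtopology S (x ` U)"
    using sub by (simp add: subtopology_subtopology inf.absorb2)
  ultimately have 2: "homeomorphic_map (top_of_set U) (subtopology S (x ` U)) x" by simp
  show ?thesis
    unfolding local_param_def img
    using E local_param_open_image[OF lp U] homeomorphic_map_compose[OF 1 2] by blast
qed

text \<open>The new transition maps are the old ones composed with \<open>\<Psi>\<close> on one side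
  and with \<open>\<Phi>\<close> on the other; their domains are open because charts are
  homeomorphisms onto open sets.\<close>

lemma compatible_reparam:
  assumes lpx: "local_param S D x" and lpy: "local_param S F y" and xy: "compatible D x F y"
    and U: "open U" "U \<subseteq> D" and E: "open E" and hom: "homeomorphism U E \<Phi> \<Psi>"
    and s: "smooth_on U \<Phi>" "smooth_on E \<Psi>"
  shows "compatible E (x \<circ> \<Psi>) F y"
  unfolding compatible_def
proof (intro conjI)
  have \<Psi>E: "\<Psi> ` E = U" and \<Phi>\<Psi>: "\<And>q. q \<in> E \<Longrightarrow> \<Phi> (\<Psi> q) = q" using hom by (auto simp: homeomorphism_def)
  have img: "(x \<circ> \<Psi>) ` E = x ` U" unfolding image_comp[symmetric] \<Psi>E ..
  have oy: "openin S (y ` F)" using lpy by (simp add: local_param_def)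
  let ?O = "{p \<in> D. x p \<in> y ` F}"
  have o: "open ?O" by (rule local_param_preimage_open[OF lpx oy])
  have "continuous_on E \<Psi>" using hom by (simp add: homeomorphism_def)
  then have "open (E \<inter> \<Psi> -` ?O)" using E o by (intro continuous_open_preimage)
  moreover have "E \<inter> \<Psi> -` ?O = {p \<in> E. (x \<circ> \<Psi>) p \<in> y ` F}" using \<Psi>E U(2) by auto
  ultimately have o1: "open {p \<in> E. (x \<circ> \<Psi>) p \<in> y ` F}" by simp
  have "smooth_on {p \<in> E. (x \<circ> \<Psi>) p \<in> y ` F} (\<lambda>p. (inv_into F y \<circ> x) (\<Psi> p))"
  proof (rule smooth_on_compose[OF o1 o, where f = \<Psi> and g = "inv_into F y \<circ> x"])
    show "\<Psi> ` {p \<in> E. (x \<circ> \<Psi>) p \<in> y ` F} \<subseteq> ?O" using \<Psi>E U(2) by auto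
    show "smooth_on {p \<in> E. (x \<circ> \<Psi>) p \<in> y ` F} \<Psi>" by (rule smooth_on_subset[OF s(2)]) blast
    show "smooth_on ?O (inv_into F y \<circ> x)" using xy by (simp add: compatible_def)
  qed
  then show "smooth_on {p \<in> E. (x \<circ> \<Psi>) p \<in> y ` F} (inv_into F y \<circ> (x \<circ> \<Psi>))" by (simp add: o_def)
  let ?O2 = "{p \<in> F. y p \<in> x ` U}"
  have o2: "open ?O2" by (rule local_param_preimage_open[OF lpy local_param_open_image[OF lpx U]])
  have inv: "inv_into D x (y p) \<in> U" "(inv_into E (x \<circ> \<Psi>) \<circ> y) p = \<Phi> ((inv_into D x \<circ> y) p)" if p: "p \<in> ?O2" for p
  proof -
    obtain d where d: "d \<in> E" "y p = x (\<Psi> d)" using p \<Psi>E by auto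
    have "\<Psi> d \<in> D" "\<Psi> d \<in> U" using d(1) \<Psi>E U(2) by blast+
    then have iD: "inv_into D x (y p) = \<Psi> d" unfolding d(2) by (intro inv_into_f_f local_param_inj[OF lpx])
    then show "inv_into D x (y p) \<in> U" using \<open>\<Psi> d \<in> U\<close> by simp
    have "inj_on (x \<circ> \<Psi>) E" by (rule local_param_inj[OF local_param_reparam[OF lpx U E hom]])
    then have "inv_into E (x \<circ> \<Psi>) ((x \<circ> \<Psi>) d) = d" using d(1) by (rule inv_into_f_f)
    then show "(inv_into E (x \<circ> \<Psi>) \<circ> y) p = \<Phi> ((inv_into D x \<circ> y) p)"
      using d iD \<Phi>\<Psi>[OF d(1)] by simp
  qed
  have "smooth_on ?O2 (\<lambda>p. \<Phi> ((inv_into D x \<circ> y) p))"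
  proof (rule smooth_on_compose[OF o2 U(1), where f = "inv_into D x \<circ> y" and g = \<Phi>])
    show "(inv_into D x \<circ> y) ` ?O2 \<subseteq> U" by (rule image_subsetI) (use inv(1) in simp)
    have "smooth_on {p \<in> F. y p \<in> x ` D} (inv_into D x \<circ> y)" using xy by (simp add: compatible_def)
    then show "smooth_on ?O2 (inv_into D x \<circ> y)" by (rule smooth_on_subset) (use U(2) in blast)
  qed (fact s(1))
  then have "smooth_on ?O2 (inv_into E (x \<circ> \<Psi>) \<circ> y)"
    using smooth_on_cong[OF o2, of "inv_into E (x \<circ> \<Psi>) \<circ> y" "\<lambda>p. \<Phi> ((inv_into D x \<circ> y) p)"] inv(2) by blast
  then show "smooth_on {p \<in> F. y p \<in> (x \<circ> \<Psi>) ` E} (inv_into E (x \<circ> \<Psi>) \<circ> y)" unfolding img .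
qed

text \<open>The tangential part of \<open>xi\<close> is determined by its pairings with tangent
  vectors, and the differential of the transition map identifies the tangent planes. This makes
  \<open>|T|\<close> a function on the surface, so that connectedness can be used.\<close>

lemma T_part_chart_independent:
  assumes c: "c \<noteq> 0" and lpx: "local_param S D x" and lpy: "local_param S F y" and xy: "compatible D x F y"
    and ix: "immersion c D (\<psi> \<circ> x)" and iy: "immersion c F (\<psi> \<circ> y)"
    and p: "p \<in> D" and q: "q \<in> F" and eq: "x p = y q"
  shows "T_part c (\<psi> \<circ> x) p = T_part c (\<psi> \<circ> y) q"
proof -
  have oD: "open D" "open F" using lpx lpy by (auto simp: local_param_def)
  interpret X: patch c D "\<psi> \<circ> x" by unfold_locales (fact c oD ix)+
  interpret Y: patch c F "\<psi> \<circ> y" by unfold_locales (fact c oD iy)+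
  let ?O = "{p \<in> D. x p \<in> y ` F}"
  define \<phi> where "\<phi> = inv_into F y \<circ> x"
  have o: "open ?O" by (rule local_param_preimage_open[OF lpx]) (use lpy in \<open>simp add: local_param_def\<close>)
  have pO: "p \<in> ?O" using p q eq by auto
  have s: "smooth_on ?O \<phi>" using xy by (simp add: compatible_def \<phi>_def)
  have \<phi>p: "\<phi> p = q" using inv_into_f_f[OF local_param_inj[OF lpy] q] by (simp add: \<phi>_def eq)
  have fac: "(\<psi> \<circ> x) p = (\<psi> \<circ> y) (\<phi> p)" if "p \<in> ?O" for p
    using that by (simp add: \<phi>_def f_inv_into_f)
  have d: "dd (\<psi> \<circ> x) p v = dd (\<psi> \<circ> y) q (dd \<phi> p v)" for v
  proof -
    have "dd (\<psi> \<circ> x) p v = dd (\<lambda>p. (\<psi> \<circ> y) (\<phi> p)) p v" by (rule dd_cong_open[OF o pO]) (rule fac)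
    also have "\<dots> = dd (\<psi> \<circ> y) (\<phi> p) (dd \<phi> p v)"
      by (rule dd_compose[OF smooth_on_imp_differentiable[OF s pO]]) (simp only: \<phi>p Y.diff_f[OF q])
    finally show ?thesis by (simp only: \<phi>p)
  qed
  \<comment> \<open>Injectivity is inherited from the immersion in the first chart; for linear maps
    of the plane it gives surjectivity.\<close>
  have "inj (dd \<phi> p)"
  proof (rule injI)
    fix v w assume "dd \<phi> p v = dd \<phi> p w"
    then have "dd (\<psi> \<circ> x) p v = dd (\<psi> \<circ> x) p w" by (simp only: d)
    then show "v = w" using X.inj[OF p] by (rule injD[rotated])
  qed
  then have surj: "surj (dd \<phi> p)" by (rule linear_injective_imp_surjective[OF linear_dd[OF s pO]]) simp
  define u where "u = X.grad_height p"
  have T: "T_part c (\<psi> \<circ> x) p = dd (\<psi> \<circ> y) q (dd \<phi> p u)" unfolding X.T_part_eq[OF p] u_def d ..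
  have "tang c (\<psi> \<circ> y) q xi = dd (\<psi> \<circ> y) q (dd \<phi> p u)"
  proof (rule Y.tang_unique[OF q])
    fix v
    obtain w where w: "v = dd \<phi> p w" using surj by (metis surjD)
    show "inn c (dd (\<psi> \<circ> y) q (dd \<phi> p u)) (dd (\<psi> \<circ> y) q v) = inn c xi (dd (\<psi> \<circ> y) q v)"
      unfolding w d[symmetric] inn_xi using X.fff_grad_height[OF p, of w] by (simp only: u_def fff_def)
  qed
  then show ?thesis unfolding T T_part_def[of c "\<psi> \<circ> y"] by simp
qed

section \<open>From local charts to the whole surface\<close>

theorem theorem4p2:
  fixes c h :: real
    and S :: "'s topology"
    and A :: "(plane set \<times> (plane \<Rightarrow> 's)) set"
    and \<psi> :: "'s \<Rightarrow> ambient"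
  assumes c: "c \<noteq> 0"
    and surface: "immersed_surface c S A \<psi>"
    and biharmonic: "biharmonic c A \<psi>"
    and cmc: "cmc c A \<psi> h"
    and H_nonzero: "everywhere A \<psi> (\<lambda>f p. mean_curv c f p \<noteq> 0)"
    and H_orthogonal: "everywhere A \<psi> (\<lambda>f p. inn c (mean_curv c f p) xi = 0)"
    and T: "everywhere A \<psi> (\<lambda>f p. len c (T_part c f p) \<in> {0<..<1})"
  shows "c > 0 \<and>
    \<not> pseudo_umbilical c A \<psi> \<and> cmc c A \<psi> h \<and> biconservative c A \<psi> \<and> flat c A \<psi> \<and>
    everywhere A \<psi> (\<lambda>f p. h\<^sup>2 > - c * (1 - (len c (T_part c f p))\<^sup>2)) \<and>
    (\<exists>a b :: real.
      0 < a\<^sup>2 + b\<^sup>2 \<and> a\<^sup>2 + b\<^sup>2 < 1 \<and>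
      everywhere A \<psi> (\<lambda>f p. a\<^sup>2 + b\<^sup>2 = (len c (T_part c f p))\<^sup>2) \<and>
      h\<^sup>2 + c * (1 - a\<^sup>2 - b\<^sup>2) > 0 \<and>
      (let \<kappa>11 = h + sqrt (h\<^sup>2 + c * (1 - a\<^sup>2 - b\<^sup>2));
           \<kappa>21 = \<bar>a\<bar> / sqrt (1 - a\<^sup>2 - b\<^sup>2) * \<kappa>11;
           \<kappa>12 = \<bar>h - sqrt (h\<^sup>2 + c * (1 - a\<^sup>2 - b\<^sup>2))\<bar>;
           \<kappa>22 = \<bar>b\<bar> / sqrt (1 - a\<^sup>2 - b\<^sup>2) * \<kappa>12
       in \<forall>s \<in> topspace S. \<exists>D y.
            s \<in> y ` D \<and> local_param S D y \<and> (\<forall>(E, x)\<in>A. compatible D y E x) \<and>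
            isometric_immersion c D (\<psi> \<circ> y) \<and>
            (\<forall>p\<in>D. inn c (dd (\<psi> \<circ> y) p (1, 0)) xi = a \<and> inn c (dd (\<psi> \<circ> y) p (0, 1)) xi = b) \<and>
            (\<forall>I \<alpha>. integral_curve D (1, 0) I \<alpha> \<longrightarrow>
               (if a = 0 then circle c I (\<psi> \<circ> y \<circ> \<alpha>) \<kappa>11
                else helix c I (\<psi> \<circ> y \<circ> \<alpha>) \<kappa>11 \<kappa>21)) \<and>
            (\<forall>I \<alpha>. integral_curve D (0, 1) I \<alpha> \<longrightarrow>
               helix c I (\<psi> \<circ> y \<circ> \<alpha>) \<kappa>12 \<kappa>22)) \<and>
      b\<^sup>2 > a\<^sup>2 \<and>
      h\<^sup>2 = c * (1 - a\<^sup>2 - b\<^sup>2) * (b\<^sup>2 - a\<^sup>2)\<^sup>2 / (4 * (1 - a\<^sup>2) * (1 - b\<^sup>2)))"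
proof -
  have ss: "smooth_surface S A" and im: "\<And>D x. (D, x) \<in> A \<Longrightarrow> immersion c D (\<psi> \<circ> x)"
    using surface by (auto simp: immersed_surface_def)
  have lp: "\<And>D x. (D, x) \<in> A \<Longrightarrow> local_param S D x"
    and cov: "(\<Union>(D, x)\<in>A. x ` D) = topspace S" and conn: "connected_space S" and ne: "topspace S \<noteq> {}"
    and compat: "\<And>D x E y. (D, x) \<in> A \<Longrightarrow> (E, y) \<in> A \<Longrightarrow> compatible D x E y"
    using ss by (auto simp: smooth_surface_def)
  have pt: "biharmonic_patch c D (\<psi> \<circ> x) h" if "(D, x) \<in> A" for D x
  proof unfold_locales
    show "c \<noteq> 0" by (rule c)
    show "open D" using lp[OF that] by (simp add: local_param_def)
    show "immersion c D (\<psi> \<circ> x)" by (rule im[OF that])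
    fix p assume p: "p \<in> D"
    show "bitension c (\<psi> \<circ> x) p = 0" using biharmonic that p by (auto simp: biharmonic_def everywhere_def)
    show "len c (mean_curv c (\<psi> \<circ> x) p) = h" using cmc that p by (auto simp: cmc_def everywhere_def)
    show "mean_curv c (\<psi> \<circ> x) p \<noteq> 0" using H_nonzero that p by (auto simp: everywhere_def)
    show "inn c (mean_curv c (\<psi> \<circ> x) p) xi = 0" using H_orthogonal that p by (auto simp: everywhere_def)
    show "len c (T_part c (\<psi> \<circ> x) p) \<in> {0<..<1}" using T that p unfolding everywhere_def by blast
  qed
  define t where "t x p = (len c (T_part c (\<psi> \<circ> x) p))\<^sup>2" for x p
  have t_patch: "t x p = patch.tnorm2 c (\<psi> \<circ> x) p" if "(D, x) \<in> A" "p \<in> D" for D x p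
    unfolding t_def by (rule biharmonic_patch.tnorm2(3)[OF pt[OF that(1)] that(2)])
  have t_indep: "t x p = t y q" if "(D, x) \<in> A" "(E, y) \<in> A" "p \<in> D" "q \<in> E" "x p = y q" for D x p E y q
    unfolding t_def
    using T_part_chart_independent[OF c lp[OF that(1)] lp[OF that(2)] compat[OF that(1,2)] im[OF that(1)] im[OF that(2)] that(3-5)]
    by simp
  have chart: "\<exists>D x p. (D, x) \<in> A \<and> p \<in> D \<and> x p = s" if "s \<in> topspace S" for s
    using that unfolding cov[symmetric] by auto
  obtain s0 where s0: "s0 \<in> topspace S" using ne by blast
  obtain D0 x0 p0 where A0: "(D0, x0) \<in> A" "p0 \<in> D0" "x0 p0 = s0" using chart[OF s0] by blast
  have const: "t x p = t x0 p0" if Dx: "(D, x) \<in> A" and p: "p \<in> D" for D x p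
  proof (rule ccontr)
    assume neq: "t x p \<noteq> t x0 p0"
    \<comment> \<open>The points whose \<open>|T|^2\<close> lies in \<open>K\<close>. Local
      constancy makes this set open for every \<open>K\<close>, so the value at \<open>p0\<close>
      and its complement would separate \<open>S\<close>.\<close>
    define W where "W K = {s. \<exists>D x p. (D, x) \<in> A \<and> p \<in> D \<and> x p = s \<and> t x p \<in> K}" for K
    have "openin S (W K)" for K
    proof (subst openin_subopen, intro ballI)
      fix s assume "s \<in> W K"
      then obtain D x p where p: "(D, x) \<in> A" "p \<in> D" "x p = s" "t x p \<in> K" by (auto simp: W_def)
      interpret P: biharmonic_patch c D "\<psi> \<circ> x" h by (rule pt[OF p(1)])
      obtain U where U: "open U" "p \<in> U" "U \<subseteq> D" "\<And>q. q \<in> U \<Longrightarrow> P.tnorm2 q = P.tnorm2 p"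
        using P.flat_coordinates[OF p(2)] by metis
      have "t x q \<in> K" if "q \<in> U" for q
      proof -
        have "t x q = P.tnorm2 q" "t x p = P.tnorm2 p"
          by (rule t_patch[OF p(1)], use U(3) that p(2) in blast)+
        then show ?thesis using U(4)[OF that] p(4) by simp
      qed
      then have "x ` U \<subseteq> W K" unfolding W_def using U(3) p(1) by blast
      then show "\<exists>T. openin S T \<and> s \<in> T \<and> T \<subseteq> W K"
        using local_param_open_image[OF lp[OF p(1)] U(1,3)] U(2) p(3) by blast
    qed
    moreover have "topspace S \<subseteq> W {t x0 p0} \<union> W (- {t x0 p0})"
    proof
      fix s assume "s \<in> topspace S"
      then obtain D x p where "(D, x) \<in> A" "p \<in> D" "x p = s" using chart by blast
      then show "s \<in> W {t x0 p0} \<union> W (- {t x0 p0})"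
        unfolding W_def by (cases "t x p = t x0 p0") blast+
    qed
    \<comment> \<open>A point may be seen in several charts; \<open>t_indep\<close> excludes that
      they assign it different values.\<close>
    moreover have "W {t x0 p0} \<inter> W (- {t x0 p0}) = {}"
    proof (rule ccontr)
      assume "W {t x0 p0} \<inter> W (- {t x0 p0}) \<noteq> {}"
      then obtain s where "s \<in> W {t x0 p0}" "s \<in> W (- {t x0 p0})" by blast
      then obtain D x p E y q where "(D, x) \<in> A" "p \<in> D" "x p = s" "t x p = t x0 p0"
        "(E, y) \<in> A" "q \<in> E" "y q = s" "t y q \<noteq> t x0 p0" by (auto simp: W_def)
      then show False using t_indep[of D x E y p q] by simp
    qed
    moreover have "s0 \<in> W {t x0 p0}" unfolding W_def using A0 by blast
    moreover have "x p \<in> W (- {t x0 p0})" unfolding W_def using Dx p neq by blast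
    ultimately show False using conn unfolding connected_space_def by blast
  qed
  \<comment> \<open>Now that \<open>|T|\<close> is a global constant, one \<open>r\<close>, hence
    one pair of \<open>a\<close> and \<open>b\<close>, serves every chart.\<close>
  define r where "r = 1 / t x0 p0"
  have rr: "1 / patch.tnorm2 c (\<psi> \<circ> x) p = r" if "(D, x) \<in> A" "p \<in> D" for D x p
    using const[OF that] t_patch[OF that] by (simp add: r_def)
  interpret P0: biharmonic_patch c D0 "\<psi> \<circ> x0" h by (rule pt[OF A0(1)])
  have h0: "h > 0" by (rule P0.h_pos(1)[OF A0(2)])
  have r1: "r > 1" using P0.tnorm2[OF A0(2)] rr[OF A0(1,2)] by (auto simp: r_def t_patch[OF A0(1,2)])
  obtain c0: "c > 0" and cr: "4 * h\<^sup>2 * r\<^sup>2 \<le> c"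
    using P0.flat_coordinates[OF A0(2), unfolded rr[OF A0(1,2)]] by metis
  define a where "a = acoef c h r"
  define b where "b = bcoef c h r"
  define \<sigma> where "\<sigma> = sdisc c h r"
  note C = coef_facts[OF c0 h0 r1 cr, folded a_def b_def \<sigma>_def]
  have tr: "t x p = 1 / r" if "(D, x) \<in> A" "p \<in> D" for D x p
    using const[OF that] by (simp add: r_def)
  have N: "1 - a\<^sup>2 - b\<^sup>2 = 1 - 1 / r" using C(5) by simp
  have \<sigma>: "sqrt (h\<^sup>2 + c * (1 - a\<^sup>2 - b\<^sup>2)) = \<sigma>" unfolding N \<sigma>_def sdisc_def ..
  have N0: "1 - 1 / r > 0" using r1 by simp
  have disc: "h\<^sup>2 + c * (1 - a\<^sup>2 - b\<^sup>2) > 0" unfolding N using c0 N0 by (simp add: add_nonneg_pos)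
  have main: "\<exists>E y. s \<in> y ` E \<and> local_param S E y \<and> (\<forall>(F, x)\<in>A. compatible E y F x) \<and>
      isometric_immersion c E (\<psi> \<circ> y) \<and>
      (\<forall>p\<in>E. inn c (dd (\<psi> \<circ> y) p (1, 0)) xi = a \<and> inn c (dd (\<psi> \<circ> y) p (0, 1)) xi = b) \<and>
      (\<forall>I \<alpha>. integral_curve E (1, 0) I \<alpha> \<longrightarrow>
         (if a = 0 then circle c I (\<psi> \<circ> y \<circ> \<alpha>) (h + \<sigma>)
          else helix c I (\<psi> \<circ> y \<circ> \<alpha>) (h + \<sigma>) (\<bar>a\<bar> / sqrt (1 - a\<^sup>2 - b\<^sup>2) * (h + \<sigma>)))) \<and>
      (\<forall>I \<alpha>. integral_curve E (0, 1) I \<alpha> \<longrightarrow>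
         helix c I (\<psi> \<circ> y \<circ> \<alpha>) \<bar>h - \<sigma>\<bar> (\<bar>b\<bar> / sqrt (1 - a\<^sup>2 - b\<^sup>2) * \<bar>h - \<sigma>\<bar>))"
    if s: "s \<in> topspace S" for s
  proof -
    obtain D x p where A: "(D, x) \<in> A" "p \<in> D" "x p = s" using chart[OF s] by blast
    interpret P: biharmonic_patch c D "\<psi> \<circ> x" h by (rule pt[OF A(1)])
    obtain U E \<Phi> \<Psi> where U: "open U" "p \<in> U" "U \<subseteq> D" and E: "open E" and hom: "homeomorphism U E \<Phi> \<Psi>"
      and sm: "smooth_on U \<Phi>" "smooth_on E \<Psi>"
      and fc: "flat_chart c h a b (h + \<sigma>) (h - \<sigma>) E
         (\<lambda>q. (\<psi> \<circ> x) (\<Psi> q)) (\<lambda>q. tension c (\<psi> \<circ> x) (\<Psi> q))"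
      by (rule P.flat_coordinates[OF A(2), unfolded rr[OF A(1,2)], folded a_def b_def \<sigma>_def])
    interpret F: flat_chart c h a b "h + \<sigma>" "h - \<sigma>" E
      "\<lambda>q. (\<psi> \<circ> x) (\<Psi> q)" "\<lambda>q. tension c (\<psi> \<circ> x) (\<Psi> q)" by (rule fc)
    have comp: "\<psi> \<circ> (x \<circ> \<Psi>) = (\<lambda>q. (\<psi> \<circ> x) (\<Psi> q))" by (simp add: o_def)
    have Np: "F.N = 1 - a\<^sup>2 - b\<^sup>2" by (rule F.N_def)
    have imm: "immersion c E (\<psi> \<circ> (x \<circ> \<Psi>))"
      unfolding immersion_def comp
    proof (intro conjI ballI)
      show "smooth_on E (\<lambda>q. (\<psi> \<circ> x) (\<Psi> q))" by (rule F.sF)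
      show "(\<lambda>q. (\<psi> \<circ> x) (\<Psi> q)) ` E \<subseteq> space_form c \<times> UNIV"
        by (rule image_subsetI, subst mem_Times_iff) (blast intro: F.space)
      fix q assume q: "q \<in> E"
      show "inj (dd (\<lambda>q. (\<psi> \<circ> x) (\<Psi> q)) q)"
      proof (rule injI)
        fix v w assume "dd (\<lambda>q. (\<psi> \<circ> x) (\<Psi> q)) q v = dd (\<lambda>q. (\<psi> \<circ> x) (\<Psi> q)) q w"
        then have "v \<bullet> z = w \<bullet> z" for z by (simp only: F.iso[OF q, symmetric])
        then show "v = w" using vector_eq_rdot by blast
      qed
    qed
    show ?thesis
    proof (intro exI conjI allI impI ballI)
      have "\<Psi> (\<Phi> p) = p" "\<Phi> p \<in> E" using hom U(2) by (auto simp: homeomorphism_def)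
      then show "s \<in> (x \<circ> \<Psi>) ` E" using A(3) by force
      show "local_param S E (x \<circ> \<Psi>)" by (rule local_param_reparam[OF lp[OF A(1)] U(1,3) E hom])
      show "case Fy of (F, y) \<Rightarrow> compatible E (x \<circ> \<Psi>) F y" if "Fy \<in> A" for Fy
        using that compatible_reparam[OF lp[OF A(1)] lp compat[OF A(1)] U(1,3) E hom sm] by (cases Fy) auto
      show "isometric_immersion c E (\<psi> \<circ> (x \<circ> \<Psi>))"
        unfolding isometric_immersion_def using imm F.iso by (simp add: fff_def comp del: o_apply)
      show "inn c (dd (\<psi> \<circ> (x \<circ> \<Psi>)) q (1, 0)) xi = a" "inn c (dd (\<psi> \<circ> (x \<circ> \<Psi>)) q (0, 1)) xi = b" if "q \<in> E" for q
        unfolding comp inn_xi by (rule F.su[OF that] F.sv[OF that])+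
    next
      fix I \<alpha> assume \<alpha>: "integral_curve E (1, 0) I \<alpha>"
      have k: "\<bar>h + \<sigma>\<bar> = h + \<sigma>" "h + \<sigma> > 0" using h0 C(1) by auto
      have fr: "frenet_curve c I (\<psi> \<circ> (x \<circ> \<Psi>) \<circ> \<alpha>) (h + \<sigma>) (\<bar>a\<bar> / sqrt (1 - a\<^sup>2 - b\<^sup>2) * (h + \<sigma>))"
        unfolding comp using F.frenet[of "(1, 0)" "h + \<sigma>" a, OF _ C(3) \<alpha>] k unfolding Np by simp
      \<comment> \<open>\<open>a = 0\<close> is the equality case of \<open>cr\<close>; the second
        curvature of the first family is then zero.\<close>
      show "if a = 0 then circle c I (\<psi> \<circ> (x \<circ> \<Psi>) \<circ> \<alpha>) (h + \<sigma>)
        else helix c I (\<psi> \<circ> (x \<circ> \<Psi>) \<circ> \<alpha>) (h + \<sigma>) (\<bar>a\<bar> / sqrt (1 - a\<^sup>2 - b\<^sup>2) * (h + \<sigma>))"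
      proof (cases "a = 0")
        case True
        then show ?thesis using fr k(2) by (simp add: circle_def)
      next
        case False
        have "\<bar>a\<bar> / sqrt (1 - a\<^sup>2 - b\<^sup>2) * (h + \<sigma>) > 0"
          unfolding N using False N0 k(2) by (intro mult_pos_pos divide_pos_pos) auto
        then show ?thesis using fr k(2) False by (simp add: helix_def)
      qed
    next
      fix I \<alpha> assume \<alpha>: "integral_curve E (0, 1) I \<alpha>"
      \<comment> \<open>As \<open>\<sigma> > h\<close>, the second principal curvature is negative,
        whence the absolute value; \<open>b > 0\<close> keeps the torsion of this family
        positive.\<close>
      have k: "h - \<sigma> \<noteq> 0" "\<bar>h - \<sigma>\<bar> > 0" using C(1) by auto
      have b0: "b \<ge> 0" using C(4) by simp
      have fr: "frenet_curve c I (\<psi> \<circ> (x \<circ> \<Psi>) \<circ> \<alpha>) \<bar>h - \<sigma>\<bar> (\<bar>b\<bar> / sqrt (1 - a\<^sup>2 - b\<^sup>2) * \<bar>h - \<sigma>\<bar>)"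
        unfolding comp using F.frenet[of "(0, 1)" "h - \<sigma>" b, OF _ b0 \<alpha>] k(1) unfolding Np by simp
      have "\<bar>b\<bar> / sqrt (1 - a\<^sup>2 - b\<^sup>2) * \<bar>h - \<sigma>\<bar> > 0"
        unfolding N using C(4) N0 k(2) by (intro mult_pos_pos divide_pos_pos) auto
      then show "helix c I (\<psi> \<circ> (x \<circ> \<Psi>) \<circ> \<alpha>) \<bar>h - \<sigma>\<bar> (\<bar>b\<bar> / sqrt (1 - a\<^sup>2 - b\<^sup>2) * \<bar>h - \<sigma>\<bar>)"
        using fr k(2) by (simp add: helix_def)
    qed
  qed
  have "\<not> pseudo_umbilical c A \<psi>"
    using P0.not_umbilical[OF A0(2)] A0(1) unfolding pseudo_umbilical_def everywhere_def by blast
  moreover have "biconservative c A \<psi>"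
    unfolding biconservative_def everywhere_def
  proof (intro ballI, clarify)
    fix D x p assume A: "(D, x) \<in> A" and p: "p \<in> D"
    interpret P: biharmonic_patch c D "\<psi> \<circ> x" h by (rule pt[OF A])
    show "tang c (\<psi> \<circ> x) p (bitension c (\<psi> \<circ> x) p) = 0"
      unfolding P.bih[OF p] tang_def by (simp add: inn_simps metric_trace_def)
  qed
  moreover have "flat c A \<psi>"
    unfolding flat_def everywhere_def using biharmonic_patch.flat[OF pt] by blast
  moreover have "everywhere A \<psi> (\<lambda>f p. h\<^sup>2 > - c * (1 - (len c (T_part c f p))\<^sup>2))"
    unfolding everywhere_def
  proof (intro ballI, clarify)
    fix D x p assume A: "(D, x) \<in> A" and p: "p \<in> D"
    have "- c * (1 - 1 / r) < 0" using c0 N0 by simp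
    also have "0 < h\<^sup>2" using h0 by simp
    finally show "- c * (1 - (len c (T_part c (\<psi> \<circ> x) p))\<^sup>2) < h\<^sup>2" using tr[OF A p] by (simp add: t_def)
  qed
  moreover have "everywhere A \<psi> (\<lambda>f p. a\<^sup>2 + b\<^sup>2 = (len c (T_part c f p))\<^sup>2)"
    unfolding everywhere_def using tr by (auto simp: t_def C(5))
  moreover have "0 < a\<^sup>2 + b\<^sup>2" "a\<^sup>2 + b\<^sup>2 < 1" unfolding C(5) using r1 by simp_all
  moreover have "b\<^sup>2 > a\<^sup>2"
  proof -
    have "h * (2 * r - 1) / (r * \<sigma>) > 0" using h0 r1 C(1) by (intro divide_pos_pos mult_pos_pos) auto
    then show ?thesis using C(6) by simp
  qed
  moreover have "h\<^sup>2 = c * (1 - a\<^sup>2 - b\<^sup>2) * (b\<^sup>2 - a\<^sup>2)\<^sup>2 / (4 * (1 - a\<^sup>2) * (1 - b\<^sup>2))"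
    unfolding a_def b_def by (rule coef_mean_curvature[OF c0 h0 r1 cr])
  ultimately show ?thesis
    using c0 cmc disc unfolding Let_def
    by (intro conjI exI[of _ a] exI[of _ b] ballI) (assumption | erule main[unfolded \<sigma>[symmetric]])+
qed

end
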